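(* (Uniqueness Theorem) Let $(\mathcal L,\eta)$ be a host algebra for the topological group $G$, and let $(\mathcal A,G,\alpha)$ be a $C^*$-action. Let $(\mathcal C,\eta_{\mathcal A},\eta_{\mathcal L})$ and $(\mathcal C^\sharp,\eta^\sharp_{\mathcal A},\eta^\sharp_{\mathcal L})$ be crossed product hosts for $(\alpha,\mathcal L)$ such that $\mathrm{Rep}(\alpha,\mathcal H)_{\eta_\times}=\mathrm{Rep}(\alpha,\mathcal H)_{\eta^\sharp_\times}$ for every Hilbert space $\mathcal H$. Then there exists a unique isomorphism $\phi:\mathcal C\to\mathcal C^\sharp$ with $\tilde\phi\circ\eta_{\mathcal A}=\eta^\sharp_{\mathcal A}$ and $\tilde\phi\circ\eta_{\mathcal L}=\eta^\sharp_{\mathcal L}$. In particular, full crossed product hosts for $(\alpha,\mathcal L)$ are isomorphic (via an isomorphism intertwining the structure maps in this way).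
   Context: Conventions. For a $C^*$-algebra $\mathcal B$, $M(\mathcal B)$ denotes its multiplier algebra. A morphism of $C^*$-algebras $\phi:\mathcal S\to M(\mathcal B)$ is non-degenerate if $\mathrm{span}(\phi(\mathcal S)\mathcal B)$ is dense in $\mathcal B$; it then extends uniquely to a strictly continuous unital homomorphism $\tilde\phi:M(\mathcal S)\to M(\mathcal B)$. $\mathrm{Rep}(\mathcal B,\mathcal H)$ is the set of non-degenerate representations of $\mathcal B$ on the complex Hilbert space $\mathcal H$; each $\pi\in\mathrm{Rep}(\mathcal B,\mathcal H)$ extends uniquely to a representation $\tilde\pi$ of $M(\mathcal B)$ on $\mathcal H$. $\mathrm{Rep}(G,\mathcal H)$ is the set of strong-operator continuous unitary representations of $G$ on $\mathcal H$. Host algebra. A host algebra for a topological group $G$ is a pair $(\mathcal L,\eta)$, with $\mathcal L$ a $C^*$-algebra and $\eta:G\to \mathrm U(M(\mathcal L))$ a group homomorphism, such that (H1) for each non-degenerate representation $\pi$ of $\mathcal L$, $\tilde\pi\circ\eta$ is a continuous unitary representation of $G$; (H2) for each $\mathcal H$ the map $\eta^*:\mathrm{Rep}(\mathcal L,\mathcal H)\to\mathrm{Rep}(G,\mathcal H)$, $\pi\mapsto\tilde\pi\circ\eta$, is injective. Elements of the range of $\eta^*$ are called $\mathcal L$-representations of $G$; for such $U$, $U_{\mathcal L}:=(\eta^* )^{-1}(U)\in\mathrm{Rep}(\mathcal L,\mathcal H)$. Actions. A $C^*$-action $(\mathcal A,G,\alpha)$ is a $C^*$-algebra $\mathcal A$,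 a topological group $G$ and a group homomorphism $\alpha:G\to\mathrm{Aut}(\mathcal A)$ (no continuity assumed). A covariant representation on $\mathcal H$ is a pair $(\pi,U)$ with $\pi\in\mathrm{Rep}(\mathcal A,\mathcal H)$, $U\in\mathrm{Rep}(G,\mathcal H)$ and $U(g)\pi(A)U(g)^*=\pi(\alpha_g(A))$ for all $g,A$; the set of these is $\mathrm{Rep}(\alpha,\mathcal H)$. $\mathrm{Rep}_{\mathcal L}(\alpha,\mathcal H)$ is the subset of those for which $U$ is an $\mathcal L$-representation of $G$. Crossed product host. A triple $(\mathcal C,\eta_{\mathcal A},\eta_{\mathcal L})$, with $\mathcal C$ a $C^*$-algebra, is a crossed product host for $(\alpha,\mathcal L)$ if: (CP1) $\eta_{\mathcal A}:\mathcal A\to M(\mathcal C)$ and $\eta_{\mathcal L}:\mathcal L\to M(\mathcal C)$ are morphisms of $C^*$-algebras; (CP2) $\eta_{\mathcal L}$ is non-degenerate; (CP3) $\tilde\eta_{\mathcal L}(\eta(g))\eta_{\mathcal A}(A)\tilde\eta_{\mathcal L}(\eta(g))^*=\eta_{\mathcal A}(\alpha_g(A))$ for all $A\in\mathcal A$, $g\in G$; (CP4) $\eta_{\mathcal A}(\mathcal A)\eta_{\mathcal L}(\mathcal L)\subseteq\mathcal C$ and $\mathcal C$ is generated as a $C^*$-algebra by this set. It is full if in addition (CP5): for every $(\pi,U)\in\mathrm{Rep}_{\mathcal L}(\alpha,\mathcal H)$ (any $\mathcal H$) there is a unique representation $\rho:\mathcal C\to B(\mathcal H)$ with $\rho(\eta_{\mathcal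 A}(A)\eta_{\mathcal L}(L))=\pi(A)U_{\mathcal L}(L)$ for all $A\in\mathcal A$, $L\in\mathcal L$. $\mathrm{Rep}(\alpha,\mathcal H)_{\eta_\times}\subseteq \mathrm{Rep}(\alpha,\mathcal H)$ denotes the range of the map $\eta_\times^*:\mathrm{Rep}(\mathcal C,\mathcal H)\to\mathrm{Rep}(\alpha,\mathcal H)$, $\rho\mapsto(\tilde\rho\circ\eta_{\mathcal A},\tilde\rho\circ\tilde\eta_{\mathcal L}\circ\eta)$; $\mathrm{Rep}(\alpha,\mathcal H)_{\eta_\times^\sharp}$ is the analogous range for $(\mathcal C^\sharp,\eta^\sharp_{\mathcal A},\eta^\sharp_{\mathcal L})$. *)

theory Defs
  imports "HOL-Analysis.Analysis"
begin

section \<open>\<open>C\<^sup>*\<close>-algebras\<close>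

text \<open>Neither class requires a unit, and the zero algebra is an instance of both.\<close>

class scaleC =
  fixes scaleC :: "complex \<Rightarrow> 'a \<Rightarrow> 'a"  (infixr "*\<^sub>C" 75)

class star_algebra = ring + scaleC +
  fixes star :: "'a \<Rightarrow> 'a"
  assumes scaleC_add_right: "a *\<^sub>C (x + y) = a *\<^sub>C x + a *\<^sub>C y"
    and scaleC_add_left: "(a + b) *\<^sub>C x = a *\<^sub>C x + b *\<^sub>C x"
    and scaleC_scaleC: "a *\<^sub>C b *\<^sub>C x = (a * b) *\<^sub>C x"
    and scaleC_one: "1 *\<^sub>C x = x"
    and mult_scaleC_left: "(a *\<^sub>C x) * y = a *\<^sub>C (x * y)"
    and mult_scaleC_right: "x * (a *\<^sub>C y) = a *\<^sub>C (x * y)"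
    and star_add: "star (x + y) = star x + star y"
    and star_scaleC: "star (a *\<^sub>C x) = cnj a *\<^sub>C star x"
    and star_mult: "star (x * y) = star y * star x"
    and star_star: "star (star x) = x"

class cstar_algebra = star_algebra + real_normed_algebra + banach +
  assumes scaleR_scaleC: "r *\<^sub>R x = complex_of_real r *\<^sub>C x"
    and norm_scaleC: "norm (a *\<^sub>C x) = cmod a * norm x"
    and cstar_identity: "norm (star x * x) = (norm x)\<^sup>2"

lemma norm_star: "norm (star x) = norm (x :: 'a::cstar_algebra)"
proof -
  have le: "norm y \<le> norm (star y)" for y :: 'a
  proof (cases "norm y = 0")
    case False
    have "norm y * norm y = norm (star y * y)"
      by (simp add: cstar_identity power2_eq_square)
    also have "\<dots> \<le> norm (star y) * norm y" by (rule norm_mult_ineq)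
    finally show ?thesis using False by (simp add: mult_right_le_imp_le)
  qed simp
  show ?thesis using le[of x] le[of "star x"] by (simp add: star_star)
qed

lemma bounded_linear_star: "bounded_linear (star :: 'a::cstar_algebra \<Rightarrow> 'a)"
  by (rule bounded_linear_intro[where K = 1])
     (simp_all add: star_add scaleR_scaleC star_scaleC norm_star)

lemma bounded_linear_scaleC: "bounded_linear (\<lambda>x :: 'a::cstar_algebra. c *\<^sub>C x)"
  by (rule bounded_linear_intro[where K = "cmod c"])
     (simp_all add: scaleC_add_right scaleR_scaleC scaleC_scaleC norm_scaleC mult.commute)

lemma scaleC_zero_right [simp]: "c *\<^sub>C (0 :: 'a::star_algebra) = 0"
  using scaleC_add_right[of c 0 "0 :: 'a"] by simp

lemma scaleC_minus_right: "c *\<^sub>C (- x) = - (c *\<^sub>C (x :: 'a::star_algebra))"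
  using scaleC_add_right[of c x "- x"] by (simp add: eq_neg_iff_add_eq_0 add.commute)

lemma scaleC_diff_right: "c *\<^sub>C (x - y) = c *\<^sub>C x - c *\<^sub>C (y :: 'a::star_algebra)"
  using scaleC_add_right[of c x "- y"] by (simp add: scaleC_minus_right)

definition star_hom :: "('a::star_algebra \<Rightarrow> 'b::star_algebra) \<Rightarrow> bool" where
  "star_hom \<phi> \<longleftrightarrow>
     (\<forall>x y. \<phi> (x + y) = \<phi> x + \<phi> y) \<and> (\<forall>c x. \<phi> (c *\<^sub>C x) = c *\<^sub>C \<phi> x) \<and>
     (\<forall>x y. \<phi> (x * y) = \<phi> x * \<phi> y) \<and> (\<forall>x. \<phi> (star x) = star (\<phi> x))"

definition star_iso :: "('a::star_algebra \<Rightarrow> 'b::star_algebra) \<Rightarrow> bool" where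
  "star_iso \<phi> \<longleftrightarrow> star_hom \<phi> \<and> bij \<phi>"

definition cstar_subalgebra :: "'a::cstar_algebra set \<Rightarrow> bool" where
  "cstar_subalgebra S \<longleftrightarrow> closed S \<and> 0 \<in> S \<and>
     (\<forall>x\<in>S. \<forall>y\<in>S. x + y \<in> S \<and> x * y \<in> S) \<and>
     (\<forall>x\<in>S. (\<forall>c. c *\<^sub>C x \<in> S) \<and> star x \<in> S)"


section \<open>Multiplier algebras\<close>

definition bounded_clinear :: "('a::cstar_algebra \<Rightarrow> 'b::cstar_algebra) \<Rightarrow> bool" where
  "bounded_clinear f \<longleftrightarrow> bounded_linear f \<and> (\<forall>c x. f (c *\<^sub>C x) = c *\<^sub>C f x)"

text \<open>\<open>M(\<B>)\<close> as the \<open>*\<close>-algebra of double centralizers: the pair \<open>(l, r)\<close> stands for the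
  multiplier \<open>m\<close> with \<open>l b = m b\<close> and \<open>r b = b m\<close>.\<close>

definition double_centralizer :: "('b::cstar_algebra \<Rightarrow> 'b) \<times> ('b \<Rightarrow> 'b) \<Rightarrow> bool" where
  "double_centralizer p \<longleftrightarrow> (case p of (l, r) \<Rightarrow>
     bounded_clinear l \<and> bounded_clinear r \<and>
     (\<forall>x y. l (x * y) = l x * y) \<and> (\<forall>x y. r (x * y) = x * r y) \<and>
     (\<forall>x y. r x * y = x * l y))"

typedef (overloaded) 'b multiplier =
  "{p :: ('b::cstar_algebra \<Rightarrow> 'b) \<times> ('b \<Rightarrow> 'b). double_centralizer p}"
  by (rule exI[of _ "(\<lambda>x. x, \<lambda>x. x)"])
     (simp add: double_centralizer_def bounded_clinear_def bounded_linear_ident)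

setup_lifting type_definition_multiplier

lift_definition lact :: "'b::cstar_algebra multiplier \<Rightarrow> 'b \<Rightarrow> 'b" is fst .

lift_definition ract :: "'b::cstar_algebra multiplier \<Rightarrow> 'b \<Rightarrow> 'b" is snd .

lift_definition embed :: "'b::cstar_algebra \<Rightarrow> 'b multiplier"
  is "\<lambda>b. (\<lambda>x. b * x, \<lambda>x. x * b)"
  by (simp add: double_centralizer_def bounded_clinear_def bounded_linear_mult_left
      bounded_linear_mult_right mult_scaleC_left mult_scaleC_right mult.assoc)

instantiation multiplier :: (cstar_algebra) star_algebra
begin

lift_definition zero_multiplier :: "'a multiplier" is "(\<lambda>x. 0, \<lambda>x. 0)"
  by (simp add: double_centralizer_def bounded_clinear_def bounded_linear_zero)

lift_definition plus_multiplier :: "'a multiplier \<Rightarrow> 'a multiplier \<Rightarrow> 'a multiplier"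
  is "\<lambda>(l1, r1) (l2, r2). (\<lambda>x. l1 x + l2 x, \<lambda>x. r1 x + r2 x)"
  by (auto simp: double_centralizer_def bounded_clinear_def bounded_linear_add
      scaleC_add_right distrib_left distrib_right)

lift_definition minus_multiplier :: "'a multiplier \<Rightarrow> 'a multiplier \<Rightarrow> 'a multiplier"
  is "\<lambda>(l1, r1) (l2, r2). (\<lambda>x. l1 x - l2 x, \<lambda>x. r1 x - r2 x)"
  by (auto simp: double_centralizer_def bounded_clinear_def bounded_linear_sub
      scaleC_diff_right left_diff_distrib right_diff_distrib)

lift_definition uminus_multiplier :: "'a multiplier \<Rightarrow> 'a multiplier"
  is "\<lambda>(l, r). (\<lambda>x. - l x, \<lambda>x. - r x)"
  by (auto simp: double_centralizer_def bounded_clinear_def bounded_linear_minus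
      scaleC_minus_right)

lift_definition times_multiplier :: "'a multiplier \<Rightarrow> 'a multiplier \<Rightarrow> 'a multiplier"
  is "\<lambda>(l1, r1) (l2, r2). (\<lambda>x. l1 (l2 x), \<lambda>x. r2 (r1 x))"
  by (auto simp: double_centralizer_def bounded_clinear_def intro: bounded_linear_compose)

lift_definition scaleC_multiplier :: "complex \<Rightarrow> 'a multiplier \<Rightarrow> 'a multiplier"
  is "\<lambda>c (l, r). (\<lambda>x. c *\<^sub>C l x, \<lambda>x. c *\<^sub>C r x)"
  by (auto simp: double_centralizer_def bounded_clinear_def mult_scaleC_left mult_scaleC_right
      scaleC_scaleC mult.commute intro: bounded_linear_compose[OF bounded_linear_scaleC])

lift_definition star_multiplier :: "'a multiplier \<Rightarrow> 'a multiplier"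
  is "\<lambda>(l, r). (\<lambda>x. star (r (star x)), \<lambda>x. star (l (star x)))"
proof (clarify, goal_cases)
  case (1 l r)
  then have *: "bounded_linear l" "bounded_linear r" "\<And>c x. l (c *\<^sub>C x) = c *\<^sub>C l x"
    "\<And>c x. r (c *\<^sub>C x) = c *\<^sub>C r x" "\<And>x y. l (x * y) = l x * y"
    "\<And>x y. r (x * y) = x * r y" "\<And>x y. r x * y = x * l y"
    by (auto simp: double_centralizer_def bounded_clinear_def)
  have "bounded_linear (\<lambda>x. star (f (star x)))" if "bounded_linear f" for f :: "'a \<Rightarrow> 'a"
    by (intro bounded_linear_compose[OF bounded_linear_star]
        bounded_linear_compose[OF that] bounded_linear_star)
  moreover have "star (l (star x)) * y = x * star (r (star y))" for x y
    using arg_cong[OF *(7)[of "star y" "star x"], of star] by (simp add: star_mult star_star)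
  ultimately show ?case
    using * by (simp add: double_centralizer_def bounded_clinear_def star_mult star_star star_scaleC)
qed

instance
proof
  fix x y z :: "'a multiplier" and a b :: complex
  show "x + y + z = x + (y + z)" by transfer (auto simp: add.assoc)
  show "x + y = y + x" by transfer (auto simp: add.commute)
  show "0 + x = x" by transfer auto
  show "- x + x = 0" by transfer auto
  show "x - y = x + - y" by transfer auto
  show "x * y * z = x * (y * z)" by transfer auto
  show "(x + y) * z = x * z + y * z"
    by transfer (auto simp: double_centralizer_def bounded_clinear_def linear_simps)
  show "x * (y + z) = x * y + x * z"
    by transfer (auto simp: double_centralizer_def bounded_clinear_def linear_simps)
  show "a *\<^sub>C (x + y) = a *\<^sub>C x + a *\<^sub>C y" by transfer (auto simp: scaleC_add_right)
  show "(a + b) *\<^sub>C x = a *\<^sub>C x + b *\<^sub>C x" by transfer (auto simp: scaleC_add_left)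
  show "a *\<^sub>C b *\<^sub>C x = (a * b) *\<^sub>C x" by transfer (auto simp: scaleC_scaleC)
  show "1 *\<^sub>C x = x" by transfer (auto simp: scaleC_one)
  show "(a *\<^sub>C x) * y = a *\<^sub>C (x * y)"
    by transfer (auto simp: double_centralizer_def bounded_clinear_def)
  show "x * (a *\<^sub>C y) = a *\<^sub>C (x * y)"
    by transfer (auto simp: double_centralizer_def bounded_clinear_def)
  show "star (x + y) = star x + star y" by transfer (auto simp: star_add)
  show "star (a *\<^sub>C x) = cnj a *\<^sub>C star x" by transfer (auto simp: star_scaleC)
  show "star (x * y) = star y * star x" by transfer (auto simp: star_star)
  show "star (star x) = x" by transfer (auto simp: star_star)
qed

end

instantiation multiplier :: (cstar_algebra) monoid_mult
begin

lift_definition one_multiplier :: "'a multiplier" is "(\<lambda>x. x, \<lambda>x. x)"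
  by (simp add: double_centralizer_def bounded_clinear_def bounded_linear_ident)

instance by standard (transfer; auto)+

end

lemma star_hom_embed: "star_hom embed"
  unfolding star_hom_def
  by (intro conjI allI; transfer)
     (auto simp: distrib_left distrib_right mult_scaleC_left mult_scaleC_right mult.assoc
        star_mult star_star)

definition unitary_mult :: "'b::cstar_algebra multiplier \<Rightarrow> bool" where
  "unitary_mult u \<longleftrightarrow> star u * u = 1 \<and> u * star u = 1"

definition nondegenerate_hom :: "('s::cstar_algebra \<Rightarrow> 'b::cstar_algebra multiplier) \<Rightarrow> bool" where
  "nondegenerate_hom \<phi> \<longleftrightarrow> closure (module.span scaleC {lact (\<phi> s) b |s b. True}) = UNIV"

text \<open>For a non-degenerate \<open>\<phi>\<close> the description below has exactly one solution, because it forces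
  \<open>\<psi>(m) \<phi>(s) b = \<phi>(m s) b\<close>; this solution is the strictly continuous extension of \<open>\<phi>\<close>.\<close>

definition mult_ext ::
  "('s::cstar_algebra \<Rightarrow> 'b::cstar_algebra multiplier) \<Rightarrow> 's multiplier \<Rightarrow> 'b multiplier" where
  "mult_ext \<phi> = (THE \<psi>. star_hom \<psi> \<and> \<psi> 1 = 1 \<and> (\<forall>s. \<psi> (embed s) = \<phi> s))"


section \<open>Hilbert spaces\<close>

text \<open>To quantify over Hilbert spaces inside a formula, a Hilbert space is a structure on a subset
  of a type \<open>'h\<close>.  The inner product is linear in its first argument.\<close>

record 'h hilbert =
  hcarrier :: "'h set"
  hzero :: 'h
  hadd :: "'h \<Rightarrow> 'h \<Rightarrow> 'h"
  hscale :: "complex \<Rightarrow> 'h \<Rightarrow> 'h"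
  hinner :: "'h \<Rightarrow> 'h \<Rightarrow> complex"

definition hnorm :: "'h hilbert \<Rightarrow> 'h \<Rightarrow> real" where
  "hnorm H x = sqrt (Re (hinner H x x))"

text \<open>The locale \<open>Metric_space\<close> wants a distance that is symmetric and nonnegative on the whole
  type, hence the value outside the carrier.\<close>

definition hdist :: "'h hilbert \<Rightarrow> 'h \<Rightarrow> 'h \<Rightarrow> real" where
  "hdist H x y = (if x \<in> hcarrier H \<and> y \<in> hcarrier H
                  then hnorm H (hadd H x (hscale H (-1) y)) else 0)"

abbreviation htopology :: "'h hilbert \<Rightarrow> 'h topology" where
  "htopology H \<equiv> Metric_space.mtopology (hcarrier H) (hdist H)"

locale hilbert_space =
  fixes H :: "'h hilbert"
  assumes zero_closed: "hzero H \<in> hcarrier H"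
    and add_closed: "x \<in> hcarrier H \<Longrightarrow> y \<in> hcarrier H \<Longrightarrow> hadd H x y \<in> hcarrier H"
    and scale_closed: "x \<in> hcarrier H \<Longrightarrow> hscale H c x \<in> hcarrier H"
    and add_assoc: "x \<in> hcarrier H \<Longrightarrow> y \<in> hcarrier H \<Longrightarrow> z \<in> hcarrier H \<Longrightarrow>
          hadd H (hadd H x y) z = hadd H x (hadd H y z)"
    and add_commute: "x \<in> hcarrier H \<Longrightarrow> y \<in> hcarrier H \<Longrightarrow> hadd H x y = hadd H y x"
    and add_zero: "x \<in> hcarrier H \<Longrightarrow> hadd H (hzero H) x = x"
    and add_inverse: "x \<in> hcarrier H \<Longrightarrow> \<exists>y\<in>hcarrier H. hadd H x y = hzero H"
    and scale_one: "x \<in> hcarrier H \<Longrightarrow> hscale H 1 x = x"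
    and scale_scale: "x \<in> hcarrier H \<Longrightarrow> hscale H a (hscale H b x) = hscale H (a * b) x"
    and scale_add_right: "x \<in> hcarrier H \<Longrightarrow> y \<in> hcarrier H \<Longrightarrow>
          hscale H a (hadd H x y) = hadd H (hscale H a x) (hscale H a y)"
    and scale_add_left: "x \<in> hcarrier H \<Longrightarrow>
          hscale H (a + b) x = hadd H (hscale H a x) (hscale H b x)"
    and inner_add: "x \<in> hcarrier H \<Longrightarrow> y \<in> hcarrier H \<Longrightarrow> z \<in> hcarrier H \<Longrightarrow>
          hinner H (hadd H x y) z = hinner H x z + hinner H y z"
    and inner_scale: "x \<in> hcarrier H \<Longrightarrow> y \<in> hcarrier H \<Longrightarrow>
          hinner H (hscale H a x) y = a * hinner H x y"
    and inner_commute: "x \<in> hcarrier H \<Longrightarrow> y \<in> hcarrier H \<Longrightarrow>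
          hinner H x y = cnj (hinner H y x)"
    and inner_nonneg: "x \<in> hcarrier H \<Longrightarrow> 0 \<le> Re (hinner H x x)"
    and inner_definite: "x \<in> hcarrier H \<Longrightarrow> hinner H x x = 0 \<Longrightarrow> x = hzero H"
    and complete: "Metric_space.mcomplete (hcarrier H) (hdist H)"

definition hsubspace :: "'h hilbert \<Rightarrow> 'h set \<Rightarrow> bool" where
  "hsubspace H S \<longleftrightarrow> S \<subseteq> hcarrier H \<and> hzero H \<in> S \<and>
     (\<forall>x\<in>S. \<forall>y\<in>S. hadd H x y \<in> S) \<and> (\<forall>c. \<forall>x\<in>S. hscale H c x \<in> S)"

text \<open>Operators are extensional functions (undefined outside the carrier), so that equality of
  operators is equality of functions.\<close>

definition bounded_ops :: "'h hilbert \<Rightarrow> ('h \<Rightarrow> 'h) set" where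
  "bounded_ops H = {T \<in> hcarrier H \<rightarrow>\<^sub>E hcarrier H.
     (\<forall>x\<in>hcarrier H. \<forall>y\<in>hcarrier H. T (hadd H x y) = hadd H (T x) (T y)) \<and>
     (\<forall>c. \<forall>x\<in>hcarrier H. T (hscale H c x) = hscale H c (T x)) \<and>
     (\<exists>K. \<forall>x\<in>hcarrier H. hnorm H (T x) \<le> K * hnorm H x)}"

abbreviation op_mult :: "'h hilbert \<Rightarrow> ('h \<Rightarrow> 'h) \<Rightarrow> ('h \<Rightarrow> 'h) \<Rightarrow> 'h \<Rightarrow> 'h" where
  "op_mult H S T \<equiv> compose (hcarrier H) S T"

definition op_id :: "'h hilbert \<Rightarrow> 'h \<Rightarrow> 'h" where
  "op_id H = (\<lambda>x\<in>hcarrier H. x)"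

definition is_adjoint :: "'h hilbert \<Rightarrow> ('h \<Rightarrow> 'h) \<Rightarrow> ('h \<Rightarrow> 'h) \<Rightarrow> bool" where
  "is_adjoint H T S \<longleftrightarrow> S \<in> bounded_ops H \<and>
     (\<forall>x\<in>hcarrier H. \<forall>y\<in>hcarrier H. hinner H (T x) y = hinner H x (S y))"

definition op_adj :: "'h hilbert \<Rightarrow> ('h \<Rightarrow> 'h) \<Rightarrow> 'h \<Rightarrow> 'h" where
  "op_adj H T = (THE S. is_adjoint H T S)"

definition unitary_op :: "'h hilbert \<Rightarrow> ('h \<Rightarrow> 'h) \<Rightarrow> bool" where
  "unitary_op H U \<longleftrightarrow> U \<in> bounded_ops H \<and>
     op_mult H (op_adj H U) U = op_id H \<and> op_mult H U (op_adj H U) = op_id H"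


section \<open>Representations\<close>

definition representation :: "'h hilbert \<Rightarrow> ('b::star_algebra \<Rightarrow> 'h \<Rightarrow> 'h) \<Rightarrow> bool" where
  "representation H \<pi> \<longleftrightarrow> (\<forall>b. \<pi> b \<in> bounded_ops H) \<and>
     (\<forall>a b. \<forall>x\<in>hcarrier H. \<pi> (a + b) x = hadd H (\<pi> a x) (\<pi> b x)) \<and>
     (\<forall>c b. \<forall>x\<in>hcarrier H. \<pi> (c *\<^sub>C b) x = hscale H c (\<pi> b x)) \<and>
     (\<forall>a b. \<pi> (a * b) = op_mult H (\<pi> a) (\<pi> b)) \<and>
     (\<forall>b. is_adjoint H (\<pi> b) (\<pi> (star b)))"

definition Rep :: "'h hilbert \<Rightarrow> ('b::cstar_algebra \<Rightarrow> 'h \<Rightarrow> 'h) set" where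
  "Rep H = {\<pi>. representation H \<pi> \<and>
     htopology H closure_of (hsubspace H hull {\<pi> b x |b x. x \<in> hcarrier H}) = hcarrier H}"

definition rep_ext ::
  "'h hilbert \<Rightarrow> ('b::cstar_algebra \<Rightarrow> 'h \<Rightarrow> 'h) \<Rightarrow> 'b multiplier \<Rightarrow> 'h \<Rightarrow> 'h" where
  "rep_ext H \<pi> = (THE \<psi>. representation H \<psi> \<and> (\<forall>b. \<psi> (embed b) = \<pi> b))"

text \<open>Topological groups are written additively, as in the library; they need not be commutative.\<close>

definition group_Rep :: "'h hilbert \<Rightarrow> ('g::topological_group_add \<Rightarrow> 'h \<Rightarrow> 'h) set" where
  "group_Rep H = {U. (\<forall>g. unitary_op H (U g)) \<and>
     (\<forall>g h. U (g + h) = op_mult H (U g) (U h)) \<and>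
     (\<forall>x\<in>hcarrier H. continuous_map euclidean (htopology H) (\<lambda>g. U g x))}"


section \<open>Host algebras\<close>

definition host_pullback ::
  "('g \<Rightarrow> 'l::cstar_algebra multiplier) \<Rightarrow> 'h hilbert \<Rightarrow> ('l \<Rightarrow> 'h \<Rightarrow> 'h) \<Rightarrow> 'g \<Rightarrow> 'h \<Rightarrow> 'h" where
  "host_pullback \<eta> H \<pi> = (\<lambda>g. rep_ext H \<pi> (\<eta> g))"

definition host_algebra ::
  "'h itself \<Rightarrow> ('g::topological_group_add \<Rightarrow> 'l::cstar_algebra multiplier) \<Rightarrow> bool" where
  "host_algebra _ \<eta> \<longleftrightarrow>
     (\<forall>g. unitary_mult (\<eta> g)) \<and> (\<forall>g h. \<eta> (g + h) = \<eta> g * \<eta> h) \<and>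
     (\<forall>H :: 'h hilbert. hilbert_space H \<longrightarrow>
        host_pullback \<eta> H ` Rep H \<subseteq> group_Rep H \<and> inj_on (host_pullback \<eta> H) (Rep H))"

definition host_inverse ::
  "('g \<Rightarrow> 'l::cstar_algebra multiplier) \<Rightarrow> 'h hilbert \<Rightarrow> ('g \<Rightarrow> 'h \<Rightarrow> 'h) \<Rightarrow> 'l \<Rightarrow> 'h \<Rightarrow> 'h" where
  "host_inverse \<eta> H = inv_into (Rep H) (host_pullback \<eta> H)"


section \<open>Actions and crossed product hosts\<close>

definition cstar_action :: "('g::group_add \<Rightarrow> 'a::cstar_algebra \<Rightarrow> 'a) \<Rightarrow> bool" where
  "cstar_action \<alpha> \<longleftrightarrow> (\<forall>g. star_iso (\<alpha> g)) \<and> (\<forall>g h. \<alpha> (g + h) = \<alpha> g \<circ> \<alpha> h)"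

definition cov_Rep ::
  "('g::topological_group_add \<Rightarrow> 'a::cstar_algebra \<Rightarrow> 'a) \<Rightarrow> 'h hilbert \<Rightarrow>
     (('a \<Rightarrow> 'h \<Rightarrow> 'h) \<times> ('g \<Rightarrow> 'h \<Rightarrow> 'h)) set" where
  "cov_Rep \<alpha> H = {(\<pi>, U). \<pi> \<in> Rep H \<and> U \<in> group_Rep H \<and>
     (\<forall>g A. op_mult H (op_mult H (U g) (\<pi> A)) (op_adj H (U g)) = \<pi> (\<alpha> g A))}"

definition cov_Rep_host ::
  "('g::topological_group_add \<Rightarrow> 'a::cstar_algebra \<Rightarrow> 'a) \<Rightarrow> ('g \<Rightarrow> 'l::cstar_algebra multiplier) \<Rightarrow>
     'h hilbert \<Rightarrow> (('a \<Rightarrow> 'h \<Rightarrow> 'h) \<times> ('g \<Rightarrow> 'h \<Rightarrow> 'h)) set" where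
  "cov_Rep_host \<alpha> \<eta> H = {(\<pi>, U) \<in> cov_Rep \<alpha> H. U \<in> host_pullback \<eta> H ` Rep H}"

text \<open>The algebra \<open>\<C>\<close> is the type \<open>'c\<close>, sitting in \<open>M(\<C>)\<close> as the range of \<open>embed\<close>.\<close>

definition crossed_product_host ::
  "('g::topological_group_add \<Rightarrow> 'a::cstar_algebra \<Rightarrow> 'a) \<Rightarrow> ('g \<Rightarrow> 'l::cstar_algebra multiplier) \<Rightarrow>
     ('a \<Rightarrow> 'c::cstar_algebra multiplier) \<Rightarrow> ('l \<Rightarrow> 'c multiplier) \<Rightarrow> bool" where
  "crossed_product_host \<alpha> \<eta> \<eta>A \<eta>L \<longleftrightarrow>
     star_hom \<eta>A \<and> star_hom \<eta>L \<and>
     nondegenerate_hom \<eta>L \<and>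
     (\<forall>A g. mult_ext \<eta>L (\<eta> g) * \<eta>A A * star (mult_ext \<eta>L (\<eta> g)) = \<eta>A (\<alpha> g A)) \<and>
     (\<forall>A L. \<eta>A A * \<eta>L L \<in> range embed) \<and>
     cstar_subalgebra hull {c. \<exists>A L. embed c = \<eta>A A * \<eta>L L} = UNIV"

definition full_crossed_product_host ::
  "'h itself \<Rightarrow> ('g::topological_group_add \<Rightarrow> 'a::cstar_algebra \<Rightarrow> 'a) \<Rightarrow>
     ('g \<Rightarrow> 'l::cstar_algebra multiplier) \<Rightarrow>
     ('a \<Rightarrow> 'c::cstar_algebra multiplier) \<Rightarrow> ('l \<Rightarrow> 'c multiplier) \<Rightarrow> bool" where
  "full_crossed_product_host _ \<alpha> \<eta> \<eta>A \<eta>L \<longleftrightarrow>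
     crossed_product_host \<alpha> \<eta> \<eta>A \<eta>L \<and>
     (\<forall>H :: 'h hilbert. hilbert_space H \<longrightarrow> (\<forall>(\<pi>, U) \<in> cov_Rep_host \<alpha> \<eta> H.
        \<exists>!\<rho>. representation H \<rho> \<and>
          (\<forall>A L c. embed c = \<eta>A A * \<eta>L L \<longrightarrow>
             \<rho> c = op_mult H (\<pi> A) (host_inverse \<eta> H U L))))"

definition cross_pullback ::
  "('g \<Rightarrow> 'l::cstar_algebra multiplier) \<Rightarrow>
     ('a \<Rightarrow> 'c::cstar_algebra multiplier) \<Rightarrow> ('l \<Rightarrow> 'c multiplier) \<Rightarrow>
     'h hilbert \<Rightarrow> ('c \<Rightarrow> 'h \<Rightarrow> 'h) \<Rightarrow> ('a \<Rightarrow> 'h \<Rightarrow> 'h) \<times> ('g \<Rightarrow> 'h \<Rightarrow> 'h)" where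
  "cross_pullback \<eta> \<eta>A \<eta>L H \<rho> =
     (rep_ext H \<rho> \<circ> \<eta>A, rep_ext H \<rho> \<circ> mult_ext \<eta>L \<circ> \<eta>)"

definition cross_range ::
  "('g \<Rightarrow> 'l::cstar_algebra multiplier) \<Rightarrow>
     ('a \<Rightarrow> 'c::cstar_algebra multiplier) \<Rightarrow> ('l \<Rightarrow> 'c multiplier) \<Rightarrow>
     'h hilbert \<Rightarrow> (('a \<Rightarrow> 'h \<Rightarrow> 'h) \<times> ('g \<Rightarrow> 'h \<Rightarrow> 'h)) set" where
  "cross_range \<eta> \<eta>A \<eta>L H = cross_pullback \<eta> \<eta>A \<eta>L H ` Rep H"

text \<open>For an isomorphism \<open>\<phi>\<close>, \<open>mult_ext (embed \<circ> \<phi>)\<close> is its extension to the multiplier algebras.\<close>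

definition host_iso ::
  "('a \<Rightarrow> 'c::cstar_algebra multiplier) \<Rightarrow> ('l \<Rightarrow> 'c multiplier) \<Rightarrow>
     ('a \<Rightarrow> 'd::cstar_algebra multiplier) \<Rightarrow> ('l \<Rightarrow> 'd multiplier) \<Rightarrow> ('c \<Rightarrow> 'd) \<Rightarrow> bool" where
  "host_iso \<eta>A \<eta>L \<eta>A' \<eta>L' \<phi> \<longleftrightarrow> star_iso \<phi> \<and>
     mult_ext (embed \<circ> \<phi>) \<circ> \<eta>A = \<eta>A' \<and> mult_ext (embed \<circ> \<phi>) \<circ> \<eta>L = \<eta>L'"

text \<open>A formula cannot quantify over types, so ``every Hilbert space'' means every Hilbert space
  whose carrier is a subset of \<open>'h\<close>.  The condition below makes \<open>'h\<close> large enough to contain a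
  copy of every Hilbert space that is the closure of a linear image of \<open>\<C>\<close>, in particular of
  every cyclic representation space of \<open>\<C>\<close>: each of its points is the limit of the image of some
  sequence in \<open>\<C>\<close>.\<close>

definition hilbert_universe :: "'h itself \<Rightarrow> 'c itself \<Rightarrow> bool" where
  "hilbert_universe _ _ \<longleftrightarrow> (\<exists>f :: (nat \<Rightarrow> 'c) \<Rightarrow> 'h. inj f)"

end

theory Submission
  imports Defs
begin

text \<open>A representation \<open>\<rho>\<close> of \<open>\<C>\<close> is determined on the generators \<open>\<eta>A A * \<eta>L L\<close> by its pair \<open>(\<pi>, U)\<close>,
  since injectivity of \<open>\<eta>\<^sup>*\<close> lets \<open>U\<close> determine the representation of \<open>\<L>\<close>.  Equality of the two ranges
  therefore matches every non-degenerate representation of one host with a representation of the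
  other that agrees with it on all corresponding \<open>*\<close>-polynomials in the generators.  By
  Gelfand--Naimark the norm of a host is attained in GNS representations, all of which live on
  subsets of \<open>'h\<close>, so the correspondence of \<open>*\<close>-polynomials is isometric and extends to the
  isomorphism.  For full hosts the matching representation comes from (CP5), once \<open>\<pi>\<close> is known to be
  non-degenerate: the reflection in the common kernel \<open>N\<close> of \<open>\<pi>\<close> commutes with \<open>U\<close>, hence, again by
  injectivity of \<open>\<eta>\<^sup>*\<close>, with \<open>\<L>\<close>, so that \<open>N\<close> is invariant under \<open>\<L>\<close> and \<open>\<C>\<close> vanishes on it.\<close>

section \<open>The square root of \<open>1 - x\<close>\<close>

text \<open>The maps \<open>rep_ext\<close> and \<open>mult_ext\<close> are definite descriptions,
  so nothing can be said about the two ranges before both extensions are shown to exist. The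
  obstacle there is to bound the action of a multiplier \<open>m\<close> on finite sums of vectors
  \<open>\<rho> b x\<close>. The bound comes from writing the square of \<open>norm m\<close> times
  \<open>1\<close>, minus \<open>star m * m\<close>, in the form \<open>star d * d\<close>; hence
  the multiplier algebra must first be made a C*-algebra with a usable notion of positivity. The
  same factorization yields contractivity of homomorphisms and representations of algebras that need
  have no unit. At the end the isomorphism is known only on the products
  \<open>\<eta>A A * \<eta>L L\<close>. Since \<open>\<eta>A\<close> is not assumed to be
  non-degenerate, a separate argument with approximate left units shows that the extension carries
  each structure map to its counterpart.\<close>

lemma star_zero [simp]: "star (0 :: 'a::star_algebra) = 0"
  using star_add[of 0 "0 :: 'a"] by simp

lemma star_minus: "star (- x) = - star (x :: 'a::star_algebra)"
  using star_add[of x "- x"] by (simp add: eq_neg_iff_add_eq_0 add.commute)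

lemma star_diff: "star (x - y) = star x - star (y :: 'a::star_algebra)"
  using star_add[of x "- y"] by (simp add: star_minus)

lemma star_scaleR: "star (r *\<^sub>R x) = r *\<^sub>R star (x :: 'a::cstar_algebra)"
  by (simp add: scaleR_scaleC star_scaleC)

lemma star_one [simp]: "star (1 :: 'a::{star_algebra,monoid_mult}) = 1"
  using star_mult[of "star (1::'a)" 1] by (simp add: star_star)

lemma star_power: "star (x ^ n) = star (x :: 'a::{star_algebra,monoid_mult}) ^ n"
  by (induction n) (simp_all add: star_mult power_commutes)

lemma norm_mult_self_sa: "star x = x \<Longrightarrow> norm (x * x) = (norm (x :: 'a::cstar_algebra))\<^sup>2"
  using cstar_identity[of x] by simp

lemma norm_mult_star: "norm (x * star x) = (norm (x :: 'a::cstar_algebra))\<^sup>2"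
  using cstar_identity[of "star x"] by (simp add: star_star norm_star)

text \<open>The C*-identity makes \<open>norm 1\<close> its own square. Only an inequality results,
  because in the zero algebra, which is allowed, \<open>1 = 0\<close>.\<close>

lemma norm_one_le: "norm (1 :: 'a::{cstar_algebra,monoid_mult}) \<le> 1"
  using norm_mult_self_sa[of "1::'a"] by (auto simp: power2_eq_square)

lemma norm_power_le: "norm (x ^ n) \<le> norm (x :: 'a::{cstar_algebra,monoid_mult}) ^ n"
proof (induction n)
  case (Suc n)
  have "norm (x ^ Suc n) \<le> norm x * norm (x ^ n)" by (simp add: norm_mult_ineq)
  also have "\<dots> \<le> norm x * norm x ^ n" using Suc by (intro mult_left_mono) auto
  finally show ?case by simp
qed (simp add: norm_one_le)

text \<open>The Taylor coefficients of \<open>sqrt (1 - x)\<close>.  They are nonpositive from index \<open>1\<close> on while their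
  partial sums stay nonnegative, so the series converges absolutely even for \<open>norm x = 1\<close>.\<close>

definition sqrt_coeff :: "nat \<Rightarrow> real" where
  "sqrt_coeff n = (-1) ^ n * ((1/2) gchoose n)"

lemma sqrt_coeff_0 [simp]: "sqrt_coeff 0 = 1" by (simp add: sqrt_coeff_def)

lemma sqrt_coeff_Suc: "sqrt_coeff (Suc n) = sqrt_coeff n * ((real n - 1/2) / (real n + 1))"
proof -
  have "((1/2::real) gchoose (Suc n)) * (real n + 1) = ((1/2) gchoose n) * (1/2 - real n)"
    using gbinomial_absorb_comp[of "1/2::real" n] gbinomial_mult_1[of "1/2::real" n]
    by (simp add: algebra_simps)
  then have "((1/2::real) gchoose (Suc n)) = ((1/2) gchoose n) * (1/2 - real n) / (real n + 1)"
    by (simp add: field_simps)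
  then show ?thesis unfolding sqrt_coeff_def power_Suc by (simp only:) (simp add: divide_simps algebra_simps)
qed

text \<open>The ratio of consecutive coefficients is negative at index 0 and positive afterwards, so
  the sign changes exactly once.\<close>

lemma sqrt_coeff_neg: "sqrt_coeff (Suc n) \<le> 0"
proof (induction n)
  case (Suc n)
  then show ?case
    by (subst sqrt_coeff_Suc) (intro mult_nonpos_nonneg divide_nonneg_nonneg, auto)
qed (simp add: sqrt_coeff_Suc)

text \<open>Summing coefficients multiplies a generating function by 1/(1 - x). The partial sums are
  therefore the coefficients \<open>d n\<close> of the power series of (1 - x) to the exponent -1/2,
  and these are products of nonnegative factors.\<close>

lemma sqrt_coeff_sum_nonneg: "0 \<le> (\<Sum>k\<le>n. sqrt_coeff k)"
proof -
  define d where "d n = (-1) ^ n * ((-1/2::real) gchoose n)" for n :: nat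
  have dS: "d (Suc n) = d n * ((real n + 1/2) / (real n + 1))" for n
  proof -
    have "((-1/2::real) gchoose (Suc n)) * (real n + 1) = ((-1/2) gchoose n) * (-1/2 - real n)"
      using gbinomial_absorb_comp[of "-1/2::real" n] gbinomial_mult_1[of "-1/2::real" n]
      by (simp add: algebra_simps)
    then have "((-1/2::real) gchoose (Suc n)) = ((-1/2) gchoose n) * (-1/2 - real n) / (real n + 1)"
      by (simp add: field_simps)
    then show ?thesis unfolding d_def power_Suc by (simp only:) (simp add: divide_simps algebra_simps)
  qed
  have dp: "0 \<le> d n" for n
  proof (induction n)
    case (Suc n)
    then show ?case unfolding dS by (intro mult_nonneg_nonneg divide_nonneg_nonneg) auto
  qed (simp add: d_def)
  have "(\<Sum>k\<le>n. sqrt_coeff k) = d n"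
    using gbinomial_sum_lower_neg[of "1/2::real" n]
    by (simp add: sqrt_coeff_def d_def mult.commute)
  then show ?thesis using dp by simp
qed

text \<open>By the Vandermonde identity the square of the series has the coefficients of 1 -
  x.\<close>

lemma sqrt_coeff_conv: "(\<Sum>k\<le>n. sqrt_coeff k * sqrt_coeff (n - k)) = (if n = 0 then 1 else if n = 1 then -1 else 0)"
proof -
  have "(\<Sum>k\<le>n. sqrt_coeff k * sqrt_coeff (n - k))
      = (\<Sum>k\<le>n. (-1) ^ n * (((1/2) gchoose k) * ((1/2) gchoose (n - k))))"
    by (intro sum.cong) (auto simp: sqrt_coeff_def power_add[symmetric])
  also have "\<dots> = (-1) ^ n * ((1::real) gchoose n)"
    using gbinomial_Vandermonde[of "1/2::real" "1/2" n]
    by (simp add: sum_distrib_left[symmetric] atMost_atLeast0)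
  also have "(1::real) gchoose n = of_nat (1 choose n)"
    using binomial_gbinomial[of 1 n, where 'a=real] by simp
  finally show ?thesis by (cases n; cases "n - 1") (auto simp: binomial_eq_0)
qed

lemma sqrt_coeff_abs_sum: "(\<Sum>k<n. norm (sqrt_coeff (Suc k))) \<le> 1"
proof -
  have "(\<Sum>k\<le>n. sqrt_coeff k) = 1 + (\<Sum>k<n. sqrt_coeff (Suc k))"
    by (metis lessThan_Suc_atMost sqrt_coeff_0 sum.lessThan_Suc_shift)
  also have "(\<Sum>k<n. sqrt_coeff (Suc k)) = - (\<Sum>k<n. norm (sqrt_coeff (Suc k)))"
    unfolding sum_negf[symmetric] by (intro sum.cong) (use sqrt_coeff_neg in auto)
  finally show ?thesis using sqrt_coeff_sum_nonneg[of n] by simp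
qed

text \<open>\<open>w\<close> is minus the tail of the series from index 1 on, so
  \<open>1 - w\<close> is the root. Its norm is at most the sum of the absolute values of those
  coefficients; self-adjointness and commutation hold termwise and pass to the sum.\<close>

lemma cstar_sqrt_one_minus:
  fixes x :: "'a::{cstar_algebra,monoid_mult}"
  assumes "norm x \<le> 1"
  obtains w where "norm w \<le> 1" "(1 - w) * (1 - w) = 1 - x" "star x = x \<Longrightarrow> star w = w"
    "\<And>y. x * y = y * x \<Longrightarrow> w * y = y * w"
proof -
  define t where "t n = sqrt_coeff n *\<^sub>R x ^ n" for n
  have np: "norm (x ^ n) \<le> 1" for n
    using norm_power_le[of x n] assms power_le_one[of "norm x" n] by simp
  have nt: "norm (t n) \<le> norm (sqrt_coeff n)" for n
    using mult_left_mono[OF np[of n], of "norm (sqrt_coeff n)"] by (simp add: t_def)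
  have s1: "summable (\<lambda>k. norm (sqrt_coeff (Suc k)))"
    by (rule bounded_imp_summable[of _ 1])
       (auto simp: sqrt_coeff_abs_sum[of "Suc _", unfolded lessThan_Suc_atMost real_norm_def])
  then have s2: "summable (\<lambda>k. norm (sqrt_coeff k))"
    using summable_Suc_iff[of "\<lambda>k. norm (sqrt_coeff k)"] by blast
  have s3: "summable (\<lambda>k. norm (t k))" by (rule summable_comparison_test'[OF s2, of 0]) (use nt in auto)
  have s4: "summable (\<lambda>k. norm (t (Suc k)))" using s3 by (subst summable_Suc_iff)
  define w where "w = - (\<Sum>k. t (Suc k))"
  have tw: "(\<Sum>k. t k) = 1 - w"
    using suminf_split_head[OF summable_norm_cancel[OF s3]] by (simp add: w_def t_def)
  have "norm w \<le> (\<Sum>k. norm (t (Suc k)))" unfolding w_def norm_minus_cancel by (rule summable_norm[OF s4])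
  also have "\<dots> \<le> (\<Sum>k. norm (sqrt_coeff (Suc k)))" by (rule suminf_le) (use nt s4 s1 in auto)
  also have "\<dots> \<le> 1" by (rule suminf_le_const[OF s1]) (rule sqrt_coeff_abs_sum)
  finally have 1: "norm w \<le> 1" .
  have "(1 - w) * (1 - w) = (\<Sum>n. \<Sum>k\<le>n. t k * t (n - k))"
    unfolding tw[symmetric] by (rule Cauchy_product[OF s3 s3])
  also have "(\<lambda>n. \<Sum>k\<le>n. t k * t (n - k))
      = (\<lambda>n. (\<Sum>k\<le>n. sqrt_coeff k * sqrt_coeff (n - k)) *\<^sub>R x ^ n)"
    by (rule ext) (auto simp: t_def scaleR_left.sum power_add[symmetric] intro!: sum.cong)
  also have "(\<Sum>n. (\<Sum>k\<le>n. sqrt_coeff k * sqrt_coeff (n - k)) *\<^sub>R x ^ n)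
      = (\<Sum>n\<in>{0,1}. (\<Sum>k\<le>n. sqrt_coeff k * sqrt_coeff (n - k)) *\<^sub>R x ^ n)"
    by (rule suminf_finite) (auto simp: sqrt_coeff_conv)
  also have "\<dots> = 1 - x" by (simp add: sqrt_coeff_conv sqrt_coeff_conv[of 1, simplified])
  finally have 2: "(1 - w) * (1 - w) = 1 - x" .
  have 3: "star w = w" if "star x = x"
  proof -
    have "star (\<Sum>k. t (Suc k)) = (\<Sum>k. star (t (Suc k)))"
      by (rule bounded_linear.suminf[OF bounded_linear_star summable_norm_cancel[OF s4]])
    moreover have "star (t (Suc k)) = t (Suc k)" for k
      using that by (simp add: t_def star_scaleR star_power del: power_Suc)
    ultimately show ?thesis by (simp add: w_def star_minus)
  qed
  have 4: "w * y = y * w" if "x * y = y * x" for y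
  proof -
    have "(\<Sum>k. t (Suc k)) * y = (\<Sum>k. t (Suc k) * y)"
      by (rule suminf_mult2[OF summable_norm_cancel[OF s4]])
    also have "\<dots> = (\<Sum>k. y * t (Suc k))"
      using power_commuting_commutes[OF that] by (simp add: t_def del: power_Suc)
    also have "\<dots> = y * (\<Sum>k. t (Suc k))"
      by (rule suminf_mult[OF summable_norm_cancel[OF s4]])
    finally show ?thesis by (simp add: w_def)
  qed
  show ?thesis by (rule that[OF 1 2 3 4])
qed

section \<open>Positivity in unital \<open>C\<^sup>*\<close>-algebras\<close>

text \<open>The criterion \<open>norm (t *\<^sub>R 1 - h) \<le> t\<close> of \<open>cposI_norm\<close> and \<open>cpos_norm\<close> replaces the spectrum
  throughout: it turns the squares of self-adjoint elements into a convex cone.\<close>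

definition cpos :: "'a::star_algebra \<Rightarrow> bool" where
  "cpos x \<longleftrightarrow> (\<exists>k. star k = k \<and> x = k * k)"

lemma cposI: "star k = k \<Longrightarrow> cpos (k * k)"
  by (auto simp: cpos_def)

lemma cpos_sa: "cpos x \<Longrightarrow> star x = x"
  by (auto simp: cpos_def star_mult)

lemma cpos_zero [simp]: "cpos 0"
  using cposI[of 0] by simp

lemma scaleC_minus_one: "(-1) *\<^sub>C x = - (x :: 'a::cstar_algebra)"
  using scaleR_scaleC[of "-1" x] by simp

text \<open>Commutation gives \<open>y = k + \<i> *\<^sub>C m\<close> the square
  \<open>star y * y = k * k + m * m\<close>, and \<open>k\<close> is the real part of
  \<open>y\<close>. This stands in for monotonicity of the norm on positive elements, which is
  derived from it later.\<close>

lemma norm_sq_le_add_comm: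
  fixes k m :: "'a::cstar_algebra"
  assumes "star k = k" "star m = m" "k * m = m * k"
  shows "(norm k)\<^sup>2 \<le> norm (k * k + m * m)"
proof -
  define y where "y = k + \<i> *\<^sub>C m"
  have "(- \<i>) *\<^sub>C m = - (\<i> *\<^sub>C m)"
    using scaleC_scaleC[of "-1" "\<i>" m] by (simp add: scaleC_minus_one)
  then have sy: "star y = k - \<i> *\<^sub>C m"
    using assms by (simp add: y_def star_add star_scaleC)
  have "star y * y = k * k + m * m"
    unfolding sy using assms
    by (simp add: y_def algebra_simps mult_scaleC_left mult_scaleC_right scaleC_scaleC scaleC_minus_one scaleC_diff_right)
  then have ny: "(norm y)\<^sup>2 = norm (k * k + m * m)" using cstar_identity[of y] by simp
  have "2 *\<^sub>R k = y + star y" unfolding sy by (simp add: y_def scaleR_2)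
  then have "2 * norm k \<le> norm y + norm (star y)"
    by (metis abs_numeral norm_scaleR norm_triangle_ineq real_norm_def)
  then have "norm k \<le> norm y" by (simp add: norm_star)
  then show ?thesis unfolding ny[symmetric] by (intro power_mono) auto
qed

text \<open>Rescaling by \<open>t\<close> reduces to the root of \<open>1 - x\<close> with
  \<open>norm x \<le> 1\<close>. The last bound says that the root meets the same criterion with
  \<open>sqrt t\<close> in place of \<open>t\<close>, so a root can be taken of it again.\<close>

lemma cstar_sqrt_scaled:
  fixes h :: "'a::{cstar_algebra,monoid_mult}"
  assumes "star h = h" "norm (t *\<^sub>R 1 - h) \<le> t"
  obtains k where "star k = k" "k * k = h" "norm (sqrt t *\<^sub>R 1 - k) \<le> sqrt t"
    "\<And>y. h * y = y * h \<Longrightarrow> k * y = y * k"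
proof (cases "t = 0")
  case True
  then have "h = 0" using assms by simp
  then show ?thesis using that[of 0] True by simp
next
  case False
  then have t: "t > 0" using assms(2) norm_ge_zero[of "t *\<^sub>R 1 - h"] by linarith
  define x where "x = 1 - (1/t) *\<^sub>R h"
  have "x = (1/t) *\<^sub>R (t *\<^sub>R 1 - h)" using t by (simp add: x_def scaleR_diff_right)
  then have "norm x = (1/t) * norm (t *\<^sub>R 1 - h)" using t by (simp only: norm_scaleR) simp
  also have "\<dots> \<le> 1" using assms t by (simp add: divide_simps)
  finally obtain w where w: "norm w \<le> 1" "(1 - w) * (1 - w) = 1 - x" "star x = x \<Longrightarrow> star w = w"
    "\<And>y. x * y = y * x \<Longrightarrow> w * y = y * w" using cstar_sqrt_one_minus by blast
  define k where "k = sqrt t *\<^sub>R (1 - w)"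
  have 1: "star k = k" using w(3) assms by (simp add: k_def x_def star_scaleR star_diff)
  have "k * k = t *\<^sub>R ((1 - w) * (1 - w))" using t by (simp add: k_def)
  also have "\<dots> = h" unfolding w(2) x_def using t by simp
  finally have 2: "k * k = h" .
  have "sqrt t *\<^sub>R 1 - k = sqrt t *\<^sub>R w" by (simp add: k_def scaleR_diff_right)
  then have 3: "norm (sqrt t *\<^sub>R 1 - k) \<le> sqrt t" using w(1) t by (simp add: mult_left_le)
  have 4: "k * y = y * k" if "h * y = y * h" for y
    using w(4)[of y] that by (simp add: k_def x_def algebra_simps)
  show ?thesis by (rule that[OF 1 2 3 4])
qed

lemma cposI_norm:
  fixes h :: "'a::{cstar_algebra,monoid_mult}"
  assumes "star h = h" "norm (t *\<^sub>R 1 - h) \<le> t"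
  shows "cpos h"
  by (rule cstar_sqrt_scaled[OF assms]) (use cposI in blast)

lemma norm_scaleR_one_le: "0 \<le> t \<Longrightarrow> norm (t *\<^sub>R (1 :: 'a::{cstar_algebra,monoid_mult})) \<le> t"
  using mult_left_le[OF norm_one_le] by simp

lemma cpos_bound_minus:
  fixes h :: "'a::{cstar_algebra,monoid_mult}"
  assumes "star h = h" "norm h \<le> t"
  shows "cpos (t *\<^sub>R 1 - h)"
  by (rule cposI_norm[of _ t]) (use assms in \<open>auto simp: star_diff star_scaleR\<close>)

text \<open>The complement \<open>g = t *\<^sub>R 1 - h\<close> meets the root criterion because
  \<open>norm h \<le> t\<close>. Its root \<open>y\<close> commutes with the root \<open>k\<close>
  of \<open>h\<close>, and the two squares add up to \<open>t *\<^sub>R 1\<close>, which bounds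
  \<open>y * y = g\<close>.\<close>

lemma cpos_norm:
  fixes h :: "'a::{cstar_algebra,monoid_mult}"
  assumes "cpos h" "norm h \<le> t"
  shows "norm (t *\<^sub>R 1 - h) \<le> t"
proof -
  obtain k where k: "star k = k" "h = k * k" using assms by (auto simp: cpos_def)
  have t: "0 \<le> t" using assms(2) norm_ge_zero[of h] by linarith
  define g where "g = t *\<^sub>R 1 - h"
  have "star g = g" using k by (simp add: g_def star_diff star_scaleR star_mult)
  moreover have "norm (t *\<^sub>R 1 - g) \<le> t" using assms by (simp add: g_def)
  ultimately obtain y where y: "star y = y" "y * y = g" "\<And>z. g * z = z * g \<Longrightarrow> y * z = z * y"
    by (rule cstar_sqrt_scaled) blast
  have "y * k = k * y" by (rule y(3)) (simp add: g_def k algebra_simps)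
  then have "(norm y)\<^sup>2 \<le> norm (y * y + k * k)" by (intro norm_sq_le_add_comm) (auto simp: y k)
  also have "\<dots> \<le> t" using norm_scaleR_one_le[OF t] by (simp add: y g_def k)
  finally show ?thesis using norm_mult_self_sa[OF y(1)] by (simp add: y g_def)
qed

text \<open>The criterion is additive: the bounds for \<open>a\<close> and for \<open>b\<close>
  combine by the triangle inequality.\<close>

lemma cpos_add:
  fixes a b :: "'a::{cstar_algebra,monoid_mult}"
  assumes "cpos a" "cpos b" shows "cpos (a + b)"
proof (rule cposI_norm[of _ "norm a + norm b"])
  show "star (a + b) = a + b" using assms by (simp add: star_add cpos_sa)
  have "norm ((norm a + norm b) *\<^sub>R 1 - (a + b)) \<le> norm (norm a *\<^sub>R 1 - a) + norm (norm b *\<^sub>R 1 - b)"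
    by (rule order_trans[OF eq_refl norm_triangle_ineq]) (simp add: algebra_simps)
  also have "\<dots> \<le> norm a + norm b" using cpos_norm[OF assms(1)] cpos_norm[OF assms(2)] by (intro add_mono) auto
  finally show "norm ((norm a + norm b) *\<^sub>R 1 - (a + b)) \<le> norm a + norm b" .
qed

lemma cpos_scaleR: "cpos (a :: 'a::cstar_algebra) \<Longrightarrow> 0 \<le> r \<Longrightarrow> cpos (r *\<^sub>R a)"
  unfolding cpos_def
  by (elim exE, rule_tac x="sqrt r *\<^sub>R k" in exI) (auto simp: star_scaleR)

text \<open>The argument of \<open>cpos_norm\<close> with the roles of the two commuting roots
  exchanged.\<close>

lemma cpos_norm_le:
  fixes a :: "'a::{cstar_algebra,monoid_mult}"
  assumes "cpos a" "cpos (t *\<^sub>R 1 - a)" "0 \<le> t"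
  shows "norm a \<le> t"
proof -
  obtain k where k: "star k = k" "a = k * k" using assms by (auto simp: cpos_def)
  define g where "g = t *\<^sub>R 1 - a"
  have "star g = g" "norm (norm g *\<^sub>R 1 - g) \<le> norm g"
    using assms cpos_norm[of g "norm g"] by (auto simp: g_def cpos_sa)
  then obtain y where y: "star y = y" "y * y = g" "\<And>z. g * z = z * g \<Longrightarrow> y * z = z * y"
    by (rule cstar_sqrt_scaled) blast
  have "k * y = y * k" by (rule y(3)[symmetric]) (simp add: g_def k algebra_simps)
  then have "(norm k)\<^sup>2 \<le> norm (k * k + y * y)" by (intro norm_sq_le_add_comm) (auto simp: y k)
  also have "\<dots> \<le> t" using norm_scaleR_one_le[OF assms(3)] by (simp add: y g_def k)
  finally show ?thesis using norm_mult_self_sa[OF k(1)] by (simp add: k)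
qed

lemma cpos_norm_mono:
  fixes a b :: "'a::{cstar_algebra,monoid_mult}"
  assumes "cpos a" "cpos (b - a)" shows "norm a \<le> norm b"
proof (rule cpos_norm_le[OF assms(1)])
  have "star b = b" using cpos_sa[OF assms(1)] cpos_sa[OF assms(2)] by (simp add: star_diff)
  then have "cpos (norm b *\<^sub>R 1 - b)" by (rule cpos_bound_minus) simp
  from cpos_add[OF this assms(2)] show "cpos (norm b *\<^sub>R 1 - a)" by simp
qed simp

text \<open>The fourth power vanishes too, and the C*-identity for \<open>b * b\<close> and then for
  \<open>b\<close> descends from it.\<close>

lemma sa_cube_zero:
  fixes b :: "'a::cstar_algebra"
  assumes "star b = b" "b * b * b = 0" shows "b = 0"
proof -
  have "norm ((b * b) * (b * b)) = (norm (b * b))\<^sup>2"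
    by (rule norm_mult_self_sa) (simp add: star_mult assms)
  also have "(b * b) * (b * b) = 0" using assms(2) by (metis mult.assoc mult_zero_left)
  finally show ?thesis using norm_mult_self_sa[OF assms(1)] by simp
qed

text \<open>With \<open>p = z * star z\<close> one has \<open>(1 - p) ^ N * z = z * (1 + q) ^ N\<close>.  The left side is bounded in \<open>N\<close>,
  whereas \<open>q * (1 + q) ^ N\<close> dominates \<open>N *\<^sub>R (q * q)\<close>.\<close>

lemma star_mult_self_neg_zero_aux:
  fixes z q :: "'a::{cstar_algebra,monoid_mult}"
  assumes z: "norm z \<le> 1" "star z * z = - q" and q: "cpos q"
  shows "z = 0"
proof -
  obtain n where n: "star n = n" "q = n * n" using q by (auto simp: cpos_def)
  define p where "p = z * star z"
  \<comment> \<open>Real and imaginary part of \<open>z\<close>. They satisfy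
    \<open>2 *\<^sub>R (u * u + v * v) = star z * z + z * star z\<close>, so \<open>p\<close> is
    that sum of squares plus \<open>q\<close>, hence positive.\<close>
  define u where "u = (1/2) *\<^sub>R (z + star z)"
  define v where "v = (1/2) *\<^sub>R (\<i> *\<^sub>C (star z - z))"
  have su: "star u = u" by (simp add: u_def star_scaleR star_add star_star add.commute)
  have sv: "star v = v"
  proof -
    have "star (\<i> *\<^sub>C (star z - z)) = (-\<i>) *\<^sub>C (z - star z)"
      by (simp add: star_scaleC star_diff star_star)
    also have "\<dots> = (- \<i> * -1) *\<^sub>C (star z - z)"
      unfolding scaleC_scaleC[symmetric] using scaleR_scaleC[of "-1" "star z - z"] by simp
    finally show ?thesis by (simp add: v_def star_scaleR)
  qed
  have vv: "v * v = (1/4) *\<^sub>R (- ((star z - z) * (star z - z)))"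
    unfolding v_def
    by (simp add: scaleR_scaleC mult_scaleC_left mult_scaleC_right scaleC_scaleC flip: scaleC_minus_one)
  have "4 *\<^sub>R (u * u + v * v) = (z + star z) * (z + star z) - (star z - z) * (star z - z)"
  proof -
    have "u * u = (1/4) *\<^sub>R ((z + star z) * (z + star z))"
      unfolding u_def by (simp only: mult_scaleR_left mult_scaleR_right scaleR_scaleR) simp
    then show ?thesis unfolding vv by (simp add: scaleR_add_right del: scaleR_minus_right scaleR_diff_right)
  qed
  also have "\<dots> = 2 *\<^sub>R (star z * z + z * star z)" by (simp add: algebra_simps scaleR_2)
  finally have "(1/2) *\<^sub>R (4 *\<^sub>R (u * u + v * v)) = (1/2) *\<^sub>R (2 *\<^sub>R (star z * z + z * star z))"
    by (rule arg_cong)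
  then have "2 *\<^sub>R (u * u + v * v) = star z * z + z * star z" by (simp only: scaleR_scaleR) simp
  then have "p = 2 *\<^sub>R (u * u + v * v) + q" using z(2) by (simp add: p_def)
  then have pp: "cpos p"
    using su sv q by (auto intro!: cpos_add cpos_scaleR cposI)
  have "norm p \<le> 1" using z(1) by (simp add: p_def norm_mult_star power_le_one)
  then have n1p: "norm (1 - p) \<le> 1" using cpos_norm[OF pp, of 1] by simp
  have comm: "(1 - p) ^ N * z = z * (1 + q) ^ N" for N
  proof (induction N)
    case (Suc N)
    have "(1 - p) * z = z * (1 + q)"
      using arg_cong[OF z(2), of "\<lambda>t. z * t"] by (simp add: p_def algebra_simps)
    then have "(1 - p) ^ Suc N * z = (1 - p) ^ N * (z * (1 + q))"
      by (simp add: power_Suc2 mult.assoc del: power_Suc)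
    also have "\<dots> = z * (1 + q) ^ Suc N" by (simp add: mult.assoc[symmetric] Suc power_Suc2 del: power_Suc)
    finally show ?case .
  qed simp
  \<comment> \<open>A cone that contains \<open>1\<close> and is mapped into itself by
    \<open>x\<close> going to \<open>n * x * n\<close>. Quantifying over all powers builds this
    invariance in, so that multiplying by \<open>q\<close> inside the induction keeps
    positivity.\<close>
  define S where "S = {x. \<forall>k. cpos (n ^ k * x * n ^ k)}"
  have S_add: "x + y \<in> S" if "x \<in> S" "y \<in> S" for x y
    using that by (auto simp: S_def algebra_simps intro!: cpos_add)
  have S_n: "n * x * n \<in> S" if "x \<in> S" for x
    unfolding S_def
  proof (clarify)
    fix k
    have "n ^ k * (n * x * n) * n ^ k = (n ^ k * n) * x * (n * n ^ k)" by (simp only: mult.assoc)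
    also have "\<dots> = n ^ Suc k * x * n ^ Suc k" by (simp only: power_Suc power_commutes)
    finally have "n ^ k * (n * x * n) * n ^ k = n ^ Suc k * x * n ^ Suc k" .
    then show "cpos (n ^ k * (n * x * n) * n ^ k)" using that by (simp add: S_def del: power_Suc)
  qed
  have S_1: "1 \<in> S" by (auto simp: S_def star_power n intro!: cposI)
  have qcomm: "n * (1 + q) ^ N = (1 + q) ^ N * n" for N
    by (rule power_commuting_commutes[symmetric]) (simp add: n algebra_simps)
  have S_0: "0 \<in> S" by (simp add: S_def)
  have S_rn: "real N *\<^sub>R x \<in> S" if "x \<in> S" for N x
    using that by (auto simp: S_def intro!: cpos_scaleR)
  \<comment> \<open>Bernoulli's inequality in the cone \<open>S\<close>. If \<open>d\<close> is the
    difference for \<open>N\<close>, the next one is \<open>d + n * d * n\<close> plus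
    \<open>N\<close> times \<open>q * q\<close>.\<close>
  have main: "(1 + q) ^ N - 1 - real N *\<^sub>R q \<in> S" for N
  proof (induction N)
    case (Suc N)
    define E where "E = (1 + q) ^ N"
    define d where "d = E - 1 - real N *\<^sub>R q"
    have "(1 + q) ^ Suc N = E + E * n * n" by (simp add: E_def n power_Suc2 distrib_left mult.assoc del: power_Suc)
    also have "E * n = n * E" using qcomm by (simp add: E_def)
    finally have "(1 + q) ^ Suc N - 1 - real (Suc N) *\<^sub>R q = (d + n * d * n) + real N *\<^sub>R (n * (n * 1 * n) * n)"
      by (simp add: d_def n algebra_simps)
    moreover have "d \<in> S" using Suc by (simp add: d_def E_def)
    ultimately show ?case by (simp only:) (intro S_add S_n S_rn S_1)
  qed (use S_0 in simp)
  have bd: "real N * norm (q * q) \<le> 1" for N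
  proof -
    have "n * ((1 + q) ^ N - 1 - real N *\<^sub>R q) * n \<in> S" by (rule S_n[OF main])
    moreover have "n * 1 * n \<in> S" by (rule S_n[OF S_1])
    ultimately have "n * ((1 + q) ^ N - 1 - real N *\<^sub>R q) * n + n * 1 * n \<in> S" by (rule S_add)
    also have "n * ((1 + q) ^ N - 1 - real N *\<^sub>R q) * n + n * 1 * n = q * (1 + q) ^ N - real N *\<^sub>R (q * q)"
    proof -
      have "n * (1 + q) ^ N * n = q * (1 + q) ^ N" unfolding mult.assoc qcomm[symmetric] by (simp only: n(2) mult.assoc)
      then show ?thesis by (simp add: right_diff_distrib left_diff_distrib) (simp add: n mult.assoc)
    qed
    finally have "cpos (q * (1 + q) ^ N - real N *\<^sub>R (q * q))"
      unfolding S_def by (auto dest: spec[of _ 0])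
    moreover have "cpos (real N *\<^sub>R (q * q))" using cpos_sa[OF q] by (intro cpos_scaleR cposI) auto
    ultimately have "norm (real N *\<^sub>R (q * q)) \<le> norm (q * (1 + q) ^ N)" by (intro cpos_norm_mono)
    \<comment> \<open>Here the hypothesis on \<open>star z * z\<close> enters: it replaces
      \<open>q\<close> by a product around \<open>(1 - p) ^ N\<close>, whose norm is at most 1 for
      every \<open>N\<close>.\<close>
    also have "q * (1 + q) ^ N = - (star z * ((1 - p) ^ N * z))"
      unfolding comm using z(2) by (simp add: mult.assoc[symmetric])
    also have "norm \<dots> \<le> norm (star z) * (norm ((1 - p) ^ N) * norm z)"
      unfolding norm_minus_cancel by (meson mult_left_mono norm_ge_zero norm_mult_ineq order_trans)
    also have "\<dots> \<le> 1 * (1 * 1)"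
      using z(1) norm_power_le[of "1 - p" N] n1p power_le_one[of "norm (1 - p)" N]
      by (intro mult_mono) (auto simp: norm_star)
    finally show ?thesis by simp
  qed
  have "norm (q * q) = 0"
  proof (rule ccontr)
    assume "norm (q * q) \<noteq> 0"
    then have "norm (q * q) > 0" by simp
    then obtain N where "1 < real N * norm (q * q)" using reals_Archimedean3 by blast
    with bd[of N] show False by simp
  qed
  then have "q = 0" using norm_mult_self_sa[OF cpos_sa[OF q]] by simp
  then show ?thesis using z(2) cstar_identity[of z] by simp
qed

lemma star_mult_self_neg_zero:
  fixes z q :: "'a::{cstar_algebra,monoid_mult}"
  assumes "star z * z = - q" "cpos q"
  shows "z = 0"
proof (rule ccontr)
  assume "z \<noteq> 0"
  define r where "r = 1 / norm z"
  have "r *\<^sub>R z = 0"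
  proof (rule star_mult_self_neg_zero_aux)
    show "norm (r *\<^sub>R z) \<le> 1" using \<open>z \<noteq> 0\<close> by (simp add: r_def)
    show "star (r *\<^sub>R z) * (r *\<^sub>R z) = - ((r * r) *\<^sub>R q)" using assms by (simp add: star_scaleR)
    show "cpos ((r * r) *\<^sub>R q)" using assms by (intro cpos_scaleR) auto
  qed
  then show False using \<open>z \<noteq> 0\<close> by (simp add: r_def)
qed

text \<open>The Kelley--Vaught argument, applied to \<open>z = x * b\<close> with \<open>b\<close> the negative part of \<open>star x * x\<close>.\<close>

theorem cpos_star_mult:
  fixes x :: "'a::{cstar_algebra,monoid_mult}"
  shows "cpos (star x * x)"
proof -
  define h where "h = star x * x"
  have sh: "star h = h" by (simp add: h_def star_mult star_star)
  have "cpos (h * h)" by (rule cposI[OF sh])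
  then have "star (h * h) = h * h" "norm (norm (h * h) *\<^sub>R 1 - h * h) \<le> norm (h * h)"
    by (auto intro: cpos_norm cpos_sa)
  then obtain g where g: "star g = g" "g * g = h * h"
      "norm (sqrt (norm (h * h)) *\<^sub>R 1 - g) \<le> sqrt (norm (h * h))"
      "\<And>y. (h * h) * y = y * (h * h) \<Longrightarrow> g * y = y * g"
    by (rule cstar_sqrt_scaled) blast
  obtain k where k: "star k = k" "k * k = g" "\<And>y. g * y = y * g \<Longrightarrow> k * y = y * k"
    by (rule cstar_sqrt_scaled[OF g(1,3)]) blast
  have gh: "g * h = h * g" by (rule g(4)) (simp add: mult.assoc)
  then have kh: "k * h = h * k" by (rule k(3))
  have kg: "k * g = g * k" by (rule k(3)) simp
  define b where "b = (1/2) *\<^sub>R (g - h)"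
  have sb: "star b = b" by (simp add: b_def star_scaleR star_diff g sh)
  have bgh: "b * h = - (b * g)" using g(2) gh by (simp add: b_def algebra_simps)
  have kb: "k * b = b * k" using kh kg by (simp add: b_def algebra_simps)
  \<comment> \<open>Because \<open>(g - h) * (g + h) = 0\<close>, \<open>h\<close> may be replaced
    by \<open>- g\<close> next to \<open>b\<close>; splitting \<open>g\<close> as
    \<open>k * k\<close> makes the result minus a square.\<close>
  have "star (x * b) * (x * b) = b * h * b" by (simp add: star_mult sb h_def mult.assoc)
  also have "\<dots> = - ((k * b) * (k * b))"
  proof -
    have "b * g * b = (b * k) * (k * b)" unfolding k(2)[symmetric] by (simp only: mult.assoc)
    then show ?thesis unfolding bgh using kb by simp
  qed
  finally have "x * b = 0"
    by (rule star_mult_self_neg_zero) (rule cposI, simp add: star_mult sb k kb)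
  then have bhb: "b * h * b = 0" by (simp add: h_def mult.assoc)
  \<comment> \<open>\<open>b * b = b * g\<close>, so the cube of \<open>b\<close> is
    \<open>b * g * b = - (b * h * b) = 0\<close>; this forces \<open>b = 0\<close> and
    \<open>h = g\<close>.\<close>
  have "b * b = (1/2) *\<^sub>R (b * g - b * h)" by (subst (2) b_def) (simp add: right_diff_distrib)
  also have "\<dots> = b * g" unfolding bgh by (simp flip: scaleR_2)
  finally have "b * g = b * b" by simp
  then have "b * b * b = 0" using bhb unfolding bgh by simp
  then have "b = 0" by (rule sa_cube_zero[OF sb])
  then have "h = k * k" by (simp add: b_def k)
  then show ?thesis unfolding h_def[symmetric] using cposI[OF k(1)] by (simp only:)
qed

section \<open>The multiplier algebra as a \<open>C\<^sup>*\<close>-algebra\<close>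

lemma bounded_linear_lact: "bounded_linear (lact m)"
  by transfer (auto simp: double_centralizer_def bounded_clinear_def)

lemmas lact_linear = bounded_linear.linear[OF bounded_linear_lact]

lemma lact_add: "lact m (x + y) = lact m x + lact m y"
  by (simp add: linear_add lact_linear)

lemma lact_zero [simp]: "lact m 0 = 0"
  by (simp add: linear_0 lact_linear)

lemma lact_scaleC: "lact m (c *\<^sub>C x) = c *\<^sub>C lact m x"
  by transfer (auto simp: double_centralizer_def bounded_clinear_def)

lemma lact_mult: "lact m (x * y) = lact m x * y"
  by transfer (auto simp: double_centralizer_def)

lemma ract_mult: "ract m (x * y) = x * ract m y"
  by transfer (auto simp: double_centralizer_def)

lemma ract_lact: "ract m x * y = x * lact m y"
  by transfer (auto simp: double_centralizer_def)

lemma lact_embed [simp]: "lact (embed b) x = b * x"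
  by transfer simp

lemma lact_plus [simp]: "lact (m + n) x = lact m x + lact n x"
  by transfer auto

lemma lact_minus [simp]: "lact (m - n) x = lact m x - lact n x"
  by transfer auto

lemma lact_0 [simp]: "lact 0 x = 0"
  by transfer auto

lemma lact_1 [simp]: "lact 1 x = x"
  by transfer auto

lemma lact_times [simp]: "lact (m * n) x = lact m (lact n x)"
  by transfer auto

lemma lact_scaleC_left [simp]: "lact (c *\<^sub>C m) x = c *\<^sub>C lact m x"
  by transfer auto

lemma lact_star: "lact (star m) x = star (ract m (star x))"
  by transfer auto

lemma ract_star: "ract (star m) x = star (lact m (star x))"
  by transfer auto

lemma star_lact: "star (lact m x) = ract (star m) (star x)"
  by (simp add: ract_star star_star)

lemma cstar_mult_left_eqI:
  fixes a b :: "'a::cstar_algebra"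
  assumes "\<And>y. a * y = b * y" shows "a = b"
proof -
  have "norm ((a - b) * star (a - b)) = 0" using assms[of "star (a - b)"] by (simp add: left_diff_distrib)
  then show ?thesis by (simp add: norm_mult_star)
qed

text \<open>By \<open>ract_lact\<close> the left action determines \<open>ract m x * y\<close> for
  all \<open>y\<close>, hence the right action.\<close>

lemma multiplier_eqI:
  assumes "\<And>x. lact a x = lact b x" shows "a = b"
proof -
  have "ract a x = ract b x" for x
    by (rule cstar_mult_left_eqI) (simp add: ract_lact assms)
  with assms show ?thesis by transfer (auto simp: prod_eq_iff)
qed

lemma embed_mult: "embed (x * y) = embed x * embed y"
  and embed_add: "embed (x + y) = embed x + embed y"
  and embed_scaleC: "embed (c *\<^sub>C x) = c *\<^sub>C embed x"
  and embed_star: "embed (star x) = star (embed x)"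
  using star_hom_embed by (auto simp: star_hom_def)

text \<open>With \<open>embed_lact\<close> this says that the algebra is a two-sided ideal of its
  multiplier algebra.\<close>

lemma mult_embed: "m * embed x = embed (lact m x)"
  by (rule multiplier_eqI) (simp add: lact_mult)

lemma embed_lact: "embed x * m = embed (ract m x)"
  by (rule multiplier_eqI) (simp add: ract_lact)

lemma embed_inj: "embed x = embed y \<longleftrightarrow> x = y"
proof
  assume "embed x = embed y"
  then have "x * z = y * z" for z by (metis lact_embed)
  then show "x = y" by (rule cstar_mult_left_eqI)
qed simp

instantiation multiplier :: (cstar_algebra) real_normed_algebra
begin

definition scaleR_multiplier :: "real \<Rightarrow> 'a multiplier \<Rightarrow> 'a multiplier" where
  "scaleR_multiplier r m = complex_of_real r *\<^sub>C m"

definition norm_multiplier :: "'a multiplier \<Rightarrow> real" where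
  "norm_multiplier m = onorm (lact m)"

definition dist_multiplier :: "'a multiplier \<Rightarrow> 'a multiplier \<Rightarrow> real" where
  "dist_multiplier m n = norm (m - n)"

definition sgn_multiplier :: "'a multiplier \<Rightarrow> 'a multiplier" where
  "sgn_multiplier m = inverse (norm m) *\<^sub>R m"

definition uniformity_multiplier :: "('a multiplier \<times> 'a multiplier) filter" where
  "uniformity_multiplier = (INF e\<in>{0<..}. principal {(x, y). dist x y < e})"

definition open_multiplier :: "'a multiplier set \<Rightarrow> bool" where
  "open_multiplier U = (\<forall>x\<in>U. eventually (\<lambda>(x', y). x' = x \<longrightarrow> y \<in> U) uniformity)"

lemma norm_lact_le: "norm (lact m x) \<le> norm m * norm x"
  unfolding norm_multiplier_def by (rule onorm[OF bounded_linear_lact])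

lemma norm_multiplier_leI: "(\<And>x. norm (lact m x) \<le> b * norm x) \<Longrightarrow> 0 \<le> b \<Longrightarrow> norm m \<le> b"
  unfolding norm_multiplier_def by (rule onorm_bound)

lemma norm_multiplier_nonneg: "0 \<le> norm (m :: 'a multiplier)"
  unfolding norm_multiplier_def by (rule onorm_pos_le[OF bounded_linear_lact])

lemma norm_multiplier_mult: "norm (m * n) \<le> norm m * norm (n :: 'a multiplier)"
proof (rule norm_multiplier_leI)
  fix x
  have "norm (lact m (lact n x)) \<le> norm m * norm (lact n x)" by (rule norm_lact_le)
  also have "\<dots> \<le> norm m * (norm n * norm x)"
    by (intro mult_left_mono norm_lact_le norm_multiplier_nonneg)
  finally show "norm (lact (m * n) x) \<le> norm m * norm n * norm x" by (simp add: mult.assoc)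
qed (simp add: norm_multiplier_nonneg)

text \<open>In the algebra, \<open>star (m x) * (m x)\<close> equals
  \<open>star x * ((star m * m) x)\<close>. The C*-identity there therefore bounds
  \<open>m x\<close> through the norm of \<open>star m * m\<close>.\<close>

lemma norm_multiplier_sq_le: "(norm m)\<^sup>2 \<le> norm (star m * (m :: 'a multiplier))"
proof -
  have "norm m \<le> sqrt (norm (star m * m))"
  proof (rule norm_multiplier_leI)
    fix x
    have "(norm (lact m x))\<^sup>2 = norm (star (lact m x) * lact m x)" by (simp add: cstar_identity)
    also have "star (lact m x) * lact m x = star x * lact (star m * m) x"
      unfolding star_lact ract_lact by simp
    also have "norm \<dots> \<le> norm x * (norm (star m * m) * norm x)"
      by (rule order_trans[OF norm_mult_ineq])
         (simp add: norm_star mult_left_mono norm_lact_le del: lact_times)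
    finally have "(norm (lact m x))\<^sup>2 \<le> norm (star m * m) * (norm x)\<^sup>2"
      by (simp add: power2_eq_square mult.left_commute)
    then have "sqrt ((norm (lact m x))\<^sup>2) \<le> sqrt (norm (star m * m) * (norm x)\<^sup>2)"
      by (rule real_sqrt_le_mono)
    then show "norm (lact m x) \<le> sqrt (norm (star m * m)) * norm x"
      by (simp add: real_sqrt_mult)
  qed (simp add: norm_multiplier_nonneg)
  from power_mono[OF this norm_multiplier_nonneg, of 2]
  show ?thesis by (simp add: norm_multiplier_nonneg)
qed

text \<open>The norm looks at the left action only. Dividing the previous inequality by
  \<open>norm m\<close> gives one direction, hence both; as a consequence the right action obeys the
  same bound.\<close>

lemma norm_multiplier_star: "norm (star m) = norm (m :: 'a multiplier)"
proof -
  have "norm m \<le> norm (star m)" for m :: "'a multiplier"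
  proof (cases "norm m = 0")
    case False
    then have "0 < norm m" using norm_multiplier_nonneg[of m] by linarith
    moreover have "norm m * norm m \<le> norm (star m) * norm m"
      using norm_multiplier_sq_le[of m] norm_multiplier_mult[of "star m" m]
      by (simp add: power2_eq_square)
    ultimately show ?thesis by simp
  qed (simp add: norm_multiplier_nonneg)
  from this[of m] this[of "star m"] show ?thesis by (simp add: star_star)
qed

lemma norm_ract_le: "norm (ract m x) \<le> norm m * norm x"
  using norm_lact_le[of "star m" "star x"] by (simp add: lact_star star_star norm_star norm_multiplier_star)

lemma norm_multiplier_scaleC: "norm (c *\<^sub>C m) = cmod c * norm (m :: 'a multiplier)"
proof -
  have le: "norm (c *\<^sub>C m) \<le> cmod c * norm m" for c and m :: "'a multiplier"
    by (rule norm_multiplier_leI)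
       (simp_all add: norm_scaleC mult_left_mono norm_lact_le mult.assoc norm_multiplier_nonneg)
  show ?thesis
  proof (cases "c = 0")
    case True
    then show ?thesis using le[of c m] norm_multiplier_nonneg[of "c *\<^sub>C m"] by simp
  next
    case False
    then have "m = inverse c *\<^sub>C (c *\<^sub>C m)" by (simp add: scaleC_scaleC scaleC_one)
    then have "norm m \<le> cmod (inverse c) * norm (c *\<^sub>C m)" using le[of "inverse c" "c *\<^sub>C m"] by simp
    then have "cmod c * norm m \<le> norm (c *\<^sub>C m)" using False by (simp add: norm_inverse norm_divide field_simps)
    with le[of c m] show ?thesis by simp
  qed
qed

instance
proof
  fix x y z :: "'a multiplier" and a b :: real
  show "dist x y = norm (x - y)" by (rule dist_multiplier_def)
  show "sgn x = inverse (norm x) *\<^sub>R x" by (rule sgn_multiplier_def)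
  show "uniformity = (INF e\<in>{0<..}. principal {(x :: 'a multiplier, y). dist x y < e})"
    by (rule uniformity_multiplier_def)
  show "open U = (\<forall>x\<in>U. eventually (\<lambda>(x', y). x' = x \<longrightarrow> y \<in> U) uniformity)"
    for U :: "'a multiplier set" by (rule open_multiplier_def)
  show "a *\<^sub>R (x + y) = a *\<^sub>R x + a *\<^sub>R y" by (simp add: scaleR_multiplier_def scaleC_add_right)
  show "(a + b) *\<^sub>R x = a *\<^sub>R x + b *\<^sub>R x" by (simp add: scaleR_multiplier_def scaleC_add_left)
  show "a *\<^sub>R b *\<^sub>R x = (a * b) *\<^sub>R x" by (simp add: scaleR_multiplier_def scaleC_scaleC)
  show "1 *\<^sub>R x = x" by (simp add: scaleR_multiplier_def scaleC_one)
  show "a *\<^sub>R x * y = a *\<^sub>R (x * y)" by (simp add: scaleR_multiplier_def mult_scaleC_left)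
  show "x * a *\<^sub>R y = a *\<^sub>R (x * y)" by (simp add: scaleR_multiplier_def mult_scaleC_right)
  show "(norm x = 0) = (x = 0)"
  proof
    assume "norm x = 0"
    then have "norm (lact x y) \<le> 0" for y using norm_lact_le[of x y] by simp
    then show "x = 0" by (intro multiplier_eqI) simp
  next
    assume "x = 0"
    then show "norm x = 0" using norm_multiplier_leI[of x 0] norm_multiplier_nonneg[of x] by simp
  qed
  show "norm (x + y) \<le> norm x + norm y"
  proof (rule norm_multiplier_leI)
    fix v
    have "norm (lact x v + lact y v) \<le> norm (lact x v) + norm (lact y v)" by (rule norm_triangle_ineq)
    then show "norm (lact (x + y) v) \<le> (norm x + norm y) * norm v"
      using norm_lact_le[of x v] norm_lact_le[of y v] by (simp add: distrib_right)
  qed (simp add: norm_multiplier_nonneg)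
  show "norm (a *\<^sub>R x) = \<bar>a\<bar> * norm x" by (simp add: scaleR_multiplier_def norm_multiplier_scaleC)
  show "norm (x * y) \<le> norm x * norm y" by (rule norm_multiplier_mult)
qed

end

text \<open>What remains is completeness. A Cauchy sequence of multipliers converges pointwise from
  both sides, the limits form a double centralizer, and the uniform Cauchy estimate upgrades
  pointwise to norm convergence.\<close>

instance multiplier :: (cstar_algebra) cstar_algebra
proof
  fix x :: "'a multiplier" and r :: real and c :: complex
  show "r *\<^sub>R x = complex_of_real r *\<^sub>C x" by (rule scaleR_multiplier_def)
  show "norm (c *\<^sub>C x) = cmod c * norm x" by (rule norm_multiplier_scaleC)
  show "norm (star x * x) = (norm x)\<^sup>2"
    using norm_multiplier_sq_le[of x] norm_mult_ineq[of "star x" x]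
    by (simp add: norm_multiplier_star power2_eq_square)
next
  fix X :: "nat \<Rightarrow> 'a multiplier"
  assume X: "Cauchy X"
  have nd: "norm (m - n) = dist m n" for m n :: "'a multiplier" by (simp add: dist_multiplier_def)
  have C: "\<exists>N. \<forall>m\<ge>N. \<forall>n\<ge>N. norm (X m - X n) < e" if "e > 0" for e
    using X that unfolding Cauchy_def nd by blast
  \<comment> \<open>Stated for an abstract action \<open>F\<close> in order to serve both the left
    and the right action; the same holds for \<open>blin\<close> and \<open>clin\<close>
    below.\<close>
  have cau: "Cauchy (\<lambda>n. F (X n) v)"
    if le: "\<And>m v. norm (F m v) \<le> norm m * norm v"
      and df: "\<And>m n v. F (m - n) v = F m v - F n v" for F :: "'a multiplier \<Rightarrow> 'a \<Rightarrow> 'a" and v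
  proof (rule CauchyI)
    fix e :: real assume e: "e > 0"
    define d where "d = e / (norm v + 1)"
    have d: "d > 0" using e by (simp add: d_def add_nonneg_pos)
    obtain N where N: "\<And>m n. m \<ge> N \<Longrightarrow> n \<ge> N \<Longrightarrow> norm (X m - X n) < d"
      using C[OF d] by blast
    have "norm (F (X m) v - F (X n) v) < e" if "m \<ge> N" "n \<ge> N" for m n
    proof -
      have "norm (F (X m) v - F (X n) v) \<le> norm (X m - X n) * norm v"
        unfolding df[symmetric] by (rule le)
      also have "\<dots> \<le> d * norm v" using N[OF that] by (intro mult_right_mono) auto
      also have "\<dots> < d * (norm v + 1)" using d by simp
      also have "\<dots> = e" using add_nonneg_pos[of "norm v" 1] by (simp add: d_def)
      finally show ?thesis .
    qed
    then show "\<exists>N. \<forall>m\<ge>N. \<forall>n\<ge>N. norm (F (X m) v - F (X n) v) < e" by blast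
  qed
  have ract_minus: "ract (m - n) v = ract m v - ract n v" for m n :: "'a multiplier" and v
    by transfer auto
  define l where "l v = lim (\<lambda>n. lact (X n) v)" for v
  define r where "r v = lim (\<lambda>n. ract (X n) v)" for v
  have l: "(\<lambda>n. lact (X n) v) \<longlonglongrightarrow> l v" for v
    unfolding l_def
    by (rule iffD1[OF convergent_LIMSEQ_iff] Cauchy_convergent)+ (rule cau, auto simp: norm_lact_le)
  have r: "(\<lambda>n. ract (X n) v) \<longlonglongrightarrow> r v" for v
    unfolding r_def
    by (rule iffD1[OF convergent_LIMSEQ_iff] Cauchy_convergent)+ (rule cau, auto simp: norm_ract_le ract_minus)
  obtain N0 where N0: "\<And>m n. m \<ge> N0 \<Longrightarrow> n \<ge> N0 \<Longrightarrow> norm (X m - X n) < 1" using C[of 1] by auto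
  define K where "K = norm (X N0) + 1"
  have XK: "norm (X n) \<le> K" if "n \<ge> N0" for n
  proof -
    have "norm (X n) \<le> norm (X N0) + norm (X n - X N0)" by (rule norm_triangle_sub)
    then show ?thesis using N0[of n N0] that by (simp add: K_def)
  qed
  have K: "norm (F (X n) v) \<le> K * norm v"
    if "n \<ge> N0" "\<And>m v. norm (F m v) \<le> norm m * norm v" for F :: "'a multiplier \<Rightarrow> 'a \<Rightarrow> 'a" and n v
    using that(2)[of "X n" v] mult_right_mono[OF XK[OF that(1)], of "norm v"] by simp
  have blin: "bounded_linear f" and clin: "f (c *\<^sub>C x) = c *\<^sub>C f x"
    if f: "\<And>v. (\<lambda>n. F (X n) v) \<longlonglongrightarrow> f v"
    and le: "\<And>m v. norm (F m v) \<le> norm m * norm v"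
    and Fa: "\<And>m v w. F m (v + w) = F m v + F m w"
    and Fs: "\<And>m c v. F m (c *\<^sub>C v) = c *\<^sub>C F m v"
    for f and F :: "'a multiplier \<Rightarrow> 'a \<Rightarrow> 'a" and c x
  proof -
    have fs: "f (c *\<^sub>C v) = c *\<^sub>C f v" for c v
      using f[of "c *\<^sub>C v"] bounded_linear.tendsto[OF bounded_linear_scaleC f[of v], of c]
      unfolding Fs by (rule LIMSEQ_unique)
    show "f (c *\<^sub>C x) = c *\<^sub>C f x" by (rule fs)
    show "bounded_linear f"
    proof (rule bounded_linear_intro)
      fix v w :: 'a and a :: real
      show "f (v + w) = f v + f w"
        using f[of "v + w"] tendsto_add[OF f[of v] f[of w]] unfolding Fa by (rule LIMSEQ_unique)
      show "f (a *\<^sub>R v) = a *\<^sub>R f v" using fs by (simp add: scaleR_scaleC)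
      show "norm (f v) \<le> norm v * K"
        by (rule LIMSEQ_le_const2[OF tendsto_norm[OF f[of v]]])
           (use K[of _ F v] le in \<open>auto simp: mult.commute\<close>)
    qed
  qed
  have ract_add: "ract m (v + w) = ract m v + ract m w" and ract_scaleC: "ract m (c *\<^sub>C v) = c *\<^sub>C ract m v"
    for m :: "'a multiplier" and v w c
    by (transfer, auto simp: double_centralizer_def bounded_clinear_def linear_simps)+
  have dc: "double_centralizer (l, r)"
    unfolding double_centralizer_def bounded_clinear_def prod.case
  proof (intro conjI allI)
    show "bounded_linear l" by (rule blin[OF l]) (auto simp: norm_lact_le lact_add lact_scaleC)
    show "bounded_linear r" by (rule blin[OF r]) (auto simp: norm_ract_le ract_add ract_scaleC)
    show "l (c *\<^sub>C x) = c *\<^sub>C l x" for c x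
      by (rule clin[OF l]) (auto simp: norm_lact_le lact_add lact_scaleC)
    show "r (c *\<^sub>C x) = c *\<^sub>C r x" for c x
      by (rule clin[OF r]) (auto simp: norm_ract_le ract_add ract_scaleC)
    fix v w
    show "l (v * w) = l v * w"
      using l[of "v * w"] tendsto_mult_right[OF l[of v], of w] unfolding lact_mult
      by (rule LIMSEQ_unique)
    show "r (v * w) = v * r w"
      using r[of "v * w"] tendsto_mult_left[OF r[of w], of v] unfolding ract_mult
      by (rule LIMSEQ_unique)
    show "r v * w = v * l w"
      using tendsto_mult_right[OF r[of v], of w] tendsto_mult_left[OF l[of w], of v] unfolding ract_lact
      by (rule LIMSEQ_unique)
  qed
  define L where "L = Abs_multiplier (l, r)"
  have L: "lact L v = l v" for v
    unfolding L_def lact.rep_eq using dc by (simp add: Abs_multiplier_inverse)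
  have "X \<longlonglongrightarrow> L"
    unfolding tendsto_iff eventually_sequentially
  proof (intro allI impI)
    fix e :: real assume e: "e > 0"
    obtain N where N: "\<And>m n. m \<ge> N \<Longrightarrow> n \<ge> N \<Longrightarrow> norm (X m - X n) < e / 2"
      using C[of "e/2"] e by auto
    have "dist (X n) L < e" if "n \<ge> N" for n
    proof -
      have "norm (X n - L) \<le> e / 2"
      proof (rule norm_multiplier_leI)
        fix v
        have "(\<lambda>m. norm (lact (X n) v - lact (X m) v)) \<longlonglongrightarrow> norm (lact (X n) v - l v)"
          by (intro tendsto_norm tendsto_diff tendsto_const l)
        moreover have "norm (lact (X n) v - lact (X m) v) \<le> e / 2 * norm v" if "m \<ge> N" for m
          using norm_lact_le[of "X n - X m" v] mult_right_mono[OF less_imp_le[OF N[OF \<open>n \<ge> N\<close> that]], of "norm v"]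
          by simp
        ultimately have "norm (lact (X n) v - l v) \<le> e / 2 * norm v"
          by (intro LIMSEQ_le_const2[where X="\<lambda>m. norm (lact (X n) v - lact (X m) v)"]) blast+
        then show "norm (lact (X n - L) v) \<le> e / 2 * norm v" by (simp add: L)
      qed (use e in simp)
      then show ?thesis using e by (simp add: dist_multiplier_def)
    qed
    then show "\<exists>N. \<forall>n\<ge>N. dist (X n) L < e" by blast
  qed
  then show "convergent X" by (auto simp: convergent_def)
qed

lemma norm_embed: "norm (embed b) = norm b"
proof (rule antisym)
  show "norm (embed b) \<le> norm b" by (rule norm_multiplier_leI) (simp_all add: norm_mult_ineq)
  show "norm b \<le> norm (embed b)"
  proof (cases "b = 0")
    case False
    have "norm b * norm b = norm (lact (embed b) (star b))"
      by (simp add: norm_mult_star power2_eq_square)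
    also have "\<dots> \<le> norm (embed b) * norm b" using norm_lact_le[of "embed b" "star b"] by (simp add: norm_star)
    finally show ?thesis using False by simp
  qed simp
qed

section \<open>Approximate units, contractivity and positive functionals\<close>

lemma star_lact_mult: "star (lact m a) * lact n b = star a * lact (star m * n) b"
  by (simp add: star_lact ract_lact)

lemma lact_scaleR_left [simp]: "lact (r *\<^sub>R m) x = r *\<^sub>R lact m x"
  by (simp add: scaleR_scaleC)

text \<open>\<open>star m * m\<close> is self-adjoint with norm the square of \<open>norm m\<close>,
  so the difference satisfies the criterion for positivity and has a root. The factorization turns
  norm bounds into identities between squares.\<close>

lemma ex_defect:
  fixes m :: "'a::{cstar_algebra,monoid_mult}"
  shows "\<exists>z. star z * z = (norm m)\<^sup>2 *\<^sub>R 1 - star m * m"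
proof -
  have "cpos ((norm m)\<^sup>2 *\<^sub>R 1 - star m * m)"
    by (rule cpos_bound_minus) (simp_all add: star_mult star_star cstar_identity)
  then obtain k where "star k = k" "(norm m)\<^sup>2 *\<^sub>R 1 - star m * m = k * k"
    by (auto simp: cpos_def)
  then show ?thesis by (intro exI[of _ k]) simp
qed

text \<open>The defect \<open>z\<close> is only a multiplier. Sandwiched between
  \<open>star a\<close> and \<open>b\<close>, its identity involves elements of the algebra alone,
  so it can be fed into homomorphisms, functionals and representations that are not yet extended to
  multipliers.\<close>

lemma ex_defect_lact:
  fixes m :: "'a::cstar_algebra multiplier"
  obtains z where "\<And>a b. star (lact z a) * lact z b
    = (norm m)\<^sup>2 *\<^sub>R (star a * b) - star (lact m a) * lact m b"
proof -
  obtain z where z: "star z * z = (norm m)\<^sup>2 *\<^sub>R 1 - star m * m" using ex_defect by blast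
  show ?thesis
  proof (rule that[of z])
    fix a b
    have "star (lact z a) * lact z b = star a * ((norm m)\<^sup>2 *\<^sub>R b - lact (star m * m) b)"
      unfolding star_lact_mult z by (simp del: lact_times)
    then show "star (lact z a) * lact z b = (norm m)\<^sup>2 *\<^sub>R (star a * b) - star (lact m a) * lact m b"
      by (simp only: right_diff_distrib mult_scaleR_right star_lact_mult)
  qed
qed

text \<open>For \<open>s = x * star x\<close> scaled to norm \<open>1\<close>, the element \<open>1 - (1 - s) ^ M\<close> lies in the algebra and
  \<open>s * (1 - s) ^ (2 * M)\<close> has norm at most \<open>1 / (2 * M)\<close>.\<close>

lemma approx_left_unit:
  fixes x :: "'a::cstar_algebra"
  assumes "0 < e"
  obtains u where "norm (u * x - x) < e"
proof (cases "x = 0")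
  case True
  then show ?thesis using that[of 0] assms by simp
next
  case False
  define t where "t = (norm x)\<^sup>2"
  have t: "t > 0" using False by (simp add: t_def)
  define s0 where "s0 = (1/t) *\<^sub>R (x * star x)"
  define s where "s = embed s0"
  have ns: "norm s \<le> 1" using t by (simp add: s_def norm_embed s0_def norm_mult_star t_def)
  have ss: "star s = s" by (simp add: s_def s0_def star_scaleR star_mult star_star flip: embed_star)
  have sx: "s = (1/t) *\<^sub>R (embed x * star (embed x))"
    by (simp add: s_def s0_def scaleR_scaleC embed_scaleC embed_mult embed_star)
  then have "cpos s" using t cpos_star_mult[of "star (embed x)"] by (auto simp: star_star intro!: cpos_scaleR)
  then obtain k where k: "star k = k" "s = k * k" by (auto simp: cpos_def)
  define E where "E = 1 - s"
  have "star E = E" "norm (1 *\<^sub>R 1 - E) \<le> 1" using ns ss by (simp_all add: E_def star_diff)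
  then obtain m where m: "star m = m" "m * m = E" by (rule cstar_sqrt_scaled) blast
  have Em: "E ^ N = m ^ N * m ^ N" for N
    by (simp only: m(2)[symmetric] power2_eq_square[symmetric] power_mult[symmetric] power_add[symmetric] mult_2 mult_2_right)
  have sm: "star (m ^ N) = m ^ N" for N by (simp add: star_power m)
  have sE: "s * E ^ N = E ^ N * s" for N
    by (rule power_commuting_commutes[symmetric]) (simp add: E_def algebra_simps)
  \<comment> \<open>In scalars: \<open>N * s * (1 - s) ^ N\<close> is at most
    \<open>1 - (1 - s) ^ N\<close>. From \<open>N\<close> to \<open>Suc N\<close> the difference
    grows by \<open>Suc N\<close> times the positive element \<open>s * E ^ N * s\<close>.\<close>
  have D: "cpos (1 - E ^ N - real N *\<^sub>R (s * E ^ N))" for N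
  proof (induction N)
    case (Suc N)
    have ES: "E ^ Suc N = E ^ N - E ^ N * s" by (simp add: power_Suc2 E_def algebra_simps del: power_Suc)
    have sES: "s * E ^ Suc N = E ^ N * s - E ^ N * s * s"
      by (simp add: ES right_diff_distrib sE del: power_Suc flip: mult.assoc)
    have "1 - E ^ Suc N - real (Suc N) *\<^sub>R (s * E ^ Suc N)
        = (1 - E ^ N - real N *\<^sub>R (s * E ^ N)) + real (Suc N) *\<^sub>R (s * E ^ N * s)"
      unfolding sES unfolding sE ES by (simp add: algebra_simps)
    also have "s * E ^ N * s = star (m ^ N * s) * (m ^ N * s)"
      by (simp add: star_mult sm ss Em mult.assoc)
    finally show ?case using Suc by (simp only:) (intro cpos_add cpos_scaleR cpos_star_mult; simp)
  qed simp
  \<comment> \<open>The squared error below is at most \<open>t / M\<close>, which this choice makes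
    smaller than the square of \<open>e\<close>; the maximum with 1 keeps \<open>M\<close>
    positive.\<close>
  obtain M :: nat where M: "t / e\<^sup>2 < real M" "0 < M"
    using reals_Archimedean2[of "max 1 (t / e\<^sup>2)"] by (metis gr0I less_numeral_extra(3) max_less_iff_conj of_nat_0 zero_less_one order_less_trans)
  have EM: "star (E ^ M) = E ^ M" by (simp add: star_power E_def star_diff ss)
  \<comment> \<open>An even exponent makes \<open>E ^ (M + M)\<close> a square, so it can be added
    back to leave a bound against \<open>1\<close>, and allows \<open>s * E ^ (M + M)\<close> to be
    written symmetrically.\<close>
  have "cpos (1 - E ^ (M + M) - real (M + M) *\<^sub>R (s * E ^ (M + M)) + E ^ (M + M))"
    by (rule cpos_add[OF D]) (simp add: Em cposI sm)
  also have "s * E ^ (M + M) = E ^ M * s * E ^ M" by (simp add: power_add sE[symmetric] mult.assoc)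
  finally have "cpos (1 *\<^sub>R 1 - real (M + M) *\<^sub>R (E ^ M * s * E ^ M))" by (simp add: algebra_simps)
  moreover have "cpos (real (M + M) *\<^sub>R (E ^ M * s * E ^ M))"
  proof (rule cpos_scaleR)
    have "E ^ M * s * E ^ M = star (k * E ^ M) * (k * E ^ M)" by (simp add: star_mult EM k mult.assoc)
    then show "cpos (E ^ M * s * E ^ M)" by (simp only: cpos_star_mult)
  qed simp
  ultimately have "norm (real (M + M) *\<^sub>R (E ^ M * s * E ^ M)) \<le> 1" by (intro cpos_norm_le) auto
  then have nM: "real M * norm (E ^ M * s * E ^ M) \<le> 1" by simp
  have "(norm (E ^ M * embed x))\<^sup>2 = norm (E ^ M * (t *\<^sub>R s) * E ^ M)"
    using t by (simp add: sx star_mult EM mult.assoc flip: norm_mult_star)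
  then have "(norm (E ^ M * embed x))\<^sup>2 = t * norm (E ^ M * s * E ^ M)" using t by simp
  also have "\<dots> \<le> t / real M" using nM M t by (simp add: field_simps)
  also have "\<dots> < e\<^sup>2" using M assms by (simp add: field_simps)
  finally have small: "norm (E ^ M * embed x) < e" using assms by (simp add: power_less_imp_less_base)
  \<comment> \<open>Each increment \<open>s * E ^ N\<close> has a factor in the algebra, which is an
    ideal; so the candidate unit is an element of the algebra although \<open>E\<close> is
    not.\<close>
  have "\<exists>u. 1 - E ^ N = embed u" for N
  proof (induction N)
    case 0
    show ?case by (intro exI[of _ 0]) (simp add: multiplier_eqI)
  next
    case (Suc N)
    then obtain u where u: "1 - E ^ N = embed u" by blast
    have "1 - E ^ Suc N = (1 - E ^ N) + s * E ^ N" by (simp add: E_def algebra_simps)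
    also have "\<dots> = embed (u + ract (E ^ N) s0)" by (simp add: u s_def embed_lact embed_add)
    finally show ?case by blast
  qed
  then obtain u where u: "1 - E ^ M = embed u" by blast
  have "embed (u * x - x) = embed u * embed x - embed x"
    by (rule multiplier_eqI) (simp add: left_diff_distrib mult.assoc)
  also have "\<dots> = - (E ^ M * embed x)" unfolding u[symmetric] by (simp add: left_diff_distrib)
  finally have "embed (u * x - x) = - (E ^ M * embed x)" .
  then have "norm (u * x - x) < e" using small norm_embed[of "u * x - x"] by simp
  then show ?thesis by (rule that)
qed

section \<open>Contractivity of homomorphisms\<close>

lemma star_homD:
  assumes "star_hom \<phi>"
  shows "\<phi> (x + y) = \<phi> x + \<phi> y" "\<phi> (c *\<^sub>C x) = c *\<^sub>C \<phi> x" "\<phi> (x * y) = \<phi> x * \<phi> y"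
    "\<phi> (star x) = star (\<phi> x)"
  using assms by (auto simp: star_hom_def)

lemma star_hom_diff: "star_hom \<phi> \<Longrightarrow> \<phi> (x - y) = \<phi> x - \<phi> y"
  using star_homD(1)[of \<phi> "x - y" y] by simp

lemma star_hom_comp: "star_hom \<phi> \<Longrightarrow> star_hom \<psi> \<Longrightarrow> star_hom (\<psi> \<circ> \<phi>)"
  by (simp add: star_hom_def)

text \<open>The domain may lack a unit, so \<open>\<phi>\<close> cannot be applied to the defect of
  \<open>g = star c * c\<close>. Applied to the defect identity multiplied by \<open>g\<close> on
  both sides, it gives \<open>norm (\<phi> g * \<phi> g) \<le> norm g * norm (\<phi> g)\<close>; for
  self-adjoint \<open>\<phi> g\<close> one factor cancels.\<close>

lemma star_hom_contractive_unital:
  fixes \<phi> :: "'a::cstar_algebra \<Rightarrow> 'b::{cstar_algebra,monoid_mult}"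
  assumes \<phi>: "star_hom \<phi>"
  shows "norm (\<phi> c) \<le> norm c"
proof -
  note h = star_homD[OF \<phi>] star_hom_diff[OF \<phi>]
  have hr: "\<phi> (r *\<^sub>R x) = r *\<^sub>R \<phi> x" for r x by (simp add: scaleR_scaleC h)
  define g where "g = star c * c"
  have sg: "star g = g" by (simp add: g_def star_mult star_star)
  obtain z where z: "\<And>a b. star (lact z a) * lact z b
    = (norm (embed g))\<^sup>2 *\<^sub>R (star a * b) - star (lact (embed g) a) * lact (embed g) b"
    using ex_defect_lact by blast
  have "cpos ((norm g)\<^sup>2 *\<^sub>R (star (\<phi> g) * \<phi> g) - star (\<phi> (g * g)) * \<phi> (g * g))"
    using cpos_star_mult[of "\<phi> (lact z g)"] z[of g g] by (simp add: norm_embed h hr flip: h(3,4))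
  then have "norm (star (\<phi> (g * g)) * \<phi> (g * g)) \<le> norm ((norm g)\<^sup>2 *\<^sub>R (star (\<phi> g) * \<phi> g))"
    by (intro cpos_norm_mono cpos_star_mult)
  then have "(norm (\<phi> (g * g)))\<^sup>2 \<le> (norm g * norm (\<phi> g))\<^sup>2"
    by (simp add: cstar_identity power_mult_distrib)
  then have "norm (\<phi> g * \<phi> g) \<le> norm g * norm (\<phi> g)"
    unfolding h(3) by (rule power2_le_imp_le) simp
  moreover have "star (\<phi> g) = \<phi> g" using sg h(4)[of g] by simp
  ultimately have "norm (\<phi> g) * norm (\<phi> g) \<le> norm g * norm (\<phi> g)"
    using norm_mult_self_sa[of "\<phi> g"] by (simp add: power2_eq_square)
  then have "norm (\<phi> g) \<le> norm g"
    by (cases "norm (\<phi> g) = 0") (auto simp: mult_le_cancel_right)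
  then have "(norm (\<phi> c))\<^sup>2 \<le> (norm c)\<^sup>2" by (simp add: g_def h cstar_identity)
  then show ?thesis by (rule power2_le_imp_le) simp
qed

lemma star_hom_contractive:
  fixes \<phi> :: "'a::cstar_algebra \<Rightarrow> 'b::cstar_algebra"
  assumes \<phi>: "star_hom \<phi>"
  shows "norm (\<phi> c) \<le> norm c"
  using star_hom_contractive_unital[OF star_hom_comp[OF \<phi> star_hom_embed]] by (simp add: norm_embed)

section \<open>The Hahn-Banach theorem through minimal sublinear functionals\<close>

definition sublinear :: "('a::real_vector \<Rightarrow> real) \<Rightarrow> bool" where
  "sublinear q \<longleftrightarrow> (\<forall>x y. q (x + y) \<le> q x + q y) \<and> (\<forall>r x. 0 \<le> r \<longrightarrow> q (r *\<^sub>R x) = r * q x)"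

lemma sublinearD:
  assumes "sublinear q"
  shows "q (x + y) \<le> q x + q y" "0 \<le> r \<Longrightarrow> q (r *\<^sub>R x) = r * q x" "q 0 = 0" "- q (- x) \<le> q x"
proof -
  show a: "q (x + y) \<le> q x + q y" for x y using assms by (auto simp: sublinear_def)
  show b: "0 \<le> r \<Longrightarrow> q (r *\<^sub>R x) = r * q x" for r x using assms by (auto simp: sublinear_def)
  show c: "q 0 = 0" using b[of 0 0] by simp
  show "- q (- x) \<le> q x" using a[of "-x" x] c by simp
qed

text \<open>The infimum of \<open>q (x + t *\<^sub>R y) - t * q y\<close> over
  \<open>t \<ge> 0\<close> is still sublinear. Taking \<open>t = 0\<close> puts it below
  \<open>q\<close>, taking \<open>t = 1\<close> at \<open>- y\<close> gives the last bound. A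
  functional that cannot be lowered in this way is odd.\<close>

lemma sublinear_lower:
  fixes q :: "'a::real_vector \<Rightarrow> real" and y :: 'a
  assumes q: "sublinear q"
  obtains q' where "sublinear q'" "\<And>x. q' x \<le> q x" "q' (- y) \<le> - q y"
proof -
  define F where "F x t = q (x + t *\<^sub>R y) - t * q y" for x t
  define q' where "q' x = (INF t\<in>{0..}. F x t)" for x
  have lb: "- q (- x) \<le> F x t" if "0 \<le> t" for x t
    using sublinearD(1)[OF q, of "x + t *\<^sub>R y" "- x"] sublinearD(2)[OF q that, of y] by (simp add: F_def)
  have bdd: "bdd_below (F x ` {0..})" for x using lb by (auto simp: bdd_below_def intro!: exI[of _ "- q (- x)"])
  have le: "q' x \<le> F x t" if "0 \<le> t" for x t unfolding q'_def by (rule cINF_lower[OF bdd]) (use that in auto)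
  have ge: "c \<le> q' x" if "\<And>t. 0 \<le> t \<Longrightarrow> c \<le> F x t" for c x
    unfolding q'_def by (rule cINF_greatest) (use that in auto)
  have "sublinear q'"
    unfolding sublinear_def
  proof (intro conjI allI impI)
    fix x x' :: 'a
    have *: "q' (x + x') \<le> F x t + F x' s" if "0 \<le> t" "0 \<le> s" for s t
    proof -
      have "q' (x + x') \<le> F (x + x') (t + s)" using that by (intro le) auto
      also have "\<dots> \<le> F x t + F x' s"
        using sublinearD(1)[OF q, of "x + t *\<^sub>R y" "x' + s *\<^sub>R y"] by (simp add: F_def algebra_simps)
      finally show ?thesis .
    qed
    have "q' (x + x') - F x' s \<le> q' x" if "0 \<le> s" for s by (rule ge) (use *[OF _ that] in \<open>simp add: algebra_simps\<close>)
    then have "q' (x + x') - q' x \<le> q' x'" by (intro ge) (simp add: algebra_simps)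
    then show "q' (x + x') \<le> q' x + q' x'" by simp
  next
    fix r :: real and x assume r: "0 \<le> r"
    have hom: "r * q' x \<le> q' (r *\<^sub>R x)" if "0 < r" for r x
    proof (rule ge)
      fix t :: real assume t: "0 \<le> t"
      have "r * q' x \<le> r * F x (t / r)" using that t by (intro mult_left_mono le) auto
      also have "\<dots> = F (r *\<^sub>R x) t"
        using that sublinearD(2)[OF q, of r "x + (t / r) *\<^sub>R y"] by (simp add: F_def algebra_simps)
      finally show "r * q' x \<le> F (r *\<^sub>R x) t" .
    qed
    show "q' (r *\<^sub>R x) = r * q' x"
    proof (cases "r = 0")
      case True
      have "F 0 t = 0" if "0 \<le> t" for t using sublinearD(2)[OF q that] by (simp add: F_def)
      then have "q' 0 = 0" using le[of 0 0] ge[of 0 0] by (intro antisym) auto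
      then show ?thesis using True by simp
    next
      case False
      then have "r * q' x \<le> q' (r *\<^sub>R x)" "inverse r * q' (r *\<^sub>R x) \<le> q' (inverse r *\<^sub>R r *\<^sub>R x)"
        using r False hom[of r x] hom[of "inverse r" "r *\<^sub>R x"] by simp_all
      then show ?thesis using False r by (simp add: field_simps)
    qed
  qed
  moreover have "q' x \<le> q x" for x using le[of 0 x] by (simp add: F_def)
  moreover have "q' (- y) \<le> - q y" using le[of 1 "- y"] sublinearD(3)[OF q] by (simp add: F_def)
  ultimately show ?thesis by (rule that)
qed

text \<open>Zorn's lemma is applied to sublinear functionals on the whole space, not to partial
  extensions. A minimal one is odd and therefore linear. Starting below a functional with value at
  most \<open>- norm x0\<close> at \<open>- x0\<close> forces the value at
  \<open>x0\<close>.\<close>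

lemma Hahn_Banach_norming:
  fixes x0 :: "'a::real_normed_vector"
  obtains f where "linear f" "\<And>x. f x \<le> norm x" "f x0 = norm x0"
proof -
  have "sublinear (norm :: 'a \<Rightarrow> real)" by (simp add: sublinear_def norm_triangle_ineq)
  then obtain p where p: "sublinear p" "\<And>x. p x \<le> norm x" "p (- x0) \<le> - norm x0"
    by (rule sublinear_lower[where y = x0]) blast
  define A where "A = {q. sublinear q \<and> (\<forall>x. q x \<le> p x)}"
  \<comment> \<open>The order is reversed, so that the maximal element delivered by Zorn's lemma is
    a pointwise minimal functional.\<close>
  define R where "R q q' \<longleftrightarrow> (\<forall>x. q' x \<le> q x)" for q q' :: "'a \<Rightarrow> real"
  have po: "partial_order_on A (relation_of R A)"
    by (rule partial_order_on_relation_ofI) (auto simp: R_def fun_eq_iff intro: order_trans antisym)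
  have "\<exists>u\<in>A. \<forall>a\<in>C. R a u" if C: "C \<in> Chains (relation_of R A)" for C
  proof (cases "C = {}")
    case True
    then show ?thesis using p by (auto simp: A_def)
  next
    case False
    have CA: "C \<subseteq> A" using C by (auto simp: Chains_def relation_of_def)
    have Cc: "R a b \<or> R b a" if "a \<in> C" "b \<in> C" for a b using C that by (auto simp: Chains_def relation_of_def)
    define u where "u x = (INF q\<in>C. q x)" for x
    have lb: "- p (- x) \<le> q x" if "q \<in> C" for q x
    proof -
      have "sublinear q" "q (- x) \<le> p (- x)" using that CA by (auto simp: A_def)
      then show ?thesis using sublinearD(4)[of q x] by linarith
    qed
    have le: "u x \<le> q x" if "q \<in> C" for q x
      unfolding u_def by (rule cINF_lower) (use lb that in \<open>auto simp: bdd_below_def intro!: exI[of _ "- p (- x)"]\<close>)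
    have ge: "c \<le> u x" if "\<And>q. q \<in> C \<Longrightarrow> c \<le> q x" for c x
      unfolding u_def by (rule cINF_greatest) (use that False in auto)
    have "sublinear u"
      unfolding sublinear_def
    proof (intro conjI allI impI)
      fix x y
      have *: "u (x + y) \<le> q x + q' y" if q: "q \<in> C" "q' \<in> C" for q q'
      proof -
        obtain r where r: "r \<in> C" "r x \<le> q x" "r y \<le> q' y" using Cc[OF q] q by (auto simp: R_def)
        have "u (x + y) \<le> r (x + y)" by (rule le[OF r(1)])
        also have "\<dots> \<le> r x + r y" using r(1) CA by (intro sublinearD) (auto simp: A_def)
        finally show ?thesis using r by linarith
      qed
      have "u (x + y) - q' y \<le> u x" if "q' \<in> C" for q' by (rule ge) (use *[OF _ that] in \<open>simp add: algebra_simps\<close>)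
      then have "u (x + y) - u x \<le> u y" by (intro ge) (simp add: algebra_simps)
      then show "u (x + y) \<le> u x + u y" by simp
    next
      fix r :: real and x assume r: "0 \<le> r"
      have qr: "q (r *\<^sub>R x) = r * q x" if "q \<in> C" "0 \<le> r" for q r x
        using that CA by (intro sublinearD) (auto simp: A_def)
      have hom: "r * u x \<le> u (r *\<^sub>R x)" if "0 \<le> r" for r x
        by (rule ge) (simp add: qr that mult_left_mono le)
      show "u (r *\<^sub>R x) = r * u x"
      proof (cases "r = 0")
        case True
        obtain q where "q \<in> C" using False by blast
        have "u 0 = 0"
          using le[OF \<open>q \<in> C\<close>, of 0] hom[of 0 0] qr[OF \<open>q \<in> C\<close>, of 0 0] by simp
        then show ?thesis using True by simp
      next
        case False
        then have "r * u x \<le> u (r *\<^sub>R x)" "inverse r * u (r *\<^sub>R x) \<le> u (inverse r *\<^sub>R r *\<^sub>R x)"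
          using r False hom[of r x] hom[of "inverse r" "r *\<^sub>R x"] by simp_all
        then show ?thesis using False r by (simp add: field_simps)
      qed
    qed
    moreover have "u x \<le> p x" for x
    proof -
      obtain q where "q \<in> C" using False by blast
      then show ?thesis using le[of q x] CA by (auto simp: A_def intro: order_trans)
    qed
    ultimately show ?thesis using le by (auto simp: A_def R_def intro!: bexI[of _ u])
  qed
  from predicate_Zorn[OF po this] obtain f where f: "f \<in> A" "\<And>a. a \<in> A \<Longrightarrow> R f a \<Longrightarrow> a = f" by blast
  have sf: "sublinear f" and fp: "\<And>x. f x \<le> p x" using f(1) by (auto simp: A_def)
  \<comment> \<open>By minimality \<open>f\<close> coincides with its own lowering in direction
    \<open>y\<close>.\<close>
  have odd: "f (- y) = - f y" for y
  proof -
    obtain q where q: "sublinear q" "\<And>x. q x \<le> f x" "q (- y) \<le> - f y"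
      by (rule sublinear_lower[OF sf, of y]) blast
    have "q = f" using q fp by (intro f(2)) (auto simp: A_def R_def intro: order_trans)
    then show ?thesis using q(3) sublinearD(4)[OF sf, of y] by simp
  qed
  have "linear f"
  proof (rule linearI)
    fix x y r
    show "f (x + y) = f x + f y"
      using sublinearD(1)[OF sf, of x y] sublinearD(1)[OF sf, of "-x" "-y"] odd[of "x + y"]
      by (simp add: odd)
    show "f (r *\<^sub>R x) = r *\<^sub>R f x"
    proof (cases "0 \<le> r")
      case False
      then show ?thesis using sublinearD(2)[OF sf, of "- r" x] odd[of "r *\<^sub>R x"] by simp
    qed (simp add: sublinearD(2)[OF sf])
  qed
  moreover have "f x \<le> norm x" for x using fp[of x] p(2)[of x] by linarith
  moreover have "f x0 = norm x0"
    using odd[of x0] fp[of "- x0"] p(3) \<open>f x0 \<le> norm x0\<close> by linarith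
  ultimately show ?thesis by (rule that)
qed

text \<open>For the nontrivial inequality, subtract \<open>1 + g\<close> from its norm times
  \<open>1\<close>: the positive difference says that \<open>g\<close> lies below
  \<open>norm (1 + g) - 1\<close>.\<close>

lemma norm_one_plus_cpos:
  fixes g :: "'a::{cstar_algebra,monoid_mult}"
  assumes "cpos g" "norm (1 :: 'a) = 1"
  shows "norm (1 + g) = 1 + norm g"
proof (rule antisym)
  show "norm (1 + g) \<le> 1 + norm g" using norm_triangle_ineq[of 1 g] assms by simp
  have c1: "cpos (1 :: 'a)" using cposI[of "1::'a"] by simp
  have 1: "1 \<le> norm (1 + g)" using cpos_norm_mono[OF c1, of "1 + g"] assms by simp
  have "cpos (norm (1 + g) *\<^sub>R 1 - (1 + g))"
    by (rule cpos_bound_minus) (simp_all add: star_add cpos_sa assms)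
  then have "cpos ((norm (1 + g) - 1) *\<^sub>R 1 - g)" by (simp add: algebra_simps)
  then have "norm g \<le> norm (1 + g) - 1" using 1 assms by (intro cpos_norm_le) auto
  then show "1 + norm g \<le> norm (1 + g)" by simp
qed

lemma embed_scaleR: "embed (r *\<^sub>R x) = r *\<^sub>R embed x"
  by (simp add: scaleR_scaleC embed_scaleC)

text \<open>A functional of norm \<open>1\<close> that norms \<open>1 + g\<close> is positive and norms \<open>g\<close>, because
  \<open>norm (1 + g) = 1 + norm g\<close>.\<close>

lemma ex_norming_positive_functional:
  fixes y :: "'a::cstar_algebra"
  obtains \<phi> :: "'a \<Rightarrow> complex" where
    "\<And>a b. \<phi> (a + b) = \<phi> a + \<phi> b" "\<And>c a. \<phi> (c *\<^sub>C a) = c * \<phi> a" "\<And>a. \<phi> (star a) = cnj (\<phi> a)"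
    "\<And>a. 0 \<le> Re (\<phi> (star a * a))" "\<And>a. Re (\<phi> (star a * a)) \<le> (norm a)\<^sup>2"
    "\<phi> (star y * y) = of_real ((norm y)\<^sup>2)"
proof (cases "y = 0")
  case True
  show ?thesis by (rule that[of "\<lambda>_. 0"]) (use True in auto)
next
  case False
  define g where "g = embed (star y * y)"
  have g: "cpos g" by (simp add: g_def embed_mult embed_star cpos_star_mult)
  \<comment> \<open>\<open>y \<noteq> 0\<close> rules out the zero algebra, the only case in which
    the multiplier unit has norm less than 1.\<close>
  have n1: "norm (1 :: 'a multiplier) = 1"
  proof -
    have "norm (embed y) \<le> norm (1 :: 'a multiplier) * norm (embed y)" using norm_mult_ineq[of 1 "embed y"] by simp
    then have "1 \<le> norm (1 :: 'a multiplier)" using False by (simp add: norm_embed)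
    then show ?thesis using norm_one_le[where 'a="'a multiplier"] by linarith
  qed
  obtain f :: "'a multiplier \<Rightarrow> real" where f: "linear f" "\<And>x. f x \<le> norm x" "f (1 + g) = norm (1 + g)"
    using Hahn_Banach_norming by blast
  have fg: "f 1 = 1" "f g = norm g"
    using f(2)[of 1] f(2)[of g] f(3) n1 norm_one_plus_cpos[OF g n1] by (auto simp: linear_add[OF f(1)])
  \<comment> \<open>The distance of \<open>h\<close> from \<open>norm h *\<^sub>R 1\<close> is at
    most \<open>norm h\<close>, and \<open>f 1 = 1\<close>; hence \<open>f h\<close> cannot be
    negative.\<close>
  have fpos: "0 \<le> f h" if "cpos h" for h
  proof -
    have "f (norm h *\<^sub>R 1 - h) \<le> norm h" using f(2)[of "norm h *\<^sub>R 1 - h"] cpos_norm[OF that, of "norm h"] by simp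
    then show ?thesis by (simp add: linear_diff[OF f(1)] linear_cmul[OF f(1)] fg)
  qed
  define F where "F x = f (embed x)" for x
  have F: "F (a + b) = F a + F b" "F (r *\<^sub>R a) = r * F a" "F (- a) = - F a" for a b r
    by (simp_all add: F_def embed_add linear_add[OF f(1)] embed_scaleR linear_cmul[OF f(1)])
       (metis (no_types) embed_scaleR f(1) linear_cmul mult_minus1 real_scaleR_def scaleR_minus1_left)
  \<comment> \<open>The real functional \<open>F\<close> is kept on self-adjoint elements and
    extended complex linearly: the two components are \<open>F\<close> of the real and of the
    imaginary part of \<open>x\<close>.\<close>
  define \<phi> where "\<phi> x = Complex ((F x + F (star x)) / 2) ((F (\<i> *\<^sub>C star x) - F (\<i> *\<^sub>C x)) / 2)" for x
  have sa: "\<phi> x = of_real (F x)" if "star x = x" for x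
    using that by (simp add: \<phi>_def complex_eq_iff)
  have nc: "(- c) *\<^sub>C x = - (c *\<^sub>C x)" for c and x :: 'a
    using scaleC_scaleC[of "-1" c x] by (simp add: scaleC_minus_one)
  show ?thesis
  proof (rule that[of \<phi>])
    show add: "\<phi> (a + b) = \<phi> a + \<phi> b" for a b
      by (simp add: \<phi>_def F star_add scaleC_add_right complex_eq_iff add_divide_distrib diff_divide_distrib)
    have re: "\<phi> (complex_of_real r *\<^sub>C a) = of_real r * \<phi> a" for r a
    proof -
      have "\<i> *\<^sub>C r *\<^sub>R x = r *\<^sub>R \<i> *\<^sub>C x" for x :: 'a by (simp add: scaleR_scaleC scaleC_scaleC mult.commute)
      then show ?thesis
        by (simp add: \<phi>_def F star_scaleR complex_eq_iff algebra_simps flip: scaleR_scaleC)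
    qed
    have im: "\<phi> (\<i> *\<^sub>C a) = \<i> * \<phi> a" for a
      by (simp add: \<phi>_def F star_scaleC nc scaleC_scaleC scaleC_minus_right scaleC_minus_one scaleC_one complex_eq_iff)
         (simp add: field_simps)
    show "\<phi> (c *\<^sub>C a) = c * \<phi> a" for c a
    proof -
      have "c *\<^sub>C a = complex_of_real (Re c) *\<^sub>C a + \<i> *\<^sub>C complex_of_real (Im c) *\<^sub>C a"
        using complex_eq[of c] by (metis scaleC_add_left scaleC_scaleC)
      then have "\<phi> (c *\<^sub>C a) = (of_real (Re c) + \<i> * of_real (Im c)) * \<phi> a"
        by (simp only: add re im) (simp add: algebra_simps)
      then show ?thesis by (simp only: complex_eq[of c, symmetric])
    qed
    show "\<phi> (star a) = cnj (\<phi> a)" for a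
      by (simp add: \<phi>_def star_star complex_eq_iff) (simp add: field_simps)
    have pf: "\<phi> (star a * a) = of_real (F (star a * a))" for a by (rule sa) (simp add: star_mult star_star)
    show "0 \<le> Re (\<phi> (star a * a))" for a
      unfolding pf using fpos[OF cpos_star_mult[of "embed a"]] by (simp add: F_def embed_mult embed_star)
    show "Re (\<phi> (star a * a)) \<le> (norm a)\<^sup>2" for a
      unfolding pf using f(2)[of "embed (star a * a)"] by (simp add: F_def norm_embed cstar_identity)
    show "\<phi> (star y * y) = of_real ((norm y)\<^sup>2)"
      unfolding pf F_def using fg by (simp add: g_def norm_embed cstar_identity)
  qed
qed

section \<open>Semi-inner product spaces\<close>

text \<open>Testing \<open>t = - s z\<close> with real \<open>s\<close> reduces this to a real
  quadratic, for which \<open>s = 1 / b\<close> is optimal. The case \<open>b = 0\<close> occurs for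
  null vectors of a semi-inner product, and \<open>a = 0\<close> will give orthogonality to a
  closest point.\<close>

lemma discriminant_complex:
  fixes z :: complex and a b :: real
  assumes b: "0 \<le> b" and q: "\<And>t. 0 \<le> a + 2 * Re (cnj t * z) + (cmod t)\<^sup>2 * b"
  shows "(cmod z)\<^sup>2 \<le> a * b"
proof -
  have r: "0 \<le> a - 2 * s * (cmod z)\<^sup>2 + s\<^sup>2 * (cmod z)\<^sup>2 * b" for s :: real
  proof -
    have "Re (cnj (- (of_real s * z)) * z) = - s * (cmod z)\<^sup>2"
      unfolding cmod_power2 by (simp add: power2_eq_square algebra_simps)
    moreover have "(cmod (- (of_real s * z)))\<^sup>2 = s\<^sup>2 * (cmod z)\<^sup>2" by (simp add: norm_mult power_mult_distrib)
    ultimately show ?thesis using q[of "- (of_real s * z)"] by simp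
  qed
  show ?thesis
  proof (cases "b = 0")
    case True
    have "cmod z = 0"
    proof (rule ccontr)
      assume "cmod z \<noteq> 0"
      \<comment> \<open>With \<open>b = 0\<close> this \<open>s\<close> makes the quadratic equal to
        \<open>a - (a + 1) = -1\<close>.\<close>
      then show False using r[of "(a + 1) / (2 * (cmod z)\<^sup>2)"] True by (simp add: field_simps)
    qed
    then show ?thesis using True by simp
  next
    case False
    then have "0 < b" using b by simp
    then have "0 \<le> (a * b - (cmod z)\<^sup>2) / b" using r[of "1 / b"] by (simp add: field_simps power2_eq_square)
    then show ?thesis using \<open>0 < b\<close> by (simp add: zero_le_divide_iff)
  qed
qed

text \<open>The common ground of Hilbert spaces, of an algebra with the form of a positive
  functional, and of the Cauchy sequences of such a space. Neither definiteness nor vector space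
  laws are included; identities between vectors are used in the form of equal norms, through
  \<open>hnorm_cong\<close>.\<close>

locale semi_hilbert =
  fixes H :: "'h hilbert"
  assumes zero_mem [simp]: "hzero H \<in> hcarrier H"
    and add_mem [simp]: "x \<in> hcarrier H \<Longrightarrow> y \<in> hcarrier H \<Longrightarrow> hadd H x y \<in> hcarrier H"
    and scale_mem [simp]: "x \<in> hcarrier H \<Longrightarrow> hscale H c x \<in> hcarrier H"
    and ip_zero [simp]: "x \<in> hcarrier H \<Longrightarrow> hinner H (hzero H) x = 0"
    and ip_add [simp]: "x \<in> hcarrier H \<Longrightarrow> y \<in> hcarrier H \<Longrightarrow> z \<in> hcarrier H \<Longrightarrow>
          hinner H (hadd H x y) z = hinner H x z + hinner H y z"
    and ip_scale [simp]: "x \<in> hcarrier H \<Longrightarrow> y \<in> hcarrier H \<Longrightarrow>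
          hinner H (hscale H a x) y = a * hinner H x y"
    and ip_commute: "x \<in> hcarrier H \<Longrightarrow> y \<in> hcarrier H \<Longrightarrow>
          hinner H x y = cnj (hinner H y x)"
    and ip_nonneg: "x \<in> hcarrier H \<Longrightarrow> 0 \<le> Re (hinner H x x)"
begin

abbreviation "hsub x y \<equiv> hadd H x (hscale H (-1) y)"

lemma ip_zero_right [simp]: "x \<in> hcarrier H \<Longrightarrow> hinner H x (hzero H) = 0"
  using ip_commute[of x "hzero H"] by simp

lemma ip_add_right [simp]: "x \<in> hcarrier H \<Longrightarrow> y \<in> hcarrier H \<Longrightarrow> z \<in> hcarrier H \<Longrightarrow>
    hinner H x (hadd H y z) = hinner H x y + hinner H x z"
  using ip_commute[of x "hadd H y z"] ip_commute[of x y] ip_commute[of x z] by simp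

lemma ip_scale_right [simp]: "x \<in> hcarrier H \<Longrightarrow> y \<in> hcarrier H \<Longrightarrow>
    hinner H x (hscale H a y) = cnj a * hinner H x y"
  using ip_commute[of x "hscale H a y"] ip_commute[of x y] by simp

lemma ip_Im [simp]: "x \<in> hcarrier H \<Longrightarrow> Im (hinner H x x) = 0"
  using arg_cong[OF ip_commute[of x x], of Im] by simp

lemma hnorm_nonneg [simp]: "x \<in> hcarrier H \<Longrightarrow> 0 \<le> hnorm H x"
  by (simp add: hnorm_def ip_nonneg)

lemma hnorm_sq: "x \<in> hcarrier H \<Longrightarrow> (hnorm H x)\<^sup>2 = Re (hinner H x x)"
  by (simp add: hnorm_def ip_nonneg)

lemma ip_self: "x \<in> hcarrier H \<Longrightarrow> hinner H x x = of_real ((hnorm H x)\<^sup>2)"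
  by (simp add: complex_eq_iff hnorm_sq)

lemma Cauchy_Schwarz:
  assumes x: "x \<in> hcarrier H" and y: "y \<in> hcarrier H"
  shows "cmod (hinner H x y) \<le> hnorm H x * hnorm H y"
proof -
  have "(cmod (hinner H x y))\<^sup>2 \<le> (hnorm H x)\<^sup>2 * (hnorm H y)\<^sup>2"
  proof (rule discriminant_complex)
    fix t :: complex
    have yx: "hinner H y x = cnj (hinner H x y)" by (rule ip_commute[OF y x])
    have "0 \<le> Re (hinner H (hadd H x (hscale H t y)) (hadd H x (hscale H t y)))"
      using x y by (intro ip_nonneg) simp
    also have "\<dots> = (hnorm H x)\<^sup>2 + 2 * Re (cnj t * hinner H x y) + (cmod t)\<^sup>2 * (hnorm H y)\<^sup>2"
      unfolding hnorm_sq[OF x] hnorm_sq[OF y] cmod_power2 using x y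
      by (simp add: yx) (simp add: power2_eq_square algebra_simps)
    finally show "0 \<le> (hnorm H x)\<^sup>2 + 2 * Re (cnj t * hinner H x y) + (cmod t)\<^sup>2 * (hnorm H y)\<^sup>2" .
  qed simp
  then have "(cmod (hinner H x y))\<^sup>2 \<le> (hnorm H x * hnorm H y)\<^sup>2" by (simp add: power_mult_distrib)
  then show ?thesis by (rule power2_le_imp_le) (use x y in simp)
qed

lemma hnorm_add_sq: "x \<in> hcarrier H \<Longrightarrow> y \<in> hcarrier H \<Longrightarrow>
    (hnorm H (hadd H x y))\<^sup>2 = (hnorm H x)\<^sup>2 + 2 * Re (hinner H x y) + (hnorm H y)\<^sup>2"
  using ip_commute[of y x] by (simp add: hnorm_sq)

lemma hnorm_triangle:
  assumes "x \<in> hcarrier H" "y \<in> hcarrier H"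
  shows "hnorm H (hadd H x y) \<le> hnorm H x + hnorm H y"
proof (rule power2_le_imp_le)
  have "Re (hinner H x y) \<le> hnorm H x * hnorm H y"
    using Cauchy_Schwarz[OF assms] complex_Re_le_cmod[of "hinner H x y"] by linarith
  then show "(hnorm H (hadd H x y))\<^sup>2 \<le> (hnorm H x + hnorm H y)\<^sup>2"
    using assms by (simp add: hnorm_add_sq power2_sum)
qed (use assms in simp)

lemma hnorm_scale [simp]: "x \<in> hcarrier H \<Longrightarrow> hnorm H (hscale H c x) = cmod c * hnorm H x"
  by (rule power2_eq_imp_eq)
     (simp_all add: power_mult_distrib hnorm_sq cmod_power2, simp add: power2_eq_square algebra_simps)

lemma hnorm_zero [simp]: "hnorm H (hzero H) = 0"
  by (simp add: hnorm_def)

lemma hnorm_cong: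
  assumes "x \<in> hcarrier H" "y \<in> hcarrier H" "\<And>z. z \<in> hcarrier H \<Longrightarrow> hinner H x z = hinner H y z"
  shows "hnorm H x = hnorm H y"
proof -
  have "hinner H x x = hinner H y y"
    using assms(3)[OF assms(1)] assms(3)[OF assms(2)] ip_commute[OF assms(2,1)] ip_commute[OF assms(2,2)]
    by metis
  then show ?thesis by (simp add: hnorm_def)
qed

lemma hnorm_sub_commute:
  assumes "x \<in> hcarrier H" "y \<in> hcarrier H"
  shows "hnorm H (hsub x y) = hnorm H (hsub y x)"
proof -
  have "hnorm H (hsub x y) = hnorm H (hscale H (-1) (hsub y x))"
    by (rule hnorm_cong) (use assms in auto)
  then show ?thesis using assms by simp
qed

lemma hnorm_sub_triangle:
  assumes "x \<in> hcarrier H" "y \<in> hcarrier H" "z \<in> hcarrier H"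
  shows "hnorm H (hsub x z) \<le> hnorm H (hsub x y) + hnorm H (hsub y z)"
proof -
  have "hnorm H (hsub x z) = hnorm H (hadd H (hsub x y) (hsub y z))"
    by (rule hnorm_cong) (use assms in auto)
  also have "\<dots> \<le> hnorm H (hsub x y) + hnorm H (hsub y z)"
    by (rule hnorm_triangle) (use assms in auto)
  finally show ?thesis .
qed

lemma hnorm_diff_le:
  assumes "x \<in> hcarrier H" "y \<in> hcarrier H"
  shows "\<bar>hnorm H x - hnorm H y\<bar> \<le> hnorm H (hsub x y)"
proof -
  have "hnorm H x \<le> hnorm H (hsub x y) + hnorm H y" if "x \<in> hcarrier H" "y \<in> hcarrier H" for x y
  proof -
    have "hnorm H x = hnorm H (hadd H (hsub x y) y)" by (rule hnorm_cong) (use that in auto)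
    then show ?thesis using hnorm_triangle[of "hsub x y" y] that by simp
  qed
  from this[OF assms] this[OF assms(2,1)] hnorm_sub_commute[OF assms] show ?thesis by linarith
qed

lemma hdist_eq: "x \<in> hcarrier H \<Longrightarrow> y \<in> hcarrier H \<Longrightarrow> hdist H x y = hnorm H (hsub x y)"
  by (simp add: hdist_def)

section \<open>Cauchy sequences and limits in a semi-inner product space\<close>

definition hCauchy :: "(nat \<Rightarrow> 'h) \<Rightarrow> bool" where
  "hCauchy X \<longleftrightarrow> (\<forall>n. X n \<in> hcarrier H) \<and>
     (\<forall>e>0. \<exists>N. \<forall>m\<ge>N. \<forall>n\<ge>N. hnorm H (hsub (X m) (X n)) < e)"

definition hlim :: "(nat \<Rightarrow> 'h) \<Rightarrow> 'h \<Rightarrow> bool" where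
  "hlim X x \<longleftrightarrow> x \<in> hcarrier H \<and> (\<forall>n. X n \<in> hcarrier H) \<and> (\<lambda>n. hnorm H (hsub (X n) x)) \<longlonglongrightarrow> 0"

lemma hCauchy_add:
  assumes "hCauchy X" "hCauchy Y" shows "hCauchy (\<lambda>n. hadd H (X n) (Y n))"
  unfolding hCauchy_def
proof (intro conjI allI impI)
  have c: "X n \<in> hcarrier H" "Y n \<in> hcarrier H" for n using assms by (auto simp: hCauchy_def)
  then show "hadd H (X n) (Y n) \<in> hcarrier H" for n by simp
  fix e :: real assume "e > 0"
  then have "0 < e / 2" by simp
  then obtain N N' where N: "\<And>m n. m \<ge> N \<Longrightarrow> n \<ge> N \<Longrightarrow> hnorm H (hsub (X m) (X n)) < e / 2"
    "\<And>m n. m \<ge> N' \<Longrightarrow> n \<ge> N' \<Longrightarrow> hnorm H (hsub (Y m) (Y n)) < e / 2"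
    using assms unfolding hCauchy_def by metis
  have "hnorm H (hsub (hadd H (X m) (Y m)) (hadd H (X n) (Y n))) < e" if "m \<ge> max N N'" "n \<ge> max N N'" for m n
  proof -
    have "hnorm H (hsub (hadd H (X m) (Y m)) (hadd H (X n) (Y n)))
        = hnorm H (hadd H (hsub (X m) (X n)) (hsub (Y m) (Y n)))"
      by (rule hnorm_cong) (use c in auto)
    also have "\<dots> \<le> hnorm H (hsub (X m) (X n)) + hnorm H (hsub (Y m) (Y n))"
      by (rule hnorm_triangle) (use c in auto)
    finally show ?thesis using N(1)[of m n] N(2)[of m n] that by simp
  qed
  then show "\<exists>N. \<forall>m\<ge>N. \<forall>n\<ge>N. hnorm H (hsub (hadd H (X m) (Y m)) (hadd H (X n) (Y n))) < e" by blast
qed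

lemma hCauchy_scale:
  assumes "hCauchy X" shows "hCauchy (\<lambda>n. hscale H c (X n))"
  unfolding hCauchy_def
proof (intro conjI allI impI)
  have X: "X n \<in> hcarrier H" for n using assms by (auto simp: hCauchy_def)
  then show "hscale H c (X n) \<in> hcarrier H" for n by simp
  fix e :: real assume "e > 0"
  then have "0 < e / (cmod c + 1)" by (simp add: add_nonneg_pos)
  then obtain N where N: "\<And>m n. m \<ge> N \<Longrightarrow> n \<ge> N \<Longrightarrow> hnorm H (hsub (X m) (X n)) < e / (cmod c + 1)"
    using assms unfolding hCauchy_def by metis
  have "hnorm H (hsub (hscale H c (X m)) (hscale H c (X n))) < e" if "m \<ge> N" "n \<ge> N" for m n
  proof -
    have "hnorm H (hsub (hscale H c (X m)) (hscale H c (X n))) = hnorm H (hscale H c (hsub (X m) (X n)))"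
      by (rule hnorm_cong) (use X in \<open>auto simp: algebra_simps\<close>)
    also have "\<dots> = cmod c * hnorm H (hsub (X m) (X n))" using X by simp
    also have "\<dots> \<le> (cmod c + 1) * hnorm H (hsub (X m) (X n))"
      using X by (intro mult_right_mono) auto
    also have "\<dots> < (cmod c + 1) * (e / (cmod c + 1))"
      using N[OF that] by (intro mult_strict_left_mono) (auto simp: add_nonneg_pos)
    also have "\<dots> = e" using add_nonneg_pos[of "cmod c" 1] by simp
    finally show ?thesis .
  qed
  then show "\<exists>N. \<forall>m\<ge>N. \<forall>n\<ge>N. hnorm H (hsub (hscale H c (X m)) (hscale H c (X n))) < e" by blast
qed

lemma hCauchy_hnorm_convergent:
  assumes "hCauchy X" shows "convergent (\<lambda>n. hnorm H (X n))"
proof (rule Cauchy_convergent, rule CauchyI)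
  fix e :: real assume "e > 0"
  then obtain N where N: "\<And>m n. m \<ge> N \<Longrightarrow> n \<ge> N \<Longrightarrow> hnorm H (hsub (X m) (X n)) < e"
    using assms unfolding hCauchy_def by metis
  have "norm (hnorm H (X m) - hnorm H (X n)) < e" if "m \<ge> N" "n \<ge> N" for m n
    using N[OF that] hnorm_diff_le[of "X m" "X n"] assms by (simp add: hCauchy_def)
  then show "\<exists>M. \<forall>m\<ge>M. \<forall>n\<ge>M. norm (hnorm H (X m) - hnorm H (X n)) < e" by blast
qed

text \<open>By polarization the inner product is a combination of squared norms of sums of Cauchy
  sequences, and norms of Cauchy sequences converge.\<close>

lemma hCauchy_inner_convergent:
  assumes "hCauchy X" "hCauchy Y" shows "convergent (\<lambda>n. hinner H (X n) (Y n))"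
proof -
  have c: "X n \<in> hcarrier H" "Y n \<in> hcarrier H" for n using assms by (auto simp: hCauchy_def)
  have pol: "hinner H x y = (of_real ((hnorm H (hadd H x y))\<^sup>2) - of_real ((hnorm H (hsub x y))\<^sup>2)
      + \<i> * (of_real ((hnorm H (hadd H x (hscale H \<i> y)))\<^sup>2) - of_real ((hnorm H (hadd H x (hscale H (-\<i>) y)))\<^sup>2))) / 4"
    if "x \<in> hcarrier H" "y \<in> hcarrier H" for x y
    using that by (simp add: hnorm_add_sq complex_eq_iff)
  have sq: "convergent (\<lambda>n. of_real ((r n)\<^sup>2) :: complex)" if r: "convergent r" for r :: "nat \<Rightarrow> real"
  proof -
    obtain L where "r \<longlonglongrightarrow> L" using r by (auto simp: convergent_def)
    then have "(\<lambda>n. of_real ((r n)\<^sup>2) :: complex) \<longlonglongrightarrow> of_real (L\<^sup>2)"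
      by (intro tendsto_of_real tendsto_power)
    then show ?thesis by (auto simp: convergent_def)
  qed
  have "convergent (\<lambda>n. of_real ((hnorm H (hadd H (X n) (hscale H a (Y n))))\<^sup>2) :: complex)" for a
    by (intro sq hCauchy_hnorm_convergent hCauchy_add hCauchy_scale assms)
  moreover have "convergent (\<lambda>n. of_real ((hnorm H (hadd H (X n) (Y n)))\<^sup>2) :: complex)"
    by (intro sq hCauchy_hnorm_convergent hCauchy_add assms)
  ultimately have "convergent (\<lambda>n. (of_real ((hnorm H (hadd H (X n) (Y n)))\<^sup>2) - of_real ((hnorm H (hsub (X n) (Y n)))\<^sup>2)
      + \<i> * (of_real ((hnorm H (hadd H (X n) (hscale H \<i> (Y n))))\<^sup>2) - of_real ((hnorm H (hadd H (X n) (hscale H (-\<i>) (Y n))))\<^sup>2))) / 4 :: complex)"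
    unfolding divide_inverse
    by (intro convergent_diff convergent_add convergent_mult convergent_const)
  then show ?thesis by (subst pol[OF c]) auto
qed

lemma metric_space_hdist:
  assumes "\<And>x y. x \<in> hcarrier H \<Longrightarrow> y \<in> hcarrier H \<Longrightarrow> hnorm H (hsub x y) = 0 \<Longrightarrow> x = y"
  shows "Metric_space (hcarrier H) (hdist H)"
proof
  show "0 \<le> hdist H x y" for x y by (simp add: hdist_def)
  show "hdist H x y = hdist H y x" for x y by (auto simp: hdist_def hnorm_sub_commute)
  show "hdist H x y = 0 \<longleftrightarrow> x = y" if "x \<in> hcarrier H" "y \<in> hcarrier H" for x y
  proof
    assume "x = y"
    have "hnorm H (hsub y y) = hnorm H (hzero H)" by (rule hnorm_cong) (use that in auto)
    then show "hdist H x y = 0" using that \<open>x = y\<close> by (simp add: hdist_eq)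
  qed (use assms that in \<open>simp add: hdist_eq\<close>)
  show "hdist H x z \<le> hdist H x y + hdist H y z"
    if "x \<in> hcarrier H" "y \<in> hcarrier H" "z \<in> hcarrier H" for x y z
    using that by (simp add: hdist_eq hnorm_sub_triangle)
qed

lemma mcomplete_hdist:
  assumes d: "\<And>x y. x \<in> hcarrier H \<Longrightarrow> y \<in> hcarrier H \<Longrightarrow> hnorm H (hsub x y) = 0 \<Longrightarrow> x = y"
  shows "Metric_space.mcomplete (hcarrier H) (hdist H) \<longleftrightarrow> (\<forall>X. hCauchy X \<longrightarrow> (\<exists>x. hlim X x))"
proof -
  interpret M: Metric_space "hcarrier H" "hdist H" by (rule metric_space_hdist[OF d])
  have 1: "M.MCauchy X \<longleftrightarrow> hCauchy X" for X
    unfolding M.MCauchy_def hCauchy_def by (auto simp: hdist_eq image_subset_iff)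
  have 2: "limitin M.mtopology X x sequentially \<longleftrightarrow> hlim X x" if "hCauchy X" for X x
    unfolding M.limitin_metric_dist_null hlim_def
    using that by (auto simp: hdist_eq hCauchy_def)
  show ?thesis unfolding M.mcomplete_def using 1 2 by auto
qed

end

sublocale hilbert_space \<subseteq> semi_hilbert
proof
  fix x assume x: "x \<in> hcarrier H"
  have "hinner H (hadd H (hzero H) (hzero H)) x = hinner H (hzero H) x + hinner H (hzero H) x"
    by (rule inner_add) (use zero_closed x in auto)
  then show "hinner H (hzero H) x = 0" using add_zero[OF zero_closed] by simp
qed (fact zero_closed add_closed scale_closed inner_add inner_scale inner_nonneg | rule inner_commute, assumption+)+

context hilbert_space
begin

lemma hnorm_sub_eq_0D:
  assumes "x \<in> hcarrier H" "y \<in> hcarrier H" "hnorm H (hsub x y) = 0"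
  shows "x = y"
proof -
  have "hinner H (hsub x y) (hsub x y) = 0" using assms ip_self[of "hsub x y"] by simp
  then have z: "hsub x y = hzero H" using assms by (intro inner_definite) auto
  have "hscale H 0 y = hzero H" using assms by (intro inner_definite) auto
  then have yy: "hadd H (hscale H (-1) y) y = hzero H"
    using scale_add_left[of y "-1" 1] scale_one[of y] assms by simp
  have "x = hadd H (hzero H) x" using assms add_zero by simp
  also have "\<dots> = hadd H x (hadd H (hscale H (-1) y) y)" unfolding yy using assms by (intro add_commute) auto
  also have "\<dots> = hadd H (hsub x y) y" using assms by (intro add_assoc[symmetric]) auto
  also have "\<dots> = y" unfolding z using assms add_zero by simp
  finally show ?thesis .
qed

lemma hext:
  assumes "x \<in> hcarrier H" "y \<in> hcarrier H" "\<And>z. z \<in> hcarrier H \<Longrightarrow> hinner H x z = hinner H y z"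
  shows "x = y"
proof (rule hnorm_sub_eq_0D[OF assms(1,2)])
  have "hnorm H (hsub x y) = hnorm H (hzero H)" by (rule hnorm_cong) (use assms in auto)
  then show "hnorm H (hsub x y) = 0" by simp
qed

lemma hCauchy_hlim: "hCauchy X \<Longrightarrow> \<exists>x. hlim X x"
  using mcomplete_hdist[OF hnorm_sub_eq_0D] complete by blast

end

section \<open>Completions\<close>

text \<open>Vectors are identified when they have the same inner products, so the vector space axioms hold
  in the quotient although nothing of the kind is assumed of \<open>S\<close>.\<close>

lemma semi_hilbert_quotient:
  fixes S :: "'w hilbert" and f :: "'w \<Rightarrow> 'h"
  assumes S: "semi_hilbert S" and f: "inj f"
    and complete: "\<And>X. semi_hilbert.hCauchy S X \<Longrightarrow> \<exists>x. semi_hilbert.hlim S X x"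
  obtains H :: "'h hilbert" and q where "hilbert_space H" "hcarrier H = q ` hcarrier S"
    "\<And>x y. x \<in> hcarrier S \<Longrightarrow> y \<in> hcarrier S \<Longrightarrow> hinner H (q x) (q y) = hinner S x y"
    "\<And>x y. x \<in> hcarrier S \<Longrightarrow> y \<in> hcarrier S \<Longrightarrow> hadd H (q x) (q y) = q (hadd S x y)"
    "\<And>c x. x \<in> hcarrier S \<Longrightarrow> hscale H c (q x) = q (hscale S c x)"
proof -
  interpret S: semi_hilbert S by fact
  \<comment> \<open>The choice depends only on the functional given by \<open>x\<close>, so vectors
    with the same inner products receive the same representative. Points of the quotient are the
    images of representatives under \<open>f\<close>.\<close>
  define rep where "rep x = (SOME y. y \<in> hcarrier S \<and> (\<forall>z\<in>hcarrier S. hinner S y z = hinner S x z))" for x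
  define q where "q x = f (rep x)" for x
  define r where "r u = inv f u" for u
  have rep: "rep x \<in> hcarrier S" "\<And>z. z \<in> hcarrier S \<Longrightarrow> hinner S (rep x) z = hinner S x z"
    if "x \<in> hcarrier S" for x
    using someI[of "\<lambda>y. y \<in> hcarrier S \<and> (\<forall>z\<in>hcarrier S. hinner S y z = hinner S x z)" x] that
    by (auto simp: rep_def)
  have rep': "hinner S z (rep x) = hinner S z x" if "x \<in> hcarrier S" "z \<in> hcarrier S" for x z
    using S.ip_commute[of z "rep x"] S.ip_commute[of z x] rep that by metis
  have rq: "r (q x) = rep x" for x using f by (simp add: r_def q_def)
  have qeq: "q x = q y" if "\<And>z. z \<in> hcarrier S \<Longrightarrow> hinner S x z = hinner S y z" for x y
  proof -
    have "rep x = rep y" unfolding rep_def using that by (intro arg_cong[where f=Eps]) auto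
    then show ?thesis by (simp add: q_def)
  qed
  define H where "H = \<lparr>hcarrier = q ` hcarrier S, hzero = q (hzero S),
    hadd = \<lambda>u v. q (hadd S (r u) (r v)), hscale = \<lambda>c u. q (hscale S c (r u)),
    hinner = \<lambda>u v. hinner S (r u) (r v)\<rparr>"
  have car: "hcarrier H = q ` hcarrier S" and zero: "hzero H = q (hzero S)" by (simp_all add: H_def)
  have inner: "hinner H (q x) (q y) = hinner S x y" if "x \<in> hcarrier S" "y \<in> hcarrier S" for x y
    using that by (simp add: H_def rq rep rep')
  have add: "hadd H (q x) (q y) = q (hadd S x y)" if "x \<in> hcarrier S" "y \<in> hcarrier S" for x y
    using that by (simp add: H_def rq) (rule qeq, simp add: rep)
  have scale: "hscale H c (q x) = q (hscale S c x)" if "x \<in> hcarrier S" for c x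
    using that by (simp add: H_def rq) (rule qeq, simp add: rep)
  interpret H: semi_hilbert H
    by standard (auto simp: car zero inner add scale S.ip_nonneg intro: S.ip_commute)
  have nrm: "hnorm H (q x) = hnorm S x" if "x \<in> hcarrier S" for x using that by (simp add: hnorm_def inner)
  have definite: "x = y" if "x \<in> hcarrier H" "y \<in> hcarrier H" "hnorm H (H.hsub x y) = 0" for x y
  proof -
    from that obtain X Y where X: "x = q X" "X \<in> hcarrier S" and Y: "y = q Y" "Y \<in> hcarrier S" by (auto simp: car)
    then have n: "hnorm S (S.hsub X Y) = 0" using that(3) by (simp add: add scale nrm)
    have "hinner S X z = hinner S Y z" if "z \<in> hcarrier S" for z
      using S.Cauchy_Schwarz[of "S.hsub X Y" z] n X Y that by simp
    then show ?thesis unfolding X Y by (rule qeq)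
  qed
  have mc: "Metric_space.mcomplete (hcarrier H) (hdist H) \<longleftrightarrow> (\<forall>X. H.hCauchy X \<longrightarrow> (\<exists>x. H.hlim X x))"
    by (rule H.mcomplete_hdist) (rule definite)
  have "hilbert_space H"
  proof
    show "Metric_space.mcomplete (hcarrier H) (hdist H)"
      unfolding mc
    proof (intro allI impI)
      fix X assume X: "H.hCauchy X"
      then have "\<forall>n. \<exists>Y. Y \<in> hcarrier S \<and> X n = q Y" by (auto simp: H.hCauchy_def car)
      then obtain Y where Y: "\<And>n. Y n \<in> hcarrier S" "\<And>n. X n = q (Y n)" by metis
      have sub: "H.hsub (q x) (q y) = q (S.hsub x y)" if "x \<in> hcarrier S" "y \<in> hcarrier S" for x y
        using that by (simp add: add scale)
      have "S.hCauchy Y" using X Y unfolding H.hCauchy_def S.hCauchy_def by (simp add: sub nrm)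
      then obtain y where "S.hlim Y y" using complete by blast
      then have "H.hlim X (q y)" using Y unfolding H.hlim_def S.hlim_def by (simp add: sub nrm car)
      then show "\<exists>x. H.hlim X x" by blast
    qed
    show "x = hzero H" if "x \<in> hcarrier H" "hinner H x x = 0" for x
      by (rule definite) (use that H.hnorm_add_sq[of x "hscale H (-1) (hzero H)"] H.hnorm_sq[of x] in auto)
    show "\<exists>y\<in>hcarrier H. hadd H x y = hzero H" if "x \<in> hcarrier H" for x
    proof (intro bexI)
      from that obtain X where X: "x = q X" "X \<in> hcarrier S" by (auto simp: car)
      then show "hadd H x (hscale H (-1) x) = hzero H" by (simp add: zero add scale) (rule qeq, simp)
    qed (use that in simp)
  qed (auto simp: car zero add scale inner S.ip_nonneg algebra_simps intro!: qeq S.ip_commute)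
  then show ?thesis using car inner add scale by (rule that)
qed

context semi_hilbert
begin

text \<open>Points of the completion are represented by sequences; this is why
  \<open>hilbert_universe\<close> embeds sequences rather than elements. Null sequences are divided
  out later by \<open>semi_hilbert_quotient\<close>.\<close>

definition cauchy_space :: "(nat \<Rightarrow> 'h) hilbert" where
  "cauchy_space = \<lparr>hcarrier = Collect hCauchy, hzero = \<lambda>_. hzero H, hadd = \<lambda>X Y n. hadd H (X n) (Y n),
     hscale = \<lambda>c X n. hscale H c (X n), hinner = \<lambda>X Y. lim (\<lambda>n. hinner H (X n) (Y n))\<rparr>"

lemma hCauchy_const: "x \<in> hcarrier H \<Longrightarrow> hCauchy (\<lambda>_. x)"
proof -
  assume x: "x \<in> hcarrier H"
  have "hnorm H (hsub x x) = hnorm H (hzero H)" by (rule hnorm_cong) (use x in auto)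
  then show ?thesis using x by (simp add: hCauchy_def)
qed

lemma cauchy_space_inner_lim:
  "hCauchy X \<Longrightarrow> hCauchy Y \<Longrightarrow> (\<lambda>n. hinner H (X n) (Y n)) \<longlonglongrightarrow> hinner cauchy_space X Y"
  using hCauchy_inner_convergent by (simp add: cauchy_space_def convergent_LIMSEQ_iff)

lemma hCauchy_mem: "hCauchy X \<Longrightarrow> X n \<in> hcarrier H"
  by (simp add: hCauchy_def)

lemma semi_hilbert_cauchy_space: "semi_hilbert cauchy_space"
proof
  have car: "X \<in> hcarrier cauchy_space \<longleftrightarrow> hCauchy X" for X by (simp add: cauchy_space_def)
  show "hzero cauchy_space \<in> hcarrier cauchy_space" by (simp add: cauchy_space_def hCauchy_const)
  fix X assume X: "X \<in> hcarrier cauchy_space"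
  show "hscale cauchy_space c X \<in> hcarrier cauchy_space" for c
    using X by (simp add: cauchy_space_def hCauchy_scale)
  show "hinner cauchy_space (hzero cauchy_space) X = 0"
    using X by (simp add: cauchy_space_def hCauchy_mem)
  have "0 \<le> Re (hinner H (X n) (X n))" for n using X by (intro ip_nonneg) (simp add: car hCauchy_mem)
  then show "0 \<le> Re (hinner cauchy_space X X)"
    using X by (intro LIMSEQ_le_const[OF tendsto_Re[OF cauchy_space_inner_lim]]) (auto simp: car)
  fix Y assume Y: "Y \<in> hcarrier cauchy_space"
  show "hadd cauchy_space X Y \<in> hcarrier cauchy_space"
    using X Y by (simp add: cauchy_space_def hCauchy_add)
  have "(\<lambda>n. hinner H (X n) (Y n)) \<longlonglongrightarrow> cnj (hinner cauchy_space Y X)"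
    using tendsto_cnj[OF cauchy_space_inner_lim[of Y X]] X Y ip_commute[of "X _" "Y _", symmetric]
    by (simp add: car hCauchy_mem)
  then show "hinner cauchy_space X Y = cnj (hinner cauchy_space Y X)"
    using cauchy_space_inner_lim[of X Y] X Y by (auto simp: car intro: LIMSEQ_unique)
  show "hinner cauchy_space (hscale cauchy_space a X) Y = a * hinner cauchy_space X Y" for a
  proof -
    have "(\<lambda>n. hinner H (hscale H a (X n)) (Y n)) \<longlonglongrightarrow> a * hinner cauchy_space X Y"
      using tendsto_mult_left[OF cauchy_space_inner_lim[of X Y], of a] X Y by (simp add: car hCauchy_mem)
    moreover have "(\<lambda>n. hinner H (hscale H a (X n)) (Y n)) \<longlonglongrightarrow> hinner cauchy_space (hscale cauchy_space a X) Y"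
      using cauchy_space_inner_lim[OF hCauchy_scale, of X Y a] X Y by (simp add: car) (simp add: cauchy_space_def)
    ultimately show ?thesis by (rule LIMSEQ_unique[symmetric])
  qed
  fix Z assume Z: "Z \<in> hcarrier cauchy_space"
  show "hinner cauchy_space (hadd cauchy_space X Y) Z = hinner cauchy_space X Z + hinner cauchy_space Y Z"
  proof -
    have "(\<lambda>n. hinner H (hadd H (X n) (Y n)) (Z n)) \<longlonglongrightarrow> hinner cauchy_space X Z + hinner cauchy_space Y Z"
      using tendsto_add[OF cauchy_space_inner_lim[of X Z] cauchy_space_inner_lim[of Y Z]] X Y Z
      by (simp add: car hCauchy_mem)
    moreover have "(\<lambda>n. hinner H (hadd H (X n) (Y n)) (Z n)) \<longlonglongrightarrow> hinner cauchy_space (hadd cauchy_space X Y) Z"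
      using cauchy_space_inner_lim[OF hCauchy_add, of X Y Z] X Y Z by (simp add: car) (simp add: cauchy_space_def)
    ultimately show ?thesis by (rule LIMSEQ_unique[symmetric])
  qed
qed

lemma cauchy_space_norm_lim:
  assumes "hCauchy X" shows "(\<lambda>n. hnorm H (X n)) \<longlonglongrightarrow> hnorm cauchy_space X"
  unfolding hnorm_def by (intro tendsto_real_sqrt tendsto_Re cauchy_space_inner_lim assms)

lemma cauchy_space_approx:
  assumes X: "hCauchy X" and e: "0 < e"
  obtains N where "\<And>n. n \<ge> N \<Longrightarrow> hnorm cauchy_space (semi_hilbert.hsub cauchy_space X (\<lambda>_. X n)) \<le> e"
proof -
  interpret S: semi_hilbert cauchy_space by (rule semi_hilbert_cauchy_space)
  obtain N where N: "\<And>m n. m \<ge> N \<Longrightarrow> n \<ge> N \<Longrightarrow> hnorm H (hsub (X m) (X n)) < e"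
    using X e unfolding hCauchy_def by metis
  have "hnorm cauchy_space (S.hsub X (\<lambda>_. X n)) \<le> e" if n: "n \<ge> N" for n
  proof (rule LIMSEQ_le_const2)
    have "hCauchy (\<lambda>m. hsub (X m) (X n))"
      by (intro hCauchy_add[OF X] hCauchy_scale hCauchy_const hCauchy_mem[OF X])
    then show "(\<lambda>m. hnorm H (hsub (X m) (X n))) \<longlonglongrightarrow> hnorm cauchy_space (S.hsub X (\<lambda>_. X n))"
      using cauchy_space_norm_lim by (simp add: cauchy_space_def)
    show "\<exists>M. \<forall>m\<ge>M. hnorm H (hsub (X m) (X n)) \<le> e" using N n by (meson less_imp_le)
  qed
  then show ?thesis by (rule that)
qed

text \<open>A diagonal argument: each \<open>X k\<close> is replaced by a constant sequence at
  distance at most \<open>1 / Suc k\<close>. The sequence \<open>a\<close> of these constants is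
  itself Cauchy, and as a point of the space it is the limit.\<close>

lemma cauchy_space_complete:
  assumes "semi_hilbert.hCauchy cauchy_space X"
  shows "\<exists>x. semi_hilbert.hlim cauchy_space X x"
proof -
  interpret S: semi_hilbert cauchy_space by (rule semi_hilbert_cauchy_space)
  have XC: "hCauchy (X k)" for k using S.hCauchy_mem[OF assms] by (simp add: cauchy_space_def)
  have car: "Y \<in> hcarrier cauchy_space \<longleftrightarrow> hCauchy Y" for Y by (simp add: cauchy_space_def)
  have "\<exists>a\<in>hcarrier H. hnorm cauchy_space (S.hsub (X k) (\<lambda>_. a)) \<le> 1 / real (Suc k)" for k
  proof -
    obtain N where "\<And>n. n \<ge> N \<Longrightarrow> hnorm cauchy_space (S.hsub (X k) (\<lambda>_. X k n)) \<le> 1 / real (Suc k)"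
      using cauchy_space_approx[OF XC, of "1 / real (Suc k)"] by auto
    then show ?thesis using hCauchy_mem[OF XC] by blast
  qed
  then obtain a where a: "\<And>k. a k \<in> hcarrier H"
    "\<And>k. hnorm cauchy_space (S.hsub (X k) (\<lambda>_. a k)) \<le> 1 / real (Suc k)" by metis
  have cm: "(\<lambda>_. a k) \<in> hcarrier cauchy_space" for k by (simp add: car hCauchy_const a)
  have Xm: "X k \<in> hcarrier cauchy_space" for k by (simp add: car XC)
  have const: "hnorm cauchy_space (S.hsub (\<lambda>_. x) (\<lambda>_. y)) = hnorm H (hsub x y)"
    if "x \<in> hcarrier H" "y \<in> hcarrier H" for x y
    by (rule LIMSEQ_unique[OF _ tendsto_const])
       (use cauchy_space_norm_lim[OF hCauchy_const[of "hsub x y"]] that in \<open>simp add: cauchy_space_def\<close>)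
  have aC: "hCauchy a"
    unfolding hCauchy_def
  proof (intro conjI allI impI a)
    fix e :: real assume e: "e > 0"
    then obtain N where N: "\<And>m n. m \<ge> N \<Longrightarrow> n \<ge> N \<Longrightarrow> hnorm cauchy_space (S.hsub (X m) (X n)) < e / 3"
      using assms unfolding S.hCauchy_def by (metis zero_less_divide_iff zero_less_numeral)
    obtain M where M: "1 / real (Suc M) < e / 3" using e nat_approx_posE by (metis divide_pos_pos zero_less_numeral)
    have "hnorm H (hsub (a m) (a n)) < e" if mn: "m \<ge> max N M" "n \<ge> max N M" for m n
    proof -
      have b: "hnorm cauchy_space (S.hsub (X k) (\<lambda>_. a k)) < e / 3" if "k \<ge> max N M" for k
      proof -
        have "1 / real (Suc k) \<le> 1 / real (Suc M)" using that by (intro divide_left_mono) auto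
        then show ?thesis using a(2)[of k] M by linarith
      qed
      have "hnorm H (hsub (a m) (a n)) \<le> hnorm cauchy_space (S.hsub (\<lambda>_. a m) (X m)) + hnorm cauchy_space (S.hsub (X m) (\<lambda>_. a n))"
        unfolding const[OF a(1) a(1), symmetric] by (rule S.hnorm_sub_triangle[OF cm Xm cm])
      also have "hnorm cauchy_space (S.hsub (X m) (\<lambda>_. a n)) \<le> hnorm cauchy_space (S.hsub (X m) (X n)) + hnorm cauchy_space (S.hsub (X n) (\<lambda>_. a n))"
        by (rule S.hnorm_sub_triangle[OF Xm Xm cm])
      also have "hnorm cauchy_space (S.hsub (\<lambda>_. a m) (X m)) = hnorm cauchy_space (S.hsub (X m) (\<lambda>_. a m))"
        by (rule S.hnorm_sub_commute[OF cm Xm])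
      finally show ?thesis using b[OF mn(1)] b[OF mn(2)] N[of m n] mn by simp
    qed
    then show "\<exists>N. \<forall>m\<ge>N. \<forall>n\<ge>N. hnorm H (hsub (a m) (a n)) < e" by blast
  qed
  have am: "a \<in> hcarrier cauchy_space" by (simp add: car aC)
  have "S.hlim X a"
    unfolding S.hlim_def
  proof (intro conjI allI Xm am)
    show "(\<lambda>n. hnorm cauchy_space (S.hsub (X n) a)) \<longlonglongrightarrow> 0"
    proof (rule LIMSEQ_I)
      fix e :: real assume e: "e > 0"
      obtain N where N: "\<And>n. n \<ge> N \<Longrightarrow> hnorm cauchy_space (S.hsub a (\<lambda>_. a n)) \<le> e / 3"
        using cauchy_space_approx[OF aC, of "e / 3"] e by auto
      obtain M where M: "1 / real (Suc M) < e / 3" using e nat_approx_posE by (metis divide_pos_pos zero_less_numeral)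
      have "norm (hnorm cauchy_space (S.hsub (X n) a) - 0) < e" if n: "n \<ge> max N M" for n
      proof -
        have "1 / real (Suc n) \<le> 1 / real (Suc M)" using n by (intro divide_left_mono) auto
        then have "hnorm cauchy_space (S.hsub (X n) (\<lambda>_. a n)) < e / 3" using a(2)[of n] M by linarith
        moreover have "hnorm cauchy_space (S.hsub (\<lambda>_. a n) a) \<le> e / 3"
          using N[of n] n S.hnorm_sub_commute[OF am cm] by simp
        ultimately show ?thesis using S.hnorm_sub_triangle[OF Xm cm am, of n n] e
            S.hnorm_nonneg[of "S.hsub (X n) a"] Xm am by simp
      qed
      then show "\<exists>N. \<forall>n\<ge>N. norm (hnorm cauchy_space (S.hsub (X n) a) - 0) < e" by blast
    qed
  qed
  then show ?thesis by blast
qed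

theorem completion:
  fixes f :: "(nat \<Rightarrow> 'h) \<Rightarrow> 'k"
  assumes f: "inj f"
  obtains K :: "'k hilbert" and j where "hilbert_space K"
    "\<And>x. x \<in> hcarrier H \<Longrightarrow> j x \<in> hcarrier K"
    "\<And>x y. x \<in> hcarrier H \<Longrightarrow> y \<in> hcarrier H \<Longrightarrow> hinner K (j x) (j y) = hinner H x y"
    "\<And>x y. x \<in> hcarrier H \<Longrightarrow> y \<in> hcarrier H \<Longrightarrow> hadd K (j x) (j y) = j (hadd H x y)"
    "\<And>c x. x \<in> hcarrier H \<Longrightarrow> hscale K c (j x) = j (hscale H c x)"
    "\<And>z e. z \<in> hcarrier K \<Longrightarrow> 0 < e \<Longrightarrow> \<exists>x\<in>hcarrier H. hnorm K (hadd K z (hscale K (-1) (j x))) < e"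
proof -
  interpret S: semi_hilbert cauchy_space by (rule semi_hilbert_cauchy_space)
  obtain K :: "'k hilbert" and q where K: "hilbert_space K" "hcarrier K = q ` hcarrier cauchy_space"
    "\<And>x y. x \<in> hcarrier cauchy_space \<Longrightarrow> y \<in> hcarrier cauchy_space \<Longrightarrow> hinner K (q x) (q y) = hinner cauchy_space x y"
    "\<And>x y. x \<in> hcarrier cauchy_space \<Longrightarrow> y \<in> hcarrier cauchy_space \<Longrightarrow> hadd K (q x) (q y) = q (hadd cauchy_space x y)"
    "\<And>c x. x \<in> hcarrier cauchy_space \<Longrightarrow> hscale K c (q x) = q (hscale cauchy_space c x)"
    using semi_hilbert_quotient[OF semi_hilbert_cauchy_space f cauchy_space_complete] by metis
  define j where "j x = q (\<lambda>_. x)" for x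
  have c: "(\<lambda>_. x) \<in> hcarrier cauchy_space" if "x \<in> hcarrier H" for x
    using that by (simp add: cauchy_space_def hCauchy_const)
  show ?thesis
  proof (rule that[of K j])
    show "hilbert_space K" by fact
    fix x y assume x: "x \<in> hcarrier H"
    show "j x \<in> hcarrier K" using c[OF x] by (simp add: j_def K)
    show "hscale K a (j x) = j (hscale H a x)" for a
      using c[OF x] by (simp add: j_def K) (simp add: cauchy_space_def)
    assume y: "y \<in> hcarrier H"
    show "hinner K (j x) (j y) = hinner H x y"
      using c[OF x] c[OF y] by (simp add: j_def K) (simp add: cauchy_space_def)
    show "hadd K (j x) (j y) = j (hadd H x y)"
      using c[OF x] c[OF y] by (simp add: j_def K) (simp add: cauchy_space_def)
  next
    fix z and e :: real assume z: "z \<in> hcarrier K" "0 < e"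
    then obtain X where X: "z = q X" "X \<in> hcarrier cauchy_space" by (auto simp: K)
    then have XC: "hCauchy X" by (simp add: cauchy_space_def)
    obtain N where N: "\<And>n. n \<ge> N \<Longrightarrow> hnorm cauchy_space (S.hsub X (\<lambda>_. X n)) \<le> e / 2"
      using cauchy_space_approx[OF XC, of "e / 2"] z by auto
    have "hnorm K (hadd K z (hscale K (-1) (j (X N)))) = hnorm cauchy_space (S.hsub X (\<lambda>_. X N))"
      using X c[OF hCauchy_mem[OF XC]] by (simp add: j_def K hnorm_def)
    also have "\<dots> < e" using N[of N] z by simp
    finally show "\<exists>x\<in>hcarrier H. hnorm K (hadd K z (hscale K (-1) (j x))) < e"
      using hCauchy_mem[OF XC] by blast
  qed
qed

end

section \<open>Operators on Hilbert spaces\<close>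

context semi_hilbert
begin

lemma hlim_inner:
  assumes "hlim X x" "y \<in> hcarrier H"
  shows "(\<lambda>n. hinner H (X n) y) \<longlonglongrightarrow> hinner H x y"
proof (rule LIM_zero_cancel, rule Lim_null_comparison)
  have c: "X n \<in> hcarrier H" "x \<in> hcarrier H" for n using assms by (auto simp: hlim_def)
  show "\<forall>\<^sub>F n in sequentially. norm (hinner H (X n) y - hinner H x y) \<le> hnorm H (hsub (X n) x) * hnorm H y"
    using Cauchy_Schwarz[of "hsub (X _) x" y] c assms(2) by (intro always_eventually) simp
  show "(\<lambda>n. hnorm H (hsub (X n) x) * hnorm H y) \<longlonglongrightarrow> 0"
    using assms(1) by (intro tendsto_mult_left_zero) (simp add: hlim_def)
qed

lemma hlim_inner_right:
  assumes "hlim X x" "y \<in> hcarrier H"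
  shows "(\<lambda>n. hinner H y (X n)) \<longlonglongrightarrow> hinner H y x"
proof -
  have c: "X n \<in> hcarrier H" "x \<in> hcarrier H" for n using assms by (auto simp: hlim_def)
  show ?thesis
    using tendsto_cnj[OF hlim_inner[OF assms]] ip_commute[OF assms(2) c(1)] ip_commute[OF assms(2) c(2)] by simp
qed

lemma hlim_norm:
  assumes "hlim X x" shows "(\<lambda>n. hnorm H (X n)) \<longlonglongrightarrow> hnorm H x"
proof (rule LIM_zero_cancel, rule Lim_null_comparison)
  show "\<forall>\<^sub>F n in sequentially. norm (hnorm H (X n) - hnorm H x) \<le> hnorm H (hsub (X n) x)"
    using assms hnorm_diff_le by (intro always_eventually) (simp add: hlim_def)
  show "(\<lambda>n. hnorm H (hsub (X n) x)) \<longlonglongrightarrow> 0" using assms by (simp add: hlim_def)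
qed

lemma bounded_opsD:
  assumes "T \<in> bounded_ops H"
  shows "x \<in> hcarrier H \<Longrightarrow> T x \<in> hcarrier H"
    "x \<in> hcarrier H \<Longrightarrow> y \<in> hcarrier H \<Longrightarrow> T (hadd H x y) = hadd H (T x) (T y)"
    "x \<in> hcarrier H \<Longrightarrow> T (hscale H c x) = hscale H c (T x)"
    "x \<notin> hcarrier H \<Longrightarrow> T x = undefined"
  using assms by (auto simp: bounded_ops_def)

lemma bounded_ops_bound:
  assumes "T \<in> bounded_ops H"
  obtains K where "0 \<le> K" "\<And>x. x \<in> hcarrier H \<Longrightarrow> hnorm H (T x) \<le> K * hnorm H x"
proof -
  obtain K where K: "\<And>x. x \<in> hcarrier H \<Longrightarrow> hnorm H (T x) \<le> K * hnorm H x"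
    using assms unfolding bounded_ops_def by blast
  show ?thesis
  proof (rule that[of "max 0 K"])
    fix x assume x: "x \<in> hcarrier H"
    have "K * hnorm H x \<le> max 0 K * hnorm H x" using x by (intro mult_right_mono) auto
    then show "hnorm H (T x) \<le> max 0 K * hnorm H x" using K[OF x] by linarith
  qed simp
qed

lemma bounded_ops_ext:
  assumes "T \<in> bounded_ops H" "S \<in> bounded_ops H" "\<And>x. x \<in> hcarrier H \<Longrightarrow> T x = S x"
  shows "T = S"
  by (rule ext) (metis assms bounded_opsD(4))

lemma hlim_op:
  assumes T: "T \<in> bounded_ops H" and X: "hlim X x"
  shows "hlim (\<lambda>n. T (X n)) (T x)"
proof -
  have c: "X n \<in> hcarrier H" "x \<in> hcarrier H" for n using X by (auto simp: hlim_def)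
  obtain K where K: "0 \<le> K" "\<And>x. x \<in> hcarrier H \<Longrightarrow> hnorm H (T x) \<le> K * hnorm H x"
    using bounded_ops_bound[OF T] by blast
  have "(\<lambda>n. hnorm H (hsub (T (X n)) (T x))) \<longlonglongrightarrow> 0"
  proof (rule Lim_null_comparison)
    have "hsub (T (X n)) (T x) = T (hsub (X n) x)" for n using c by (simp add: bounded_opsD[OF T])
    then show "\<forall>\<^sub>F n in sequentially. norm (hnorm H (hsub (T (X n)) (T x))) \<le> K * hnorm H (hsub (X n) x)"
      using c K(2)[of "hsub (X _) x"] by (intro always_eventually) (simp add: bounded_opsD(1)[OF T])
    show "(\<lambda>n. K * hnorm H (hsub (X n) x)) \<longlonglongrightarrow> 0"
      using X by (intro tendsto_mult_right_zero) (simp add: hlim_def)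
  qed
  then show ?thesis using c by (simp add: hlim_def bounded_opsD[OF T])
qed

lemma hlim_of_approx:
  assumes x: "x \<in> hcarrier H" and M: "M \<subseteq> hcarrier H"
    and a: "\<And>e. 0 < e \<Longrightarrow> \<exists>y\<in>M. hnorm H (hsub x y) < e"
  obtains X where "hlim X x" "\<And>n. X n \<in> M" "\<And>n. hnorm H (hsub x (X n)) < 1 / real (Suc n)"
proof -
  have "\<forall>n. \<exists>y\<in>M. hnorm H (hsub x y) < 1 / real (Suc n)" using a by auto
  then obtain X where X: "\<And>n. X n \<in> M" "\<And>n. hnorm H (hsub x (X n)) < 1 / real (Suc n)" by metis
  have "(\<lambda>n. hnorm H (hsub (X n) x)) \<longlonglongrightarrow> 0"
  proof (rule Lim_null_comparison)
    have "norm (hnorm H (hsub (X n) x)) \<le> 1 / real (Suc n)" for n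
      using X(2)[of n] X(1)[of n] M x hnorm_sub_commute[of x "X n"] by auto
    then show "\<forall>\<^sub>F n in sequentially. norm (hnorm H (hsub (X n) x)) \<le> 1 / real (Suc n)" by simp
    show "(\<lambda>n. 1 / real (Suc n)) \<longlonglongrightarrow> 0" using LIMSEQ_inverse_real_of_nat by (simp add: inverse_eq_divide)
  qed
  then have "hlim X x" using X M x by (auto simp: hlim_def)
  then show ?thesis using X by (rule that)
qed

lemma hlim_hCauchy:
  assumes "hlim X x" shows "hCauchy X"
  unfolding hCauchy_def
proof (intro conjI allI impI)
  have c: "X n \<in> hcarrier H" "x \<in> hcarrier H" for n using assms by (auto simp: hlim_def)
  show "X n \<in> hcarrier H" for n by (rule c)
  fix e :: real assume "e > 0"
  then have "\<forall>\<^sub>F n in sequentially. hnorm H (hsub (X n) x) < e / 2"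
    using assms by (intro order_tendstoD) (auto simp: hlim_def)
  then obtain N where N: "\<And>n. n \<ge> N \<Longrightarrow> hnorm H (hsub (X n) x) < e / 2" by (auto simp: eventually_sequentially)
  have "hnorm H (hsub (X m) (X n)) < e" if "m \<ge> N" "n \<ge> N" for m n
    using hnorm_sub_triangle[OF c(1) c(2) c(1), of m n] hnorm_sub_commute[OF c(2) c(1), of n] N[OF that(1)] N[OF that(2)]
    by linarith
  then show "\<exists>N. \<forall>m\<ge>N. \<forall>n\<ge>N. hnorm H (hsub (X m) (X n)) < e" by blast
qed

end

context hilbert_space
begin

section \<open>Closed subspaces and orthogonal projections\<close>

definition closed_subspace :: "'h set \<Rightarrow> bool" where
  "closed_subspace M \<longleftrightarrow> hsubspace H M \<and> (\<forall>X x. hlim X x \<longrightarrow> (\<forall>n. X n \<in> M) \<longrightarrow> x \<in> M)"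

text \<open>A minimizing sequence is Cauchy by the parallelogram law \<open>par\<close>, since
  midpoints stay in \<open>M\<close>; its limit is the closest point.\<close>

lemma projection:
  assumes M: "closed_subspace M" and x: "x \<in> hcarrier H"
  obtains p where "p \<in> M" "\<And>y. y \<in> M \<Longrightarrow> hinner H (hsub x p) y = 0"
proof -
  have Ms: "M \<subseteq> hcarrier H" "hzero H \<in> M" "\<And>x y. x \<in> M \<Longrightarrow> y \<in> M \<Longrightarrow> hadd H x y \<in> M"
    "\<And>c x. x \<in> M \<Longrightarrow> hscale H c x \<in> M" using M by (auto simp: closed_subspace_def hsubspace_def)
  have mc: "y \<in> hcarrier H" if "y \<in> M" for y using that Ms by auto
  define D where "D y = (hnorm H (hsub x y))\<^sup>2" for y
  define d where "d = (INF y\<in>M. D y)"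
  have bdd: "bdd_below (D ` M)" by (rule bdd_belowI[of _ 0]) (auto simp: D_def)
  have dle: "d \<le> D y" if "y \<in> M" for y unfolding d_def by (rule cINF_lower[OF bdd that])
  have "\<exists>y\<in>M. D y < d + 1 / real (Suc n)" for n
  proof (rule ccontr)
    assume "\<not> (\<exists>y\<in>M. D y < d + 1 / real (Suc n))"
    then have "d + 1 / real (Suc n) \<le> d" unfolding d_def using Ms(2) by (intro cINF_greatest) (auto simp: not_less)
    then show False by (simp add: field_simps)
  qed
  then obtain Y where Y: "\<And>n. Y n \<in> M" "\<And>n. D (Y n) < d + 1 / real (Suc n)" by metis
  have par: "(hnorm H (hsub y z))\<^sup>2 = 2 * D y + 2 * D z - 4 * D (hscale H (1/2) (hadd H y z))" if "y \<in> M" "z \<in> M" for y z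
    using mc[OF that(1)] mc[OF that(2)] x ip_commute[of x y] ip_commute[of x z] ip_commute[of y z]
    by (simp add: D_def hnorm_sq algebra_simps)
  have Yd: "(hnorm H (hsub (Y m) (Y n)))\<^sup>2 \<le> 2 / real (Suc m) + 2 / real (Suc n)" for m n
  proof -
    have "hscale H (1/2) (hadd H (Y m) (Y n)) \<in> M" using Y Ms by auto
    from dle[OF this] show ?thesis using par[OF Y(1) Y(1), of m n] Y(2)[of m] Y(2)[of n] by simp
  qed
  have "hCauchy Y"
    unfolding hCauchy_def
  proof (intro conjI allI impI)
    show "Y n \<in> hcarrier H" for n using mc Y by auto
    fix e :: real assume e: "e > 0"
    then obtain N where N: "1 / real (Suc N) < e\<^sup>2 / 4" using nat_approx_posE[of "e\<^sup>2 / 4"] by auto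
    have "hnorm H (hsub (Y m) (Y n)) < e" if "m \<ge> N" "n \<ge> N" for m n
    proof (rule power2_less_imp_less)
      have "1 / real (Suc m) \<le> 1 / real (Suc N)" "1 / real (Suc n) \<le> 1 / real (Suc N)"
        using that by (auto intro!: divide_left_mono)
      then show "(hnorm H (hsub (Y m) (Y n)))\<^sup>2 < e\<^sup>2" using Yd[of m n] N by simp
    qed (use e in simp)
    then show "\<exists>N. \<forall>m\<ge>N. \<forall>n\<ge>N. hnorm H (hsub (Y m) (Y n)) < e" by blast
  qed
  then obtain p where p: "hlim Y p" using hCauchy_hlim by blast
  then have pM: "p \<in> M" using M Y by (auto simp: closed_subspace_def)
  have pc: "p \<in> hcarrier H" by (rule mc[OF pM])
  have "hlim (\<lambda>n. hsub x (Y n)) (hsub x p)"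
  proof -
    have "hnorm H (hsub (hsub x (Y n)) (hsub x p)) = hnorm H (hsub p (Y n))" for n
      by (rule hnorm_cong) (use x mc[OF Y(1)] pc in auto)
    then have "hnorm H (hsub (hsub x (Y n)) (hsub x p)) = hnorm H (hsub (Y n) p)" for n
      using hnorm_sub_commute[OF pc mc[OF Y(1)]] by simp
    then show ?thesis using p x mc[OF Y(1)] pc by (simp add: hlim_def)
  qed
  from tendsto_power[OF hlim_norm[OF this], of 2] have "(\<lambda>n. D (Y n)) \<longlonglongrightarrow> D p" by (simp add: D_def)
  moreover have "(\<lambda>n. d + 1 / real (Suc n)) \<longlonglongrightarrow> d + 0"
    using LIMSEQ_inverse_real_of_nat by (intro tendsto_intros) (simp add: inverse_eq_divide)
  ultimately have Dp: "D p \<le> d" using Y(2) by (intro LIMSEQ_le[of "\<lambda>n. D (Y n)" _ "\<lambda>n. d + 1 / real (Suc n)"]) (auto intro: less_imp_le)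
  have "hinner H (hsub x p) y = 0" if y: "y \<in> M" for y
  proof -
    \<comment> \<open>Minimality of the distance along the line \<open>p + t y\<close> is a
      quadratic inequality with constant term 0, so its linear coefficient vanishes.\<close>
    have "(cmod (- hinner H (hsub x p) y))\<^sup>2 \<le> 0 * (hnorm H y)\<^sup>2"
    proof (rule discriminant_complex)
      fix t
      have "hadd H p (hscale H t y) \<in> M" using pM y Ms by auto
      from dle[OF this] have "D p \<le> D (hadd H p (hscale H t y))" using Dp by linarith
      also have "D (hadd H p (hscale H t y)) = (hnorm H (hadd H (hsub x p) (hscale H (- t) y)))\<^sup>2"
        unfolding D_def by (rule arg_cong[where f="\<lambda>t. t\<^sup>2"], rule hnorm_cong) (use x pc mc[OF y] in \<open>auto simp: algebra_simps\<close>)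
      also have "\<dots> = D p + 2 * Re (cnj t * (- hinner H (hsub x p) y)) + (cmod t)\<^sup>2 * (hnorm H y)\<^sup>2"
        using x pc mc[OF y] by (simp add: hnorm_add_sq power_mult_distrib D_def algebra_simps)
      finally show "0 \<le> 0 + 2 * Re (cnj t * (- hinner H (hsub x p) y)) + (cmod t)\<^sup>2 * (hnorm H y)\<^sup>2" by simp
    qed simp
    then show ?thesis by simp
  qed
  with pM show ?thesis by (rule that)
qed

lemma total_closed_subspace:
  assumes M: "closed_subspace M" and E: "E \<subseteq> M"
    and tot: "\<And>z. z \<in> hcarrier H \<Longrightarrow> (\<And>e. e \<in> E \<Longrightarrow> hinner H z e = 0) \<Longrightarrow> z = hzero H"
  shows "M = hcarrier H"
proof
  show "M \<subseteq> hcarrier H" using M by (auto simp: closed_subspace_def hsubspace_def)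
  show "hcarrier H \<subseteq> M"
  proof
    fix x assume x: "x \<in> hcarrier H"
    obtain p where p: "p \<in> M" "\<And>y. y \<in> M \<Longrightarrow> hinner H (hsub x p) y = 0" using projection[OF M x] by blast
    have pc: "p \<in> hcarrier H" using p \<open>M \<subseteq> hcarrier H\<close> by auto
    have "hsub x p = hzero H" by (rule tot) (use p E x pc in auto)
    then have "hnorm H (hsub x p) = 0" by simp
    then show "x \<in> M" using hnorm_sub_eq_0D[OF x pc] p by simp
  qed
qed

lemma hsubspace_hull: "S \<subseteq> hcarrier H \<Longrightarrow> hsubspace H (hsubspace H hull S)"
  unfolding hull_def hsubspace_def
  by (auto simp: zero_closed add_closed scale_closed subset_iff)

text \<open>Translates the topological form of non-degeneracy into triviality of the orthogonal
  complement, the form in which \<open>Rep\<close> is used from here on.\<close>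

lemma closure_hull_eq_carrier_iff:
  assumes S: "S \<subseteq> hcarrier H"
  shows "htopology H closure_of (hsubspace H hull S) = hcarrier H \<longleftrightarrow>
    (\<forall>z\<in>hcarrier H. (\<forall>e\<in>S. hinner H z e = 0) \<longrightarrow> z = hzero H)" (is "?L \<longleftrightarrow> ?R")
proof -
  interpret M: Metric_space "hcarrier H" "hdist H" by (rule metric_space_hdist) (rule hnorm_sub_eq_0D)
  define L where "L = hsubspace H hull S"
  have L: "hsubspace H L" "S \<subseteq> L" "L \<subseteq> hcarrier H"
    using hsubspace_hull[OF S] by (auto simp: L_def hull_subset hsubspace_def)
  have Lmin: "L \<subseteq> M" if "hsubspace H M" "S \<subseteq> M" for M unfolding L_def using that by (simp add: hull_minimal)
  have cl: "htopology H closure_of L = {x \<in> hcarrier H. \<forall>r>0. \<exists>y\<in>L. hnorm H (hsub x y) < r}"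
    unfolding M.metric_closure_of using L by (auto simp: hdist_eq subset_iff) (metis hdist_eq)+
  show ?thesis unfolding L_def[symmetric]
  proof
    assume d: "htopology H closure_of L = hcarrier H"
    show ?R
    proof (intro ballI impI)
      fix z assume z: "z \<in> hcarrier H" "\<forall>e\<in>S. hinner H z e = 0"
      have LZ: "L \<subseteq> {y \<in> hcarrier H. hinner H z y = 0}"
        by (rule Lmin) (use S z in \<open>auto simp: hsubspace_def\<close>)
      obtain X where X: "hlim X z" "\<And>n. X n \<in> L"
        by (rule hlim_of_approx[OF z(1) L(3)]) (use d cl z in auto)
      have "(\<lambda>n. hinner H z (X n)) \<longlonglongrightarrow> hinner H z z" by (rule hlim_inner_right[OF X(1) z(1)])
      moreover have "hinner H z (X n) = 0" for n using X(2) LZ by auto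
      ultimately have "hinner H z z = 0" by (simp add: LIMSEQ_const_iff)
      then show "z = hzero H" by (rule inner_definite[OF z(1)])
    qed
  next
    assume R: ?R
    define K where "K = htopology H closure_of L"
    have "closed_subspace K"
      unfolding closed_subspace_def hsubspace_def
    proof (intro conjI ballI allI impI)
      show "K \<subseteq> hcarrier H" by (auto simp: K_def cl)
      have LK: "L \<subseteq> K" unfolding K_def using L(3) by (intro closure_of_subset) simp
      then show "hzero H \<in> K" using L(1) by (auto simp: hsubspace_def)
      have seq: "\<exists>X. hlim X x \<and> (\<forall>n. X n \<in> L)" if "x \<in> K" for x
      proof -
        have "x \<in> hcarrier H" "\<And>e. 0 < e \<Longrightarrow> \<exists>y\<in>L. hnorm H (hsub x y) < e" using that by (auto simp: K_def cl)
        from hlim_of_approx[OF this(1) L(3) this(2)] show ?thesis by metis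
      qed
      have ofseq: "x \<in> K" if X: "hlim X x" "\<And>n. X n \<in> L" for X x
      proof -
        have c: "x \<in> hcarrier H" "\<And>n. X n \<in> hcarrier H" using X by (auto simp: hlim_def)
        have "\<exists>y\<in>L. hnorm H (hsub x y) < r" if "r > 0" for r
        proof -
          have "\<forall>\<^sub>F n in sequentially. hnorm H (hsub (X n) x) < r"
            using X(1) that by (intro order_tendstoD) (auto simp: hlim_def)
          then obtain n where "hnorm H (hsub (X n) x) < r" by (auto simp: eventually_sequentially)
          then show ?thesis using X(2) hnorm_sub_commute[OF c(1) c(2)] by (intro bexI[of _ "X n"]) simp_all
        qed
        then show ?thesis using c by (simp add: K_def cl)
      qed
      fix x assume x: "x \<in> K"
      then obtain X where X: "hlim X x" "\<And>n. X n \<in> L" using seq by blast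
      have xc: "x \<in> hcarrier H" "\<And>n. X n \<in> hcarrier H" using X by (auto simp: hlim_def)
      show "hscale H c x \<in> K" for c
      proof (rule ofseq)
        show "hscale H c (X n) \<in> L" for n using X L by (auto simp: hsubspace_def)
        have "hnorm H (hsub (hscale H c (X n)) (hscale H c x)) = hnorm H (hscale H c (hsub (X n) x))" for n
          by (rule hnorm_cong) (use xc in \<open>auto simp: algebra_simps\<close>)
        then show "hlim (\<lambda>n. hscale H c (X n)) (hscale H c x)"
          using X(1) xc tendsto_mult_right_zero[of "\<lambda>n. hnorm H (hsub (X n) x)" sequentially "cmod c"]
          by (simp add: hlim_def)
      qed
      fix y assume y: "y \<in> K"
      then obtain Y where Y: "hlim Y y" "\<And>n. Y n \<in> L" using seq by blast
      have yc: "y \<in> hcarrier H" "\<And>n. Y n \<in> hcarrier H" using Y by (auto simp: hlim_def)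
      show "hadd H x y \<in> K"
      proof (rule ofseq)
        show "hadd H (X n) (Y n) \<in> L" for n using X Y L by (auto simp: hsubspace_def)
        have e: "hnorm H (hsub (hadd H (X n) (Y n)) (hadd H x y)) = hnorm H (hadd H (hsub (X n) x) (hsub (Y n) y))" for n
          by (rule hnorm_cong) (use xc yc in \<open>auto simp: algebra_simps\<close>)
        have "(\<lambda>n. hnorm H (hsub (hadd H (X n) (Y n)) (hadd H x y))) \<longlonglongrightarrow> 0"
        proof (rule Lim_null_comparison)
          show "\<forall>\<^sub>F n in sequentially. norm (hnorm H (hsub (hadd H (X n) (Y n)) (hadd H x y)))
              \<le> hnorm H (hsub (X n) x) + hnorm H (hsub (Y n) y)"
            unfolding e using hnorm_triangle[of "hsub (X _) x" "hsub (Y _) y"] xc yc by (intro always_eventually) simp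
          show "(\<lambda>n. hnorm H (hsub (X n) x) + hnorm H (hsub (Y n) y)) \<longlonglongrightarrow> 0"
            using X(1) Y(1) by (intro tendsto_add_zero) (auto simp: hlim_def)
        qed
        then show "hlim (\<lambda>n. hadd H (X n) (Y n)) (hadd H x y)" using xc yc by (simp add: hlim_def)
      qed
    next
      fix X x assume X: "hlim X x" "\<forall>n. X n \<in> K"
      have c: "x \<in> hcarrier H" "\<And>n. X n \<in> hcarrier H" using X by (auto simp: hlim_def)
      have "\<exists>y\<in>L. hnorm H (hsub x y) < r" if r: "r > 0" for r
      proof -
        have "\<forall>\<^sub>F n in sequentially. hnorm H (hsub (X n) x) < r / 2"
          using X(1) r by (intro order_tendstoD) (auto simp: hlim_def)
        then obtain n where n: "hnorm H (hsub (X n) x) < r / 2" by (auto simp: eventually_sequentially)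
        have "X n \<in> K" "0 < r / 2" using X(2) r by auto
        then obtain y where y: "y \<in> L" "hnorm H (hsub (X n) y) < r / 2"
          unfolding K_def cl by blast
        have "y \<in> hcarrier H" using y L by auto
        then have "hnorm H (hsub x y) < r"
          using hnorm_sub_triangle[OF c(1) c(2), of y n] n y hnorm_sub_commute[OF c(1) c(2), of n] by linarith
        then show ?thesis using y by blast
      qed
      then show "x \<in> K" using c by (simp add: K_def cl)
    qed
    moreover have "S \<subseteq> K"
      using L(2) closure_of_subset[of L "htopology H"] L(3) by (auto simp: K_def)
    ultimately have "K = hcarrier H" by (rule total_closed_subspace) (use R in auto)
    then show "htopology H closure_of L = hcarrier H" unfolding K_def .
  qed
qed

text \<open>Prescribing the coefficients against the total family \<open>e\<close> makes the operator unique, which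
  gives its linearity for free.\<close>

lemma weak_extension:
  assumes e: "\<And>i. e i \<in> hcarrier H" "\<And>i. e' i \<in> hcarrier H"
    and tot: "\<And>z. z \<in> hcarrier H \<Longrightarrow> (\<And>i. hinner H z (e i) = 0) \<Longrightarrow> z = hzero H"
    and V: "hsubspace H V" "\<And>z r. z \<in> hcarrier H \<Longrightarrow> 0 < r \<Longrightarrow> \<exists>y\<in>V. hnorm H (hsub z y) < r"
    and K: "0 \<le> K"
    and ex: "\<And>z. z \<in> V \<Longrightarrow> \<exists>w\<in>hcarrier H. (\<forall>i. hinner H w (e i) = hinner H z (e' i)) \<and> hnorm H w \<le> K * hnorm H z"
  obtains T where "T \<in> bounded_ops H"
    "\<And>z i. z \<in> hcarrier H \<Longrightarrow> hinner H (T z) (e i) = hinner H z (e' i)"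
proof -
  define R where "R z w \<longleftrightarrow> w \<in> hcarrier H \<and> (\<forall>i. hinner H w (e i) = hinner H z (e' i))" for z w
  have Vc: "z \<in> hcarrier H" if "z \<in> V" for z using that V by (auto simp: hsubspace_def)
  have uniq: "w = w'" if "R z w" "R z w'" for z w w'
  proof -
    have "hsub w w' = hzero H" by (rule tot) (use that e in \<open>auto simp: R_def\<close>)
    then have "hnorm H (hsub w w') = 0" by simp
    then show ?thesis using that by (intro hnorm_sub_eq_0D) (auto simp: R_def)
  qed
  have bV: "hnorm H w \<le> K * hnorm H z" if "z \<in> V" "R z w" for z w
    using ex[OF that(1)] uniq[OF that(2)] by (auto simp: R_def)
  have Radd: "R (hadd H z z') (hadd H w w')" if "R z w" "R z' w'" "z \<in> hcarrier H" "z' \<in> hcarrier H" for z w z' w'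
    using that e by (simp add: R_def)
  have Rscale: "R (hscale H c z) (hscale H c w)" if "R z w" "z \<in> hcarrier H" for c z w
    using that e by (simp add: R_def)
  have tot': "\<exists>w. R z w \<and> hnorm H w \<le> K * hnorm H z" if z: "z \<in> hcarrier H" for z
  proof -
    obtain X where X: "hlim X z" "\<And>n. X n \<in> V" "\<And>n. hnorm H (hsub z (X n)) < 1 / real (Suc n)"
      by (rule hlim_of_approx[OF z, of V]) (use V(2)[OF z] Vc in auto)
    obtain W where W: "\<And>n. R (X n) (W n)" using ex[OF X(2)] unfolding R_def by metis
    have Wc: "W n \<in> hcarrier H" for n using W by (simp add: R_def)
    have Xc: "X n \<in> hcarrier H" for n using Vc X by auto
    have d: "hnorm H (hsub (W m) (W n)) \<le> K * hnorm H (hsub (X m) (X n))" for m n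
    proof (rule bV)
      show "hsub (X m) (X n) \<in> V" using X(2) V(1) by (simp add: hsubspace_def)
      show "R (hsub (X m) (X n)) (hsub (W m) (W n))" by (intro Radd Rscale W Xc scale_mem)
    qed
    have "hCauchy W"
      unfolding hCauchy_def
    proof (intro conjI allI impI Wc)
      fix r :: real assume r: "r > 0"
      \<comment> \<open>\<open>K + 1\<close> in place of \<open>K\<close>, because \<open>K\<close>
        may be zero.\<close>
      then have "0 < r / (K + 1)" using K by simp
      then obtain N where N: "\<And>m n. m \<ge> N \<Longrightarrow> n \<ge> N \<Longrightarrow> hnorm H (hsub (X m) (X n)) < r / (K + 1)"
        using hlim_hCauchy[OF X(1)] unfolding hCauchy_def by metis
      have "hnorm H (hsub (W m) (W n)) < r" if "m \<ge> N" "n \<ge> N" for m n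
      proof -
        have "hnorm H (hsub (W m) (W n)) \<le> (K + 1) * hnorm H (hsub (X m) (X n))"
          using d[of m n] hnorm_nonneg[of "hsub (X m) (X n)"] add_mem[OF Xc scale_mem[OF Xc]]
          unfolding distrib_right by (metis add_increasing2 mult_1)
        also have "\<dots> < (K + 1) * (r / (K + 1))" using N[OF that] K by (intro mult_strict_left_mono) auto
        also have "\<dots> = r" using K by simp
        finally show ?thesis .
      qed
      then show "\<exists>N. \<forall>m\<ge>N. \<forall>n\<ge>N. hnorm H (hsub (W m) (W n)) < r" by blast
    qed
    then obtain w where w: "hlim W w" using hCauchy_hlim by blast
    have "hinner H w (e i) = hinner H z (e' i)" for i
      using hlim_inner[OF w e(1), of i] hlim_inner[OF X(1) e(2), of i] W
      by (auto simp: R_def intro: LIMSEQ_unique)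
    moreover have "hnorm H w \<le> K * hnorm H z"
      by (rule LIMSEQ_le[OF hlim_norm[OF w] tendsto_mult_left[OF hlim_norm[OF X(1)]]]) (use bV[OF X(2) W] in auto)
    ultimately show ?thesis using w by (auto simp: R_def hlim_def)
  qed
  define T where "T = (\<lambda>z\<in>hcarrier H. SOME w. R z w \<and> hnorm H w \<le> K * hnorm H z)"
  have T: "R z (T z)" "hnorm H (T z) \<le> K * hnorm H z" if "z \<in> hcarrier H" for z
    using someI_ex[OF tot'[OF that]] that by (auto simp: T_def)
  have "T \<in> bounded_ops H"
    unfolding bounded_ops_def
  proof (intro CollectI conjI ballI allI exI)
    show "T \<in> hcarrier H \<rightarrow>\<^sub>E hcarrier H" using T by (auto simp: R_def T_def)
    fix x assume x: "x \<in> hcarrier H"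
    show "hnorm H (T x) \<le> K * hnorm H x" by (rule T(2)[OF x])
    show "T (hscale H c x) = hscale H c (T x)" for c
      by (rule uniq[OF T(1)]) (use Rscale T(1) x in auto)
    show "T (hadd H x y) = hadd H (T x) (T y)" if "y \<in> hcarrier H" for y
      by (rule uniq[OF T(1)]) (use Radd T(1) x that in auto)
  qed
  then show ?thesis using T by (intro that[of T]) (auto simp: R_def)
qed

section \<open>Adjoints and representations\<close>

lemma is_adjointD:
  assumes "is_adjoint H T S"
  shows "S \<in> bounded_ops H" "x \<in> hcarrier H \<Longrightarrow> y \<in> hcarrier H \<Longrightarrow> hinner H (T x) y = hinner H x (S y)"
  using assms by (auto simp: is_adjoint_def)

lemma op_adj_eq:
  assumes T: "T \<in> bounded_ops H" and S: "is_adjoint H T S"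
  shows "op_adj H T = S"
  unfolding op_adj_def
proof (rule the_equality)
  show "is_adjoint H T S" by fact
next
  fix S' assume S': "is_adjoint H T S'"
  note c = bounded_opsD[OF is_adjointD(1)[OF S]] bounded_opsD[OF is_adjointD(1)[OF S']]
  show "S' = S"
  proof (rule bounded_ops_ext[OF is_adjointD(1)[OF S'] is_adjointD(1)[OF S]])
    fix x assume x: "x \<in> hcarrier H"
    show "S' x = S x"
    proof (rule hext)
      fix z assume z: "z \<in> hcarrier H"
      have "hinner H z (S' x) = hinner H z (S x)"
        using is_adjointD(2)[OF S z x] is_adjointD(2)[OF S' z x] by simp
      then show "hinner H (S' x) z = hinner H (S x) z"
        using ip_commute[of "S' x" z] ip_commute[of "S x" z] c x z by simp
    qed (use c x in auto)
  qed
qed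

lemma representationD:
  assumes "representation H \<pi>"
  shows "\<pi> b \<in> bounded_ops H"
    "x \<in> hcarrier H \<Longrightarrow> \<pi> b x \<in> hcarrier H"
    "x \<in> hcarrier H \<Longrightarrow> \<pi> (a + b) x = hadd H (\<pi> a x) (\<pi> b x)"
    "x \<in> hcarrier H \<Longrightarrow> \<pi> (c *\<^sub>C b) x = hscale H c (\<pi> b x)"
    "x \<in> hcarrier H \<Longrightarrow> \<pi> (a * b) x = \<pi> a (\<pi> b x)"
    "x \<in> hcarrier H \<Longrightarrow> y \<in> hcarrier H \<Longrightarrow> hinner H (\<pi> b x) y = hinner H x (\<pi> (star b) y)"
proof -
  show *: "\<pi> b \<in> bounded_ops H" for b using assms by (simp add: representation_def)
  show "x \<in> hcarrier H \<Longrightarrow> \<pi> b x \<in> hcarrier H" using bounded_opsD(1)[OF *] by blast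
qed (use assms in \<open>auto simp: representation_def compose_def is_adjoint_def\<close>)

lemma representationI:
  assumes "\<And>b. \<pi> b \<in> bounded_ops H"
    "\<And>a b x. x \<in> hcarrier H \<Longrightarrow> \<pi> (a + b) x = hadd H (\<pi> a x) (\<pi> b x)"
    "\<And>c b x. x \<in> hcarrier H \<Longrightarrow> \<pi> (c *\<^sub>C b) x = hscale H c (\<pi> b x)"
    "\<And>a b x. x \<in> hcarrier H \<Longrightarrow> \<pi> (a * b) x = \<pi> a (\<pi> b x)"
    "\<And>b x y. x \<in> hcarrier H \<Longrightarrow> y \<in> hcarrier H \<Longrightarrow> hinner H (\<pi> b x) y = hinner H x (\<pi> (star b) y)"
  shows "representation H \<pi>"
proof -
  have "\<pi> (a * b) = op_mult H (\<pi> a) (\<pi> b)" for a b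
    by (rule ext) (use assms(4) bounded_opsD(4)[OF assms(1)] in \<open>auto simp: compose_def restrict_def\<close>)
  then show ?thesis using assms by (auto simp: representation_def is_adjoint_def)
qed

lemma representation_scaleR:
  "representation H \<pi> \<Longrightarrow> x \<in> hcarrier H \<Longrightarrow> \<pi> (r *\<^sub>R (b :: 'b::cstar_algebra)) x = hscale H (of_real r) (\<pi> b x)"
  by (simp add: scaleR_scaleC representationD)

lemma representation_diff:
  fixes \<pi> :: "'b::cstar_algebra \<Rightarrow> 'h \<Rightarrow> 'h"
  assumes "representation H \<pi>" "x \<in> hcarrier H"
  shows "\<pi> (a - b) x = hsub (\<pi> a x) (\<pi> b x)"
  using representationD(3)[OF assms, of a "(-1) *\<^sub>C b"] representationD(4)[OF assms, of "-1" b]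
  by (simp add: scaleC_minus_one)

text \<open>The element \<open>z\<close> with \<open>star z * z = (norm a)\<^sup>2 *\<^sub>R 1 - star a * a\<close> is only a multiplier, so it can be used
  on vectors \<open>\<rho> b x\<close> only; taking \<open>a = b = star c * c\<close> yields the bound on all vectors.\<close>

lemma representation_contractive:
  fixes \<rho> :: "'b::cstar_algebra \<Rightarrow> 'h \<Rightarrow> 'h"
  assumes r: "representation H \<rho>" and x: "x \<in> hcarrier H"
  shows "hnorm H (\<rho> c x) \<le> norm c * hnorm H x"
proof -
  note R = representationD[OF r]
  have sq: "(hnorm H (\<rho> a x))\<^sup>2 = Re (hinner H x (\<rho> (star a * a) x))" if "x \<in> hcarrier H" for a x
    using that by (simp add: hnorm_sq R)
  have sub: "hnorm H (\<rho> (a * b) x) \<le> norm a * hnorm H (\<rho> b x)" if x: "x \<in> hcarrier H" for a b x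
  proof -
    obtain z where z: "\<And>u v. star (lact z u) * lact z v
      = (norm (embed a))\<^sup>2 *\<^sub>R (star u * v) - star (lact (embed a) u) * lact (embed a) v"
      using ex_defect_lact by blast
    have "0 \<le> (hnorm H (\<rho> (lact z b) x))\<^sup>2" by simp
    also have "\<dots> = (norm a)\<^sup>2 * (hnorm H (\<rho> b x))\<^sup>2 - (hnorm H (\<rho> (a * b) x))\<^sup>2"
      unfolding sq[OF x] z using x
      by (simp add: representation_diff[OF r] representation_scaleR[OF r] R norm_embed)
    finally have "(hnorm H (\<rho> (a * b) x))\<^sup>2 \<le> (norm a * hnorm H (\<rho> b x))\<^sup>2" by (simp add: power_mult_distrib)
    then show ?thesis by (rule power2_le_imp_le) (simp add: x R)
  qed
  define g where "g = star c * c"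
  have sg: "star g = g" by (simp add: g_def star_mult star_star)
  have "hnorm H (\<rho> g x) \<le> norm g * hnorm H x"
  proof (cases "hnorm H (\<rho> g x) = 0")
    case False
    then have pos: "0 < hnorm H (\<rho> g x)" using x R(2)[OF x, of g] hnorm_nonneg[of "\<rho> g x"] by linarith
    have "(hnorm H (\<rho> g x))\<^sup>2 \<le> cmod (hinner H x (\<rho> (g * g) x))"
      unfolding sq[OF x] sg by (rule complex_Re_le_cmod)
    also have "\<dots> \<le> hnorm H x * hnorm H (\<rho> (g * g) x)" by (rule Cauchy_Schwarz) (use x R in auto)
    also have "\<dots> \<le> hnorm H x * (norm g * hnorm H (\<rho> g x))" using x by (intro mult_left_mono sub) auto
    finally have "hnorm H (\<rho> g x) * hnorm H (\<rho> g x) \<le> (norm g * hnorm H x) * hnorm H (\<rho> g x)"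
      by (simp add: power2_eq_square algebra_simps)
    then show ?thesis using pos by simp
  qed (use x in simp)
  have "(hnorm H (\<rho> c x))\<^sup>2 \<le> cmod (hinner H x (\<rho> g x))"
    unfolding sq[OF x] g_def by (rule complex_Re_le_cmod)
  also have "\<dots> \<le> hnorm H x * hnorm H (\<rho> g x)" by (rule Cauchy_Schwarz) (use x R in auto)
  also have "\<dots> \<le> hnorm H x * (norm g * hnorm H x)" using x \<open>hnorm H (\<rho> g x) \<le> _\<close> by (intro mult_left_mono) auto
  also have "\<dots> = (norm c * hnorm H x)\<^sup>2" by (simp add: g_def cstar_identity power2_eq_square)
  finally show ?thesis by (rule power2_le_imp_le) (use x in simp)
qed

lemma Rep_iff:
  fixes \<pi> :: "'b::cstar_algebra \<Rightarrow> 'h \<Rightarrow> 'h"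
  shows "\<pi> \<in> Rep H \<longleftrightarrow> representation H \<pi> \<and>
    (\<forall>z\<in>hcarrier H. (\<forall>b. \<forall>x\<in>hcarrier H. hinner H z (\<pi> b x) = 0) \<longrightarrow> z = hzero H)"
proof (cases "representation H \<pi>")
  case True
  have "{\<pi> b x |b x. x \<in> hcarrier H} \<subseteq> hcarrier H" using representationD(2)[OF True] by auto
  from closure_hull_eq_carrier_iff[OF this] show ?thesis using True unfolding Rep_def by blast
qed (simp add: Rep_def)

end

section \<open>GNS representations and extension to multipliers\<close>

text \<open>Without a unit there is no obvious cyclic vector, so the class of \<open>star c\<close>
  is used and the functional is chosen to norm \<open>c * star c\<close>. Then
  \<open>\<rho> c\<close> sends a vector of norm at most \<open>norm c\<close> to one whose norm is
  exactly the square of \<open>norm c\<close>.\<close>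

theorem GNS_norming:
  fixes c :: "'c::cstar_algebra" and f :: "(nat \<Rightarrow> 'c) \<Rightarrow> 'h"
  assumes f: "inj f" and c: "c \<noteq> 0"
  obtains H :: "'h hilbert" and \<rho> :: "'c \<Rightarrow> 'h \<Rightarrow> 'h" and x where
    "hilbert_space H" "\<rho> \<in> Rep H" "x \<in> hcarrier H" "0 < hnorm H x" "norm c * hnorm H x \<le> hnorm H (\<rho> c x)"
proof -
  obtain \<phi> :: "'c \<Rightarrow> complex" where \<phi>:
    "\<And>a b. \<phi> (a + b) = \<phi> a + \<phi> b" "\<And>r a. \<phi> (r *\<^sub>C a) = r * \<phi> a" "\<And>a. \<phi> (star a) = cnj (\<phi> a)"
    "\<And>a. 0 \<le> Re (\<phi> (star a * a))" "\<And>a. Re (\<phi> (star a * a)) \<le> (norm a)\<^sup>2"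
    "\<phi> (star (c * star c) * (c * star c)) = of_real ((norm (c * star c))\<^sup>2)"
    using ex_norming_positive_functional[of "c * star c"] by blast
  have \<phi>0: "\<phi> 0 = 0" using \<phi>(1)[of 0 0] by simp
  have \<phi>diff: "\<phi> (a - b) = \<phi> a - \<phi> b" for a b using \<phi>(1)[of "a - b" b] by simp
  define S where "S = \<lparr>hcarrier = (UNIV :: 'c set), hzero = 0, hadd = (+), hscale = scaleC,
    hinner = \<lambda>x y. \<phi> (star y * x)\<rparr>"
  interpret S: semi_hilbert S
  proof
    show "hinner S x y = cnj (hinner S y x)" for x y
      by (simp add: S_def star_mult star_star flip: \<phi>(3))
  qed (simp_all add: S_def \<phi> \<phi>0 distrib_left mult_scaleC_right)
  obtain H :: "'h hilbert" and j where hs: "hilbert_space H"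
    and j: "\<And>x. j x \<in> hcarrier H" "\<And>x y. hinner H (j x) (j y) = \<phi> (star y * x)"
      "\<And>x y. hadd H (j x) (j y) = j (x + y)" "\<And>r x. hscale H r (j x) = j (r *\<^sub>C x)"
    and dense: "\<And>z e. z \<in> hcarrier H \<Longrightarrow> 0 < e \<Longrightarrow> \<exists>x. hnorm H (hadd H z (hscale H (-1) (j x))) < e"
    using S.completion[OF f] by (auto simp: S_def)
  interpret H: hilbert_space H by (rule hs)
  have jr: "range j \<subseteq> hcarrier H" using j by auto
  have seq: "\<exists>X. H.hlim (\<lambda>n. j (X n)) z" if z: "z \<in> hcarrier H" for z
  proof -
    obtain Y where "H.hlim Y z" "\<And>n. Y n \<in> range j"
      by (rule H.hlim_of_approx[OF z jr]) (use dense[OF z] in auto)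
    then have "\<exists>X. \<forall>n. Y n = j (X n)" by (intro choice) auto
    then obtain X where "Y = (\<lambda>n. j (X n))" by blast
    then show ?thesis using \<open>H.hlim Y z\<close> by blast
  qed
  have tot: "z = hzero H" if z: "z \<in> hcarrier H" "\<And>x. hinner H z (j x) = 0" for z
  proof -
    obtain X where "H.hlim (\<lambda>n. j (X n)) z" using seq[OF z(1)] by blast
    from H.hlim_inner_right[OF this z(1)] have "hinner H z z = 0" using z(2) by (simp add: LIMSEQ_const_iff)
    then show ?thesis by (rule H.inner_definite[OF z(1)])
  qed
  have exteq: "u = v" if "u \<in> hcarrier H" "v \<in> hcarrier H" "\<And>x. hinner H u (j x) = hinner H v (j x)" for u v
  proof -
    have "H.hsub u v = hzero H" by (rule tot) (use that j in auto)
    then show ?thesis using that by (intro H.hnorm_sub_eq_0D) auto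
  qed
  have j0: "hzero H = j 0" using H.inner_definite[of "j 0"] j \<phi>0 by simp
  have V: "hsubspace H (range j)" using j j0 by (auto simp: hsubspace_def)
  have jsq: "(hnorm H (j x))\<^sup>2 = Re (\<phi> (star x * x))" for x by (simp add: H.hnorm_sq j)
  have bound: "hnorm H (j (a * x)) \<le> norm a * hnorm H (j x)" for a x
  proof (rule power2_le_imp_le)
    obtain z where z: "\<And>u v. star (lact z u) * lact z v
      = (norm (embed a))\<^sup>2 *\<^sub>R (star u * v) - star (lact (embed a) u) * lact (embed a) v"
      using ex_defect_lact by blast
    have "0 \<le> Re (\<phi> (star (lact z x) * lact z x))" by (rule \<phi>(4))
    then show "(hnorm H (j (a * x)))\<^sup>2 \<le> (norm a * hnorm H (j x))\<^sup>2"
      unfolding z power_mult_distrib jsq by (simp add: \<phi>diff scaleR_scaleC \<phi>(2) norm_embed)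
    show "0 \<le> norm a * hnorm H (j x)" using j by simp
  qed
  have "\<exists>T. T \<in> bounded_ops H \<and> (\<forall>z\<in>hcarrier H. \<forall>x. hinner H (T z) (j x) = hinner H z (j (star a * x)))" for a
  proof -
    \<comment> \<open>Left multiplication by \<open>a\<close> is extended from the dense image of
      the algebra by prescribing coefficients, with left multiplication by \<open>star a\<close> as
      the formal adjoint.\<close>
    obtain T where "T \<in> bounded_ops H"
      "\<And>z x. z \<in> hcarrier H \<Longrightarrow> hinner H (T z) (j x) = hinner H z (j (star a * x))"
    proof (rule H.weak_extension[where e = j and e' = "\<lambda>x. j (star a * x)" and V = "range j" and K = "norm a"])
      show "\<exists>w\<in>hcarrier H. (\<forall>i. hinner H w (j i) = hinner H z (j (star a * i))) \<and> hnorm H w \<le> norm a * hnorm H z"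
        if "z \<in> range j" for z
      proof -
        from that obtain x where "z = j x" by blast
        then show ?thesis
          using bound by (intro bexI[of _ "j (a * x)"]) (simp_all add: j star_mult star_star mult.assoc)
      qed
      show "\<exists>y\<in>range j. hnorm H (H.hsub z y) < r" if "z \<in> hcarrier H" "0 < r" for z r using dense[OF that] by auto
    qed (use j tot V in auto)
    then show ?thesis by blast
  qed
  then obtain \<rho> where \<rho>: "\<And>a. \<rho> a \<in> bounded_ops H"
    "\<And>a z x. z \<in> hcarrier H \<Longrightarrow> hinner H (\<rho> a z) (j x) = hinner H z (j (star a * x))" by metis
  note \<rho>c = H.bounded_opsD(1)[OF \<rho>(1)]
  have \<rho>j: "\<rho> a (j x) = j (a * x)" for a x
    by (rule exteq) (simp_all add: \<rho>c \<rho> j star_mult star_star mult.assoc)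
  have rep: "representation H \<rho>"
  proof (rule H.representationI)
    fix a b :: 'c and z assume z: "z \<in> hcarrier H"
    show "\<rho> (a + b) z = hadd H (\<rho> a z) (\<rho> b z)"
      by (rule exteq) (simp_all add: z \<rho>c \<rho> j star_add distrib_right flip: j(3))
    show "\<rho> (r *\<^sub>C b) z = hscale H r (\<rho> b z)" for r
      by (rule exteq) (simp_all add: z \<rho>c \<rho> j star_scaleC mult_scaleC_left flip: j(4))
    show "\<rho> (a * b) z = \<rho> a (\<rho> b z)"
      by (rule exteq) (simp_all add: z \<rho>c \<rho> star_mult mult.assoc)
    fix w assume w: "w \<in> hcarrier H"
    obtain X where X: "H.hlim (\<lambda>n. j (X n)) w" using seq[OF w] by blast
    have "hinner H (\<rho> b z) (j (X n)) = hinner H z (\<rho> (star b) (j (X n)))" for n by (simp add: \<rho> z \<rho>j)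
    then show "hinner H (\<rho> b z) w = hinner H z (\<rho> (star b) w)"
      using H.hlim_inner_right[OF X \<rho>c[OF z, of b]] H.hlim_inner_right[OF H.hlim_op[OF \<rho>(1) X] z, of "star b"]
      by (simp add: LIMSEQ_unique)
  qed (rule \<rho>(1))
  have "\<rho> \<in> Rep H"
    unfolding H.Rep_iff
  proof (intro conjI ballI impI rep)
    fix z assume z: "z \<in> hcarrier H" "\<forall>b. \<forall>x\<in>hcarrier H. hinner H z (\<rho> b x) = 0"
    show "z = hzero H"
    proof (rule tot[OF z(1)])
      fix x
      \<comment> \<open>Orthogonality to all \<open>\<rho> u (j x) = j (u * x)\<close> passes to
        \<open>j x\<close> itself, because \<open>u * x\<close> approximates \<open>x\<close> and
        \<open>j\<close> does not increase norms.\<close>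
      have zero: "hinner H z (j (u * x)) = 0" for u using z(2) j(1)[of x] \<rho>j by metis
      have "cmod (hinner H z (j x)) \<le> hnorm H z * e" if e: "e > 0" for e
      proof -
        obtain u where u: "norm (u * x - x) < e" using approx_left_unit[OF e] by blast
        have jd: "j (u * x - x) = H.hsub (j (u * x)) (j x)" by (simp add: j scaleC_minus_one)
        have "hinner H z (j (u * x - x)) = - hinner H z (j x)"
          unfolding jd using z(1) zero[of u] j(1) by simp
        then have "cmod (hinner H z (j x)) \<le> hnorm H z * hnorm H (j (u * x - x))"
          using H.Cauchy_Schwarz[OF z(1) j(1), of "u * x - x"] by simp
        also have "hnorm H (j (u * x - x)) \<le> norm (u * x - x)"
          by (rule power2_le_imp_le) (simp_all add: jsq \<phi>(5))
        finally show ?thesis using u z(1) by (smt (verit) H.hnorm_nonneg mult_left_mono)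
      qed
      then have "\<And>e. e > 0 \<Longrightarrow> cmod (hinner H z (j x)) \<le> e"
      proof -
        fix e :: real assume e: "e > 0"
        have p: "0 < hnorm H z + 1" using z(1) by (simp add: add_nonneg_pos)
        have "cmod (hinner H z (j x)) \<le> hnorm H z * (e / (hnorm H z + 1))"
          by (rule \<open>\<And>e. e > 0 \<Longrightarrow> cmod (hinner H z (j x)) \<le> hnorm H z * e\<close>) (use e p in simp)
        also have "\<dots> \<le> e" using p e z(1) by (simp add: field_simps)
        finally show "cmod (hinner H z (j x)) \<le> e" .
      qed
      then have "cmod (hinner H z (j x)) \<le> 0" by (rule field_le_epsilon[of _ 0, simplified])
      then show "hinner H z (j x) = 0" by simp
    qed
  qed
  moreover have hn: "hnorm H (\<rho> c (j (star c))) = (norm c)\<^sup>2"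
  proof (rule power2_eq_imp_eq)
    show "(hnorm H (\<rho> c (j (star c))))\<^sup>2 = ((norm c)\<^sup>2)\<^sup>2"
      using \<phi>(6) by (simp add: \<rho>j jsq norm_mult_star)
  qed (use j in \<open>simp_all add: \<rho>c\<close>)
  moreover have le: "hnorm H (j (star c)) \<le> norm c"
    by (rule power2_le_imp_le) (use \<phi>(5)[of "star c"] in \<open>simp_all add: jsq norm_star\<close>)
  moreover have "0 < hnorm H (j (star c))"
  proof (rule ccontr)
    assume "\<not> 0 < hnorm H (j (star c))"
    then have "hnorm H (j (star c)) = 0" using H.hnorm_nonneg[OF j(1)] by (metis less_eq_real_def)
    then have "hnorm H (\<rho> c (j (star c))) \<le> 0"
      using H.representation_contractive[OF rep j(1), of c "star c"] by simp
    then show False using hn c by simp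
  qed
  moreover have "norm c * hnorm H (j (star c)) \<le> hnorm H (\<rho> c (j (star c)))"
    using mult_left_mono[OF le, of "norm c"] by (simp add: hn power2_eq_square)
  ultimately show ?thesis using hs j(1) by (intro that[of H \<rho> "j (star c)"])
qed

context hilbert_space
begin

section \<open>Extension of representations to multipliers\<close>

lemma Rep_representation: "\<rho> \<in> Rep H \<Longrightarrow> representation H \<rho>"
  by (simp add: Rep_def)

lemma Rep_eqI:
  fixes \<rho> :: "'b::cstar_algebra \<Rightarrow> 'h \<Rightarrow> 'h"
  assumes "\<rho> \<in> Rep H" "u \<in> hcarrier H" "v \<in> hcarrier H"
    "\<And>b x. x \<in> hcarrier H \<Longrightarrow> hinner H u (\<rho> b x) = hinner H v (\<rho> b x)"
  shows "u = v"
proof -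
  have "hsub u v = hzero H"
    using assms(1)[unfolded Rep_iff] assms(2-4) representationD(2)[OF Rep_representation[OF assms(1)]]
    by (auto dest!: bspec[of _ _ "hsub u v"])
  then show ?thesis using assms by (intro hnorm_sub_eq_0D) auto
qed

text \<open>\<open>V\<close> need not be the span of the vectors \<open>\<rho> b x\<close>; it will
  be the set of vectors on which an identity or a construction is known to work.\<close>

lemma Rep_dense:
  fixes \<rho> :: "'b::cstar_algebra \<Rightarrow> 'h \<Rightarrow> 'h"
  assumes r: "\<rho> \<in> Rep H" and V: "hsubspace H V" "\<And>b x. x \<in> hcarrier H \<Longrightarrow> \<rho> b x \<in> V"
    and z: "z \<in> hcarrier H"
  shows "0 < e \<Longrightarrow> \<exists>y\<in>V. hnorm H (hsub z y) < e" "\<exists>X. hlim X z \<and> (\<forall>n. X n \<in> V)"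
proof -
  interpret M: Metric_space "hcarrier H" "hdist H" by (rule metric_space_hdist) (rule hnorm_sub_eq_0D)
  have Vc: "V \<subseteq> hcarrier H" using V by (simp add: hsubspace_def)
  have "hsubspace H hull {\<rho> b x |b x. x \<in> hcarrier H} \<subseteq> V"
    by (rule hull_minimal) (use V in auto)
  then have "hcarrier H \<subseteq> htopology H closure_of V"
    using r closure_of_mono unfolding Rep_def by blast
  then have "z \<in> htopology H closure_of V" using z by auto
  then show *: "0 < e \<Longrightarrow> \<exists>y\<in>V. hnorm H (hsub z y) < e" for e
    unfolding M.metric_closure_of using Vc by (auto simp: hdist_eq subset_iff) (metis hdist_eq)
  show "\<exists>X. hlim X z \<and> (\<forall>n. X n \<in> V)"
    by (rule hlim_of_approx[OF z Vc *]) blast+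
qed

lemma adjoint_extend:
  fixes \<rho> :: "'b::cstar_algebra \<Rightarrow> 'h \<Rightarrow> 'h"
  assumes r: "\<rho> \<in> Rep H" and T: "T \<in> bounded_ops H" and S: "S \<in> bounded_ops H"
    and e: "\<And>b x. x \<in> hcarrier H \<Longrightarrow> hinner H (T z) (\<rho> b x) = hinner H z (S (\<rho> b x))"
    and z: "z \<in> hcarrier H" and w: "w \<in> hcarrier H"
  shows "hinner H (T z) w = hinner H z (S w)"
proof -
  define V where "V = {w \<in> hcarrier H. hinner H (T z) w = hinner H z (S w)}"
  note c = bounded_opsD[OF T] bounded_opsD[OF S]
  have S0: "S (hzero H) = hzero H"
    using c(7)[of "hzero H" 0] zero_closed
    by (metis c(5) hext hnorm_zero inner_definite ip_scale ip_zero mult_zero_left scale_closed zero_mem)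
  have "hsubspace H V" using z S0 by (auto simp: V_def hsubspace_def c)
  then obtain X where X: "hlim X w" "\<And>n. X n \<in> V"
    using Rep_dense(2)[OF r _ _ w, of V] e representationD(2)[OF Rep_representation[OF r]] by (auto simp: V_def)
  then have "hinner H (T z) (X n) = hinner H z (S (X n))" for n by (simp add: V_def)
  then show ?thesis
    using hlim_inner_right[OF X(1) c(1)[OF z]] hlim_inner_right[OF hlim_op[OF S X(1)] z]
    by (simp add: LIMSEQ_unique)
qed

text \<open>In the proof, \<open>good z W\<close> says that \<open>W n\<close> behaves like the multiplier \<open>n\<close> applied to \<open>z\<close>.  The bound
  on \<open>W m\<close> comes from \<open>W d\<close> with \<open>star d * d = (norm m)\<^sup>2 *\<^sub>R 1 - star m * m\<close>.\<close>

lemma ex_rep_ext: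
  fixes \<rho> :: "'b::cstar_algebra \<Rightarrow> 'h \<Rightarrow> 'h"
  assumes r: "\<rho> \<in> Rep H"
  shows "\<exists>\<psi>. representation H \<psi> \<and> (\<forall>b. \<psi> (embed b) = \<rho> b)"
proof -
  note R = representationD[OF Rep_representation[OF r]]
  \<comment> \<open>The weak description of \<open>w\<close> as the value of the extended
    representation at \<open>n\<close>, applied to \<open>z\<close>: the multiplier is moved to the
    other side, where it acts on the algebra. Non-degeneracy makes \<open>w\<close> unique.\<close>
  define rel where "rel n z w \<longleftrightarrow> z \<in> hcarrier H \<and> w \<in> hcarrier H \<and>
    (\<forall>b. \<forall>y\<in>hcarrier H. hinner H w (\<rho> b y) = hinner H z (\<rho> (lact (star n) b) y))" for n z w
  have rel_unique: "w = w'" if "rel n z w" "rel n z w'" for n z w w'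
    by (rule Rep_eqI[OF r]) (use that in \<open>auto simp: rel_def\<close>)
  have rel_rho: "rel n (\<rho> b x) (\<rho> (lact n b) x)" if "x \<in> hcarrier H" for n b x
    unfolding rel_def
  proof (intro conjI allI ballI)
    fix b' y assume y: "y \<in> hcarrier H"
    have "star (lact n b) * b' = star b * lact (star n) b'"
      using star_lact_mult[of n b 1 b'] by simp
    then show "hinner H (\<rho> (lact n b) x) (\<rho> b' y) = hinner H (\<rho> b x) (\<rho> (lact (star n) b') y)"
      using that y by (simp add: R flip: R(5))
  qed (use that R in auto)
  define good where "good z W \<longleftrightarrow> W 1 = z \<and> (\<forall>n. W n \<in> hcarrier H) \<and>
    (\<forall>n x w k. rel n x w \<longrightarrow> hinner H w (W k) = hinner H x (W (star n * k)))" for z and W :: "'b multiplier \<Rightarrow> 'h"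
  have good_rel: "rel n z (W n)" if g: "good z W" for z W n
    unfolding rel_def
  proof (intro conjI allI ballI)
    have W: "W 1 = z" "\<And>n. W n \<in> hcarrier H"
      "\<And>n x w k. rel n x w \<Longrightarrow> hinner H w (W k) = hinner H x (W (star n * k))"
      using g by (auto simp: good_def)
    show zc: "z \<in> hcarrier H" using W(1) W(2)[of 1] by simp
    show "W n \<in> hcarrier H" by (rule W)
    fix b y assume y: "y \<in> hcarrier H"
    have "hinner H (\<rho> (lact (star n) b) y) z = hinner H (\<rho> b y) (W n)"
      using W(3)[OF rel_rho[OF y, of "star n" b], of 1] W(1) by (simp add: star_star)
    then show "hinner H (W n) (\<rho> b y) = hinner H z (\<rho> (lact (star n) b) y)"
      using ip_commute[of "W n" "\<rho> b y"] ip_commute[of z "\<rho> (lact (star n) b) y"] W(2) zc R(2)[OF y] by simp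
  qed
  \<comment> \<open>Families for \<open>\<rho> b x\<close> are given by
    \<open>\<rho> (lact n b) x\<close> and can be added, so \<open>V\<close> contains all finite
    sums. That the action does not depend on how a vector is written as a sum then follows from
    \<open>rel_unique\<close>.\<close>
  define V where "V = {z. \<exists>W. good z W}"
  have Vsub: "hsubspace H V"
    unfolding hsubspace_def
  proof (intro conjI ballI allI)
    show "V \<subseteq> hcarrier H" using good_rel by (auto simp: V_def rel_def)
    have "good (hzero H) (\<lambda>_. hzero H)" by (auto simp: good_def rel_def zero_closed)
    then show "hzero H \<in> V" by (auto simp: V_def)
    fix z assume "z \<in> V"
    then obtain W where W: "good z W" by (auto simp: V_def)
    have "good (hscale H c z) (\<lambda>n. hscale H c (W n))" for c
      using W by (auto simp: good_def rel_def scale_closed)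
    then show "hscale H c z \<in> V" for c by (auto simp: V_def)
    fix z' assume "z' \<in> V"
    then obtain W' where W': "good z' W'" by (auto simp: V_def)
    have "good (hadd H z z') (\<lambda>n. hadd H (W n) (W' n))"
      unfolding good_def
    proof (intro conjI allI impI)
      fix n x w k assume rl: "rel n x w"
      have eq: "hinner H w (W k) = hinner H x (W (star n * k))"
        "hinner H w (W' k) = hinner H x (W' (star n * k))" using W W' rl by (auto simp: good_def)
      have mem: "x \<in> hcarrier H" "w \<in> hcarrier H" "\<And>k. W k \<in> hcarrier H" "\<And>k. W' k \<in> hcarrier H"
        using rl W W' by (auto simp: rel_def good_def)
      show "hinner H w (hadd H (W k) (W' k)) = hinner H x (hadd H (W (star n * k)) (W' (star n * k)))"
        by (simp add: mem eq)
    qed (use W W' in \<open>auto simp: good_def\<close>)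
    then show "hadd H z z' \<in> V" by (auto simp: V_def)
  qed
  have Vrho: "\<rho> b x \<in> V" if x: "x \<in> hcarrier H" for b x
  proof -
    have "good (\<rho> b x) (\<lambda>n. \<rho> (lact n b) x)" using x by (auto simp: good_def rel_def R)
    then show ?thesis by (auto simp: V_def)
  qed
  have "\<exists>T. T \<in> bounded_ops H \<and> (\<forall>z\<in>hcarrier H. \<forall>b. \<forall>y\<in>hcarrier H.
      hinner H (T z) (\<rho> b y) = hinner H z (\<rho> (lact (star m) b) y))" for m
  proof -
    \<comment> \<open>The family must be indexed by a whole type, so second components outside the
      carrier are replaced by the zero vector.\<close>
    define e where "e i = \<rho> (fst i) (if snd i \<in> hcarrier H then snd i else hzero H)" for i :: "'b \<times> 'h"
    define e' where "e' i = \<rho> (lact (star m) (fst i)) (if snd i \<in> hcarrier H then snd i else hzero H)" for i :: "'b \<times> 'h"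
    have ec: "e i \<in> hcarrier H" "e' i \<in> hcarrier H" for i by (auto simp: e_def e'_def R zero_closed)
    obtain T where T: "T \<in> bounded_ops H" "\<And>z i. z \<in> hcarrier H \<Longrightarrow> hinner H (T z) (e i) = hinner H z (e' i)"
    proof (rule weak_extension[where e = e and e' = e' and V = V and K = "norm m"])
      show "z = hzero H" if "z \<in> hcarrier H" "\<And>i. hinner H z (e i) = 0" for z
      proof (rule Rep_eqI[OF r that(1) zero_closed])
        fix b x assume x: "x \<in> hcarrier H"
        then show "hinner H z (\<rho> b x) = hinner H (hzero H) (\<rho> b x)" using that(2)[of "(b, x)"] R(2)[OF x] by (simp add: e_def)
      qed
      show "\<exists>y\<in>V. hnorm H (hsub z y) < q" if "z \<in> hcarrier H" "0 < q" for z q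
        using Rep_dense(1)[OF r Vsub Vrho that] by blast
      show "\<exists>w\<in>hcarrier H. (\<forall>i. hinner H w (e i) = hinner H z (e' i)) \<and> hnorm H w \<le> norm m * hnorm H z"
        if "z \<in> V" for z
      proof -
        from that obtain W where g: "good z W" by (auto simp: V_def)
        then have W: "W 1 = z" "\<And>n. W n \<in> hcarrier H"
          "\<And>n x w k. rel n x w \<Longrightarrow> hinner H w (W k) = hinner H x (W (star n * k))"
          by (auto simp: good_def)
        have zc: "z \<in> hcarrier H" using W(1) W(2)[of 1] by simp
        obtain d where d: "star d * d = (norm m)\<^sup>2 *\<^sub>R 1 - star m * m" using ex_defect by blast
        have sum: "W (star d * d + star m * m) = hadd H (W (star d * d)) (W (star m * m))"
        proof (rule rel_unique[OF good_rel[OF g]])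
          show "rel (star d * d + star m * m) z (hadd H (W (star d * d)) (W (star m * m)))"
            using good_rel[OF g, of "star d * d"] good_rel[OF g, of "star m * m"]
            by (auto simp: rel_def star_add R add_closed)
        qed
        have one: "W ((norm m)\<^sup>2 *\<^sub>R 1) = hscale H (of_real ((norm m)\<^sup>2)) z"
        proof (rule rel_unique[OF good_rel[OF g]])
          show "rel ((norm m)\<^sup>2 *\<^sub>R 1) z (hscale H (of_real ((norm m)\<^sup>2)) z)"
            using zc by (auto simp: rel_def star_scaleR scaleR_scaleC star_scaleC R scale_closed)
        qed
        have "hinner H (W m) (W m) = hinner H z (W (star m * m))" by (rule W(3)[OF good_rel[OF g]])
        moreover have "hinner H (W d) (W d) = hinner H z (W (star d * d))" by (rule W(3)[OF good_rel[OF g]])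
        ultimately have "hinner H (W d) (W d) + hinner H (W m) (W m) = hinner H z (W (star d * d + star m * m))"
          unfolding sum using zc W(2) by simp
        also have "star d * d + star m * m = (norm m)\<^sup>2 *\<^sub>R 1" using d by simp
        finally have "(hnorm H (W d))\<^sup>2 + (hnorm H (W m))\<^sup>2 = (norm m)\<^sup>2 * (hnorm H z)\<^sup>2"
          unfolding one using zc W(2) by (simp add: hnorm_sq complex_eq_iff)
        then have "(hnorm H (W m))\<^sup>2 \<le> (norm m * hnorm H z)\<^sup>2"
          by (simp add: power_mult_distrib) (metis le_add_same_cancel2 zero_le_power2)
        then have "hnorm H (W m) \<le> norm m * hnorm H z" by (rule power2_le_imp_le) (use zc in simp)
        moreover have "hinner H (W m) (e i) = hinner H z (e' i)" for i
          using good_rel[OF g, of m] by (auto simp: rel_def e_def e'_def zero_closed)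
        ultimately show ?thesis using W(2) by blast
      qed
    qed (use ec Vsub in auto)
    have "hinner H (T z) (\<rho> b y) = hinner H z (\<rho> (lact (star m) b) y)"
      if "z \<in> hcarrier H" "y \<in> hcarrier H" for z b y
      using T(2)[OF that(1), of "(b, y)"] that by (simp add: e_def e'_def)
    then show ?thesis using T(1) by blast
  qed
  then obtain \<psi> where \<psi>: "\<And>m. \<psi> m \<in> bounded_ops H"
    "\<And>m z b y. z \<in> hcarrier H \<Longrightarrow> y \<in> hcarrier H \<Longrightarrow>
      hinner H (\<psi> m z) (\<rho> b y) = hinner H z (\<rho> (lact (star m) b) y)" by metis
  note \<psi>c = bounded_opsD(1)[OF \<psi>(1)]
  have \<psi>rho: "\<psi> m (\<rho> b y) = \<rho> (lact m b) y" if "y \<in> hcarrier H" for m b y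
    by (rule rel_unique[OF _ rel_rho[OF that]]) (use that in \<open>auto simp: rel_def R \<psi>c \<psi>\<close>)
  have "representation H \<psi>"
  proof (rule representationI)
    fix m n :: "'b multiplier" and z assume z: "z \<in> hcarrier H"
    show "\<psi> (m + n) z = hadd H (\<psi> m z) (\<psi> n z)"
      by (rule Rep_eqI[OF r]) (simp_all add: z \<psi>c \<psi> star_add R add_closed)
    show "\<psi> (c *\<^sub>C n) z = hscale H c (\<psi> n z)" for c
      by (rule Rep_eqI[OF r]) (simp_all add: z \<psi>c \<psi> star_scaleC R scale_closed)
    show "\<psi> (m * n) z = \<psi> m (\<psi> n z)"
      by (rule Rep_eqI[OF r]) (simp_all add: z \<psi>c \<psi> star_mult)
    fix w assume w: "w \<in> hcarrier H"
    show "hinner H (\<psi> n z) w = hinner H z (\<psi> (star n) w)"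
      by (rule adjoint_extend[OF r \<psi>(1) \<psi>(1) _ z w]) (simp add: \<psi> z \<psi>rho)
  qed (rule \<psi>)
  moreover have "\<psi> (embed b) = \<rho> b" for b
  proof (rule bounded_ops_ext[OF \<psi>(1) R(1)])
    fix z assume z: "z \<in> hcarrier H"
    show "\<psi> (embed b) z = \<rho> b z"
      by (rule Rep_eqI[OF r]) (simp_all add: z \<psi>c \<psi> R flip: embed_star)
  qed
  ultimately show ?thesis by blast
qed

lemma representation_embed_mult:
  fixes \<psi> :: "'b::cstar_algebra multiplier \<Rightarrow> 'h \<Rightarrow> 'h"
  assumes "representation H \<psi>" "\<And>b. \<psi> (embed b) = \<rho> b" "x \<in> hcarrier H"
  shows "\<psi> m (\<rho> b x) = \<rho> (lact m b) x"
  using representationD(5)[OF assms(1,3), of m "embed b"] by (simp add: mult_embed assms(2))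

lemma rep_ext_unique:
  fixes \<rho> :: "'b::cstar_algebra \<Rightarrow> 'h \<Rightarrow> 'h"
  assumes r: "\<rho> \<in> Rep H" and p: "representation H \<psi>" "\<And>b. \<psi> (embed b) = \<rho> b"
    and p': "representation H \<psi>'" "\<And>b. \<psi>' (embed b) = \<rho> b"
  shows "\<psi> = \<psi>'"
proof
  fix m
  show "\<psi> m = \<psi>' m"
  proof (rule bounded_ops_ext[OF representationD(1)[OF p(1)] representationD(1)[OF p'(1)]])
    fix z assume z: "z \<in> hcarrier H"
    show "\<psi> m z = \<psi>' m z"
      by (rule Rep_eqI[OF r])
         (simp_all add: z representationD[OF p(1)] representationD[OF p'(1)]
           representationD(2)[OF Rep_representation[OF r]]
           representation_embed_mult[OF p] representation_embed_mult[OF p'])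
  qed
qed

lemma rep_ext:
  fixes \<rho> :: "'b::cstar_algebra \<Rightarrow> 'h \<Rightarrow> 'h"
  assumes r: "\<rho> \<in> Rep H"
  shows rep_ext_representation: "representation H (rep_ext H \<rho>)"
    and rep_ext_embed: "rep_ext H \<rho> (embed b) = \<rho> b"
    and rep_ext_eqI: "representation H \<psi> \<Longrightarrow> (\<And>b. \<psi> (embed b) = \<rho> b) \<Longrightarrow> rep_ext H \<rho> = \<psi>"
proof -
  have "\<exists>!\<psi>. representation H \<psi> \<and> (\<forall>b. \<psi> (embed b) = \<rho> b)"
    using ex_rep_ext[OF r] rep_ext_unique[OF r] by blast
  from theI'[OF this] show *: "representation H (rep_ext H \<rho>)" and **: "rep_ext H \<rho> (embed b) = \<rho> b" for b
    by (auto simp: rep_ext_def)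
  show "rep_ext H \<rho> = \<psi>" if "representation H \<psi>" "\<And>b. \<psi> (embed b) = \<rho> b"
    using rep_ext_unique[OF r * ** that] .
qed

end

section \<open>Extension of non-degenerate homomorphisms\<close>

lemma module_scaleC: "module (scaleC :: complex \<Rightarrow> 'a::star_algebra \<Rightarrow> 'a)"
  by standard (simp_all add: scaleC_add_right scaleC_add_left scaleC_scaleC scaleC_one)

lemma nondegenerate_induct:
  fixes \<phi> :: "'s::cstar_algebra \<Rightarrow> 'b::cstar_algebra multiplier"
  assumes \<phi>: "nondegenerate_hom \<phi>" and cl: "closed {x. P x}"
    and P: "P 0" "\<And>x y. P x \<Longrightarrow> P y \<Longrightarrow> P (x + y)" "\<And>c x. P x \<Longrightarrow> P (c *\<^sub>C x)"
      "\<And>s b. P (lact (\<phi> s) b)"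
  shows "P x"
proof -
  interpret M: module "scaleC :: complex \<Rightarrow> 'b \<Rightarrow> 'b" by (rule module_scaleC)
  have "module.span scaleC {lact (\<phi> s) b |s b. True} \<subseteq> {x. P x}"
    by (rule M.span_minimal) (use P in \<open>auto simp: M.subspace_def\<close>)
  then have "closure (module.span scaleC {lact (\<phi> s) b |s b. True}) \<subseteq> {x. P x}"
    by (rule closure_minimal[OF _ cl])
  then show ?thesis using \<phi> by (auto simp: nondegenerate_hom_def)
qed

lemma closed_linear_eq:
  assumes "bounded_linear f" "bounded_linear g" shows "closed {x. f x = g x}"
  by (intro closed_Collect_eq linear_continuous_on assms)

lemma mult_ext_unique:
  fixes \<phi> :: "'s::cstar_algebra \<Rightarrow> 'b::cstar_algebra multiplier"
  assumes \<phi>: "nondegenerate_hom \<phi>"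
    and p: "star_hom \<psi>" "\<And>s. \<psi> (embed s) = \<phi> s" and p': "star_hom \<psi>'" "\<And>s. \<psi>' (embed s) = \<phi> s"
  shows "\<psi> = \<psi>'"
proof
  fix m
  have eq: "lact (\<psi> m) (lact (\<phi> s) b) = lact (\<phi> (lact m s)) b"
    if "star_hom \<psi>" "\<And>s. \<psi> (embed s) = \<phi> s" for \<psi> s b
    using star_homD(3)[OF that(1), of m "embed s"] by (simp add: mult_embed that(2) flip: lact_times)
  show "\<psi> m = \<psi>' m"
  proof (rule multiplier_eqI)
    fix x
    show "lact (\<psi> m) x = lact (\<psi>' m) x"
      by (rule nondegenerate_induct[OF \<phi>, where P = "\<lambda>x. lact (\<psi> m) x = lact (\<psi>' m) x"])
         (simp_all add: closed_linear_eq bounded_linear_lact lact_add lact_scaleC eq[OF p] eq[OF p'])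
  qed
qed

lemma bounded_linear_star_mult: "bounded_linear (\<lambda>y :: 'a::cstar_algebra. star y * v)"
  using bounded_linear_compose[OF bounded_linear_mult_left bounded_linear_star] .

text \<open>The construction of \<open>ex_rep_ext\<close> with the algebra-valued inner product \<open>star y * x\<close>.\<close>

lemma ex_mult_ext:
  fixes \<phi> :: "'s::cstar_algebra \<Rightarrow> 'b::cstar_algebra multiplier"
  assumes h: "star_hom \<phi>" and nd: "nondegenerate_hom \<phi>"
  shows "\<exists>\<psi>. star_hom \<psi> \<and> \<psi> 1 = 1 \<and> (\<forall>s. \<psi> (embed s) = \<phi> s)"
proof -
  note H = star_homD[OF h]
  define rel where "rel n x w \<longleftrightarrow> (\<forall>s b. star (lact (\<phi> s) b) * w = star (lact (\<phi> (lact (star n) s)) b) * x)"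
    for n x w
  have Hi: "star (lact (\<phi> s) b) * lact (\<phi> t) c = star b * lact (\<phi> (star s * t)) c" for s t b c
    by (simp add: star_lact_mult H)
  \<comment> \<open>By non-degeneracy \<open>v\<close> itself is a limit of combinations of the test
    vectors, whence \<open>star v * v = 0\<close>.\<close>
  have tot: "v = 0" if "\<And>s b. star (lact (\<phi> s) b) * v = 0" for v
  proof -
    have "star v * v = 0"
      by (rule nondegenerate_induct[OF nd, where P = "\<lambda>y. star y * v = 0"])
         (auto simp: that star_add star_scaleC distrib_right mult_scaleC_left
           intro: closed_linear_eq[OF bounded_linear_star_mult bounded_linear_zero])
    then show ?thesis using cstar_identity[of v] by simp
  qed
  have rel_unique: "w = w'" if "rel n x w" "rel n x w'" for n x w w'
    using tot[of "w - w'"] that by (simp add: rel_def right_diff_distrib)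
  have rel_phi: "rel n (lact (\<phi> s) b) (lact (\<phi> (lact n s)) b)" for n s b
    using star_lact_mult[of "star n" _ 1 s] by (simp add: rel_def Hi star_star)
  have rel_add: "rel n (x + y) (w + v)" if "rel n x w" "rel n y v" for n x y w v
    using that by (simp add: rel_def distrib_left)
  have rel_scale: "rel n (c *\<^sub>C x) (c *\<^sub>C w)" if "rel n x w" for n x w c
    using that by (simp add: rel_def mult_scaleC_right)
  have rel_0: "rel n 0 0" for n by (simp add: rel_def)
  have rel_mult: "rel n (x * y) (w * y)" if "rel n x w" for n x w y
    using that by (simp add: rel_def flip: mult.assoc)
  have rel_add_left: "rel (m + n) x (w + v)" if "rel m x w" "rel n x v" for m n x w v
    using that by (simp add: rel_def star_add H distrib_left distrib_right)
  have rel_scale_left: "rel (c *\<^sub>C n) x (c *\<^sub>C w)" if "rel n x w" for n x w c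
    using that by (simp add: rel_def star_scaleC H mult_scaleC_right mult_scaleC_left)
  have rel_comp: "rel (m * n) x w" if "rel n x v" "rel m v w" for m n x v w
    using that by (simp add: rel_def star_mult)
  have rel_1: "rel 1 x x" for x by (simp add: rel_def)
  have rel_embed: "rel (embed s) x (lact (\<phi> s) x)" for s x
    by (simp add: rel_def star_lact_mult H star_mult star_star flip: embed_star)
       (simp add: star_lact H star_mult star_star ract_lact flip: lact_times)
  define good where "good x W \<longleftrightarrow> W 1 = x \<and>
    (\<forall>n y w k. rel n y w \<longrightarrow> star w * W k = star y * W (star n * k))" for x and W :: "'s multiplier \<Rightarrow> 'b"
  have good_rel: "rel n x (W n)" if g: "good x W" for x W n
    unfolding rel_def
  proof (intro allI)
    fix s b
    have "star (lact (\<phi> (lact (star n) s)) b) * W 1 = star (lact (\<phi> s) b) * W (star (star n) * 1)"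
      using g rel_phi[of "star n" s b] unfolding good_def by blast
    then show "star (lact (\<phi> s) b) * W n = star (lact (\<phi> (lact (star n) s)) b) * x"
      using g by (simp add: good_def star_star)
  qed
  have good_phi: "good (lact (\<phi> s) b) (\<lambda>k. lact (\<phi> (lact k s)) b)" for s b
    unfolding good_def
  proof (intro conjI allI impI)
    fix n y w k assume "rel n y w"
    then have "star (lact (\<phi> (lact k s)) b) * w = star (lact (\<phi> (lact (star n) (lact k s))) b) * y"
      by (simp add: rel_def)
    from arg_cong[OF this, of star]
    show "star w * lact (\<phi> (lact k s)) b = star y * lact (\<phi> (lact (star n * k) s)) b"
      by (simp add: star_mult star_star)
  qed simp
  have good_bound: "norm (W m) \<le> norm m * norm x" if g: "good x W" for x W m
  proof -
    obtain d where d: "star d * d = (norm m)\<^sup>2 *\<^sub>R 1 - star m * m" using ex_defect by blast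
    have sq: "star (W n) * W n = star x * W (star n * n)" for n
      using g good_rel[OF g, of n] unfolding good_def by blast
    have "W (star d * d + star m * m) = W (star d * d) + W (star m * m)"
      by (rule rel_unique[OF good_rel[OF g]]) (intro rel_add_left good_rel[OF g])
    moreover have "W (star d * d + star m * m) = (norm m)\<^sup>2 *\<^sub>R x"
      unfolding d by (rule rel_unique[OF good_rel[OF g]]) (simp add: scaleR_scaleC rel_scale_left rel_1)
    ultimately have sum: "star (W d) * W d + star (W m) * W m = (norm m)\<^sup>2 *\<^sub>R (star x * x)"
      unfolding sq by (metis distrib_left mult_scaleR_right)
    \<comment> \<open>\<open>sum\<close> exhibits the difference as \<open>star (W d) * W d\<close>;
      its positivity is used in the multiplier algebra, where a unit is available for the
      monotonicity of the norm.\<close>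
    have "norm (embed (star (W m) * W m)) \<le> norm (embed ((norm m)\<^sup>2 *\<^sub>R (star x * x)))"
    proof (rule cpos_norm_mono)
      have "embed ((norm m)\<^sup>2 *\<^sub>R (star x * x)) - embed (star (W m) * W m) = embed (star (W d) * W d)"
        unfolding sum[symmetric] by (simp add: embed_add)
      then show "cpos (embed ((norm m)\<^sup>2 *\<^sub>R (star x * x)) - embed (star (W m) * W m))"
        by (simp add: embed_mult embed_star cpos_star_mult)
    qed (simp add: embed_mult embed_star cpos_star_mult)
    then have "(norm (W m))\<^sup>2 \<le> (norm m * norm x)\<^sup>2"
      by (simp add: norm_embed cstar_identity power_mult_distrib)
    then show ?thesis by (rule power2_le_imp_le) simp
  qed
  define V where "V = {x. \<exists>W. good x W}"
  have V_add: "x + y \<in> V" if xy: "x \<in> V" "y \<in> V" for x y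
  proof -
    obtain W W' where "good x W" "good y W'" using xy by (auto simp: V_def)
    then have "good (x + y) (\<lambda>n. W n + W' n)" by (simp add: good_def distrib_left)
    then show ?thesis by (auto simp: V_def)
  qed
  have V_scale: "c *\<^sub>C x \<in> V" if xV: "x \<in> V" for c x
  proof -
    obtain W where "good x W" using xV by (auto simp: V_def)
    then have "good (c *\<^sub>C x) (\<lambda>n. c *\<^sub>C W n)" by (simp add: good_def mult_scaleC_right)
    then show ?thesis by (auto simp: V_def)
  qed
  have V_diff: "x - y \<in> V" if "x \<in> V" "y \<in> V" for x y
    using V_add[OF that(1) V_scale[OF that(2), of "-1"]] by (simp add: scaleC_minus_one)
  have V0: "0 \<in> V" by (auto simp: V_def good_def intro!: exI[of _ "\<lambda>_. 0"])
  have V_phi: "lact (\<phi> s) b \<in> V" for s b using good_phi by (auto simp: V_def)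
  have Vdense: "x \<in> closure V" for x
  proof (rule nondegenerate_induct[OF nd, where P = "\<lambda>x. x \<in> closure V"])
    show "x + y \<in> closure V" if "x \<in> closure V" "y \<in> closure V" for x y
    proof -
      obtain X Y where "\<And>n. X n \<in> V" "X \<longlonglongrightarrow> x" "\<And>n. Y n \<in> V" "Y \<longlonglongrightarrow> y"
        using \<open>x \<in> closure V\<close> \<open>y \<in> closure V\<close> by (auto simp: closure_sequential)
      then show ?thesis
        unfolding closure_sequential by (intro exI[of _ "\<lambda>n. X n + Y n"]) (auto intro: V_add tendsto_add)
    qed
    show "c *\<^sub>C x \<in> closure V" if xV: "x \<in> closure V" for x c
    proof -
      obtain X where "\<And>n. X n \<in> V" "X \<longlonglongrightarrow> x" using xV by (auto simp: closure_sequential)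
      then show ?thesis
        unfolding closure_sequential
        by (intro exI[of _ "\<lambda>n. c *\<^sub>C X n"]) (auto intro: V_scale bounded_linear.tendsto[OF bounded_linear_scaleC])
    qed
    show "0 \<in> closure V" "lact (\<phi> s) b \<in> closure V" for s b
      using V0 V_phi closure_subset by blast+
  qed simp
  have "\<exists>w. rel m x w \<and> norm w \<le> norm m * norm x" for m x
  proof -
    obtain X where X: "\<And>n. X n \<in> V" "X \<longlonglongrightarrow> x" using Vdense[of x] by (auto simp: closure_sequential)
    have "\<exists>w. rel m (X n) w" for n using X(1)[of n] good_rel by (auto simp: V_def)
    then obtain Y where Y: "\<And>n. rel m (X n) (Y n)" by metis
    have bV: "norm w \<le> norm m * norm z" if zw: "z \<in> V" "rel m z w" for z w
    proof -
      obtain W where g: "good z W" using zw by (auto simp: V_def)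
      show ?thesis unfolding rel_unique[OF zw(2) good_rel[OF g]] by (rule good_bound[OF g])
    qed
    have rd: "rel m (X k - X n) (Y k - Y n)" for k n
      using rel_add[OF Y[of k] rel_scale[OF Y[of n], of "-1"]] by (simp add: scaleC_minus_one)
    have d: "norm (Y k - Y n) \<le> norm m * norm (X k - X n)" for k n
      by (rule bV[OF V_diff[OF X(1) X(1)] rd])
    have "Cauchy Y"
    proof (rule CauchyI)
      fix e :: real assume e: "e > 0"
      then have "0 < e / (norm m + 1)" by (simp add: add_nonneg_pos)
      then obtain N where N: "\<And>k n. k \<ge> N \<Longrightarrow> n \<ge> N \<Longrightarrow> norm (X k - X n) < e / (norm m + 1)"
        using LIMSEQ_imp_Cauchy[OF X(2)] by (meson CauchyD)
      have "norm (Y k - Y n) < e" if "k \<ge> N" "n \<ge> N" for k n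
      proof -
        have "norm (Y k - Y n) \<le> (norm m + 1) * norm (X k - X n)"
          using d[of k n] by (simp add: distrib_right add_increasing2)
        also have "\<dots> < (norm m + 1) * (e / (norm m + 1))"
          using N[OF that] by (intro mult_strict_left_mono) (auto simp: add_nonneg_pos)
        also have "\<dots> = e" using add_nonneg_pos[of "norm m" 1] by simp
        finally show ?thesis .
      qed
      then show "\<exists>N. \<forall>k\<ge>N. \<forall>n\<ge>N. norm (Y k - Y n) < e" by blast
    qed
    then have "convergent Y" by (rule Cauchy_convergent)
    then obtain w where w: "Y \<longlonglongrightarrow> w" by (auto simp: convergent_def)
    have "rel m x w"
      unfolding rel_def
    proof (intro allI)
      fix s b
      show "star (lact (\<phi> s) b) * w = star (lact (\<phi> (lact (star m) s)) b) * x"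
        using tendsto_mult_left[OF w, of "star (lact (\<phi> s) b)"]
          tendsto_mult_left[OF X(2), of "star (lact (\<phi> (lact (star m) s)) b)"] Y
        by (auto simp: rel_def intro: LIMSEQ_unique)
    qed
    moreover have "norm w \<le> norm m * norm x"
      by (rule LIMSEQ_le[OF tendsto_norm[OF w] tendsto_mult_left[OF tendsto_norm[OF X(2)]]])
         (use bV[OF X(1) Y] in auto)
    ultimately show ?thesis by blast
  qed
  then obtain L where L: "\<And>m x. rel m x (L m x)" "\<And>m x. norm (L m x) \<le> norm m * norm x" by metis
  have L_eq: "L m x = w" if "rel m x w" for m x w by (rule rel_unique[OF L(1) that])
  have L_bl: "bounded_linear (L m)" for m
  proof (rule bounded_linear_intro[where K = "norm m"])
    show "norm (L m x) \<le> norm x * norm m" for x using L(2)[of m x] by (simp only: mult.commute)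
  qed (auto simp: scaleR_scaleC intro: L_eq rel_add rel_scale L(1))
  have L_phi: "L m (lact (\<phi> s) b) = lact (\<phi> (lact m s)) b" for m s b by (rule L_eq[OF rel_phi])
  have L_scale: "L m (c *\<^sub>C x) = c *\<^sub>C L m x" for m c x by (rule L_eq[OF rel_scale[OF L(1)]])
  have L_add: "L m (x + y) = L m x + L m y" for m x y by (rule L_eq[OF rel_add[OF L(1) L(1)]])
  have L_mult: "L m (x * y) = L m x * y" for m x y by (rule L_eq[OF rel_mult[OF L(1)]])
  have L_adj: "star (L (star m) u) * y = star u * L m y" for m u y
  proof (rule nondegenerate_induct[OF nd, where P = "\<lambda>y. star (L (star m) u) * y = star u * L m y"])
    show "closed {y. star (L (star m) u) * y = star u * L m y}"
      by (intro closed_linear_eq bounded_linear_mult_right bounded_linear_compose[OF bounded_linear_mult_right L_bl])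
    show "star (L (star m) u) * lact (\<phi> s) b = star u * L m (lact (\<phi> s) b)" for s b
    proof -
      have "star (lact (\<phi> s) b) * L (star m) u = star (lact (\<phi> (lact m s)) b) * u"
        using L(1)[of "star m" u] by (simp add: rel_def star_star)
      from arg_cong[OF this, of star] show ?thesis by (simp add: L_phi star_mult star_star)
    qed
  qed (simp_all add: L_add L_scale distrib_left mult_scaleC_right L_eq[OF rel_0])
  \<comment> \<open>The right action is forced by compatibility with \<open>star\<close>;
    \<open>L_adj\<close> is the centralizer identity linking the two actions.\<close>
  define R where "R m x = star (L (star m) (star x))" for m x
  have dc: "double_centralizer (L m, R m)" for m
    unfolding double_centralizer_def bounded_clinear_def prod.case
  proof (intro conjI allI)
    show "bounded_linear (R m)"
      unfolding R_def by (intro bounded_linear_compose[OF bounded_linear_star]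
          bounded_linear_compose[OF L_bl] bounded_linear_star)
    show "R m x * y = x * L m y" for x y using L_adj[of m "star x" y] by (simp add: R_def star_star)
  qed (simp_all add: L_bl L_scale L_mult R_def star_mult star_scaleC star_star)
  define \<psi> where "\<psi> m = Abs_multiplier (L m, R m)" for m
  have l: "lact (\<psi> m) x = L m x" and r: "ract (\<psi> m) x = R m x" for m x
    unfolding \<psi>_def lact.rep_eq ract.rep_eq using dc by (simp_all add: Abs_multiplier_inverse)
  have "star_hom \<psi>"
    unfolding star_hom_def
  proof (intro conjI allI)
    show "\<psi> (m + n) = \<psi> m + \<psi> n" for m n
      by (rule multiplier_eqI) (simp add: l L_eq[OF rel_add_left[OF L(1) L(1)]])
    show "\<psi> (c *\<^sub>C m) = c *\<^sub>C \<psi> m" for c m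
      by (rule multiplier_eqI) (simp add: l L_eq[OF rel_scale_left[OF L(1)]])
    show "\<psi> (m * n) = \<psi> m * \<psi> n" for m n
      by (rule multiplier_eqI) (simp add: l L_eq[OF rel_comp[OF L(1) L(1)]])
    show "\<psi> (star m) = star (\<psi> m)" for m
      by (rule multiplier_eqI) (simp add: l lact_star r R_def star_star)
  qed
  moreover have "\<psi> 1 = 1" by (rule multiplier_eqI) (simp add: l L_eq[OF rel_1])
  moreover have "\<psi> (embed s) = \<phi> s" for s by (rule multiplier_eqI) (simp add: l L_eq[OF rel_embed])
  ultimately show ?thesis by blast
qed

lemma mult_ext:
  fixes \<phi> :: "'s::cstar_algebra \<Rightarrow> 'b::cstar_algebra multiplier"
  assumes "star_hom \<phi>" "nondegenerate_hom \<phi>"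
  shows star_hom_mult_ext: "star_hom (mult_ext \<phi>)"
    and mult_ext_one: "mult_ext \<phi> 1 = 1"
    and mult_ext_embed: "mult_ext \<phi> (embed s) = \<phi> s"
proof -
  have "\<exists>!\<psi>. star_hom \<psi> \<and> \<psi> 1 = 1 \<and> (\<forall>s. \<psi> (embed s) = \<phi> s)"
    using ex_mult_ext[OF assms] mult_ext_unique[OF assms(2)] by blast
  from theI'[OF this] show "star_hom (mult_ext \<phi>)" "mult_ext \<phi> 1 = 1" "mult_ext \<phi> (embed s) = \<phi> s"
    by (auto simp: mult_ext_def)
qed

text \<open>Every \<open>x\<close> is a limit of products \<open>u * x\<close> with \<open>u\<close>
  in the range of \<open>\<phi>\<close>, even when the algebra has no unit.\<close>

lemma nondegenerate_embed_surj:
  fixes \<phi> :: "'s::cstar_algebra \<Rightarrow> 'b::cstar_algebra"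
  assumes "surj \<phi>" shows "nondegenerate_hom (embed \<circ> \<phi>)"
proof -
  interpret M: module "scaleC :: complex \<Rightarrow> 'b \<Rightarrow> 'b" by (rule module_scaleC)
  have "x \<in> closure (module.span scaleC {lact ((embed \<circ> \<phi>) s) b |s b. True})" for x
    unfolding closure_approachable
  proof (intro allI impI)
    fix e :: real assume "e > 0"
    then obtain u where u: "norm (u * x - x) < e" by (rule approx_left_unit)
    obtain s where "u = \<phi> s" using assms by (metis surjD)
    then have "u * x \<in> module.span scaleC {lact ((embed \<circ> \<phi>) s) b |s b. True}"
      by (intro M.span_base) auto
    then show "\<exists>y\<in>module.span scaleC {lact ((embed \<circ> \<phi>) s) b |s b. True}. dist y x < e"
      using u by (intro bexI[of _ "u * x"]) (simp_all add: dist_norm)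
  qed
  then show ?thesis by (auto simp: nondegenerate_hom_def)
qed

text \<open>Since \<open>\<phi>\<close> is onto, this describes the extension completely; the
  intertwining conditions of \<open>host_iso\<close> become identities between elements of the two
  algebras.\<close>

lemma mult_ext_iso:
  fixes \<phi> :: "'s::cstar_algebra \<Rightarrow> 'b::cstar_algebra"
  assumes "star_iso \<phi>"
  shows "lact (mult_ext (embed \<circ> \<phi>) m) (\<phi> s) = \<phi> (lact m s)"
proof -
  have h: "star_hom (embed \<circ> \<phi>)" "nondegenerate_hom (embed \<circ> \<phi>)"
    using assms by (auto simp: star_iso_def bij_def intro: star_hom_comp star_hom_embed nondegenerate_embed_surj)
  have "mult_ext (embed \<circ> \<phi>) m * mult_ext (embed \<circ> \<phi>) (embed s) = mult_ext (embed \<circ> \<phi>) (embed (lact m s))"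
    using star_homD(3)[OF star_hom_mult_ext[OF h]] by (metis mult_embed)
  then show ?thesis by (simp add: mult_ext_embed[OF h] mult_embed embed_inj)
qed

context hilbert_space
begin

lemma representation_comp:
  "representation H \<psi> \<Longrightarrow> star_hom h \<Longrightarrow> representation H (\<psi> \<circ> h)"
  by (rule representationI) (simp_all add: representationD star_homD)

text \<open>Matrix coefficients are complex-valued functions of the algebra element, so limits in
  the algebra can be followed without a type class topology on the carrier.\<close>

lemma bounded_linear_matrix_coeff:
  fixes \<rho> :: "'b::cstar_algebra \<Rightarrow> 'h \<Rightarrow> 'h"
  assumes r: "representation H \<rho>" and x: "x \<in> hcarrier H" and z: "z \<in> hcarrier H"
  shows "bounded_linear (\<lambda>c. hinner H (\<rho> c x) z)"
proof (rule bounded_linear_intro[where K = "hnorm H x * hnorm H z"])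
  fix c d :: 'b and t :: real
  show "hinner H (\<rho> (c + d) x) z = hinner H (\<rho> c x) z + hinner H (\<rho> d x) z"
    using x z by (simp add: representationD[OF r])
  show "hinner H (\<rho> (t *\<^sub>R c) x) z = t *\<^sub>R hinner H (\<rho> c x) z"
    using x z by (simp add: representationD[OF r] representation_scaleR[OF r] scaleR_conv_of_real)
  have "cmod (hinner H (\<rho> c x) z) \<le> hnorm H (\<rho> c x) * hnorm H z"
    by (rule Cauchy_Schwarz) (use x z representationD(2)[OF r] in auto)
  also have "\<dots> \<le> (norm c * hnorm H x) * hnorm H z"
    using z by (intro mult_right_mono representation_contractive[OF r x]) auto
  finally show "norm (hinner H (\<rho> c x) z) \<le> norm c * (hnorm H x * hnorm H z)" by (simp add: mult.assoc)
qed

lemma representation_0: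
  fixes \<rho> :: "'b::cstar_algebra \<Rightarrow> 'h \<Rightarrow> 'h"
  assumes r: "representation H \<rho>" and x: "x \<in> hcarrier H"
  shows "\<rho> 0 x = hzero H"
proof (rule hext)
  show "hinner H (\<rho> 0 x) z = hinner H (hzero H) z" if "z \<in> hcarrier H" for z
    using linear_simps(3)[OF bounded_linear_matrix_coeff[OF r x that]] that by simp
qed (use x representationD(2)[OF r] zero_closed in auto)

text \<open>The vectors \<open>\<rho> (lact (\<phi> s) b) x\<close> have trivial orthogonal
  complement because \<open>\<phi>\<close> is non-degenerate; the second claim is then uniqueness of
  extensions. With \<open>\<eta>L\<close> for \<open>\<phi>\<close> it identifies the group part of
  an induced pair as the pullback of a representation of \<L>.\<close>

lemma rep_ext_comp_nondegenerate:
  fixes \<rho> :: "'b::cstar_algebra \<Rightarrow> 'h \<Rightarrow> 'h" and \<phi> :: "'s::cstar_algebra \<Rightarrow> 'b multiplier"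
  assumes r: "\<rho> \<in> Rep H" and h: "star_hom \<phi>" "nondegenerate_hom \<phi>"
  shows "rep_ext H \<rho> \<circ> \<phi> \<in> Rep H"
    and "rep_ext H (rep_ext H \<rho> \<circ> \<phi>) = rep_ext H \<rho> \<circ> mult_ext \<phi>"
proof -
  note rr = Rep_representation[OF r]
  have rep: "representation H (rep_ext H \<rho> \<circ> \<phi>)"
    by (rule representation_comp[OF rep_ext_representation[OF r] h(1)])
  show *: "rep_ext H \<rho> \<circ> \<phi> \<in> Rep H"
    unfolding Rep_iff
  proof (intro conjI ballI impI rep)
    fix z assume z: "z \<in> hcarrier H" "\<forall>b. \<forall>x\<in>hcarrier H. hinner H z ((rep_ext H \<rho> \<circ> \<phi>) b x) = 0"
    have "hinner H (\<rho> c x) z = 0" if x: "x \<in> hcarrier H" for c x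
    proof (rule nondegenerate_induct[OF h(2), where P = "\<lambda>c. hinner H (\<rho> c x) z = 0"])
      show "closed {c. hinner H (\<rho> c x) z = 0}"
        by (intro closed_linear_eq bounded_linear_matrix_coeff[OF rr x z(1)] bounded_linear_zero)
      show "hinner H (\<rho> (lact (\<phi> s) b) x) z = 0" for s b
      proof -
        have "hinner H z (rep_ext H \<rho> (\<phi> s) (\<rho> b x)) = 0" using z(2) representationD(2)[OF rr x] by simp
        then have "hinner H z (\<rho> (lact (\<phi> s) b) x) = 0"
          by (simp add: representation_embed_mult[OF rep_ext_representation[OF r] rep_ext_embed[OF r] x])
        then show ?thesis using ip_commute[OF representationD(2)[OF rr x] z(1)] by simp
      qed
    qed (use x z in \<open>simp_all add: representationD[OF rr] representation_0[OF rr]\<close>)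
    then show "z = hzero H"
      using r z(1) representationD(2)[OF rr] ip_commute[OF z(1)] unfolding Rep_iff by simp
  qed
  show "rep_ext H (rep_ext H \<rho> \<circ> \<phi>) = rep_ext H \<rho> \<circ> mult_ext \<phi>"
    by (rule rep_ext_eqI[OF *])
       (simp_all add: representation_comp rep_ext_representation[OF r] star_hom_mult_ext[OF h] mult_ext_embed[OF h])
qed

end

section \<open>Comparison of two crossed product hosts\<close>

lemma crossed_product_hostD:
  assumes "crossed_product_host \<alpha> \<eta> \<eta>A \<eta>L"
  shows "star_hom \<eta>A" "star_hom \<eta>L" "nondegenerate_hom \<eta>L"
    "mult_ext \<eta>L (\<eta> g) * \<eta>A A * star (mult_ext \<eta>L (\<eta> g)) = \<eta>A (\<alpha> g A)"
    "\<exists>c. embed c = \<eta>A A * \<eta>L L"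
  using assms unfolding crossed_product_host_def by (auto simp: image_iff) metis

lemma crossed_product_host_induct:
  fixes \<eta>A :: "'a::cstar_algebra \<Rightarrow> 'c::cstar_algebra multiplier"
  assumes "crossed_product_host \<alpha> \<eta> \<eta>A \<eta>L"
    and "closed {c. P c}" "P 0" "\<And>x y. P x \<Longrightarrow> P y \<Longrightarrow> P (x + y)" "\<And>x y. P x \<Longrightarrow> P y \<Longrightarrow> P (x * y)"
      "\<And>a x. P x \<Longrightarrow> P (a *\<^sub>C x)" "\<And>x. P x \<Longrightarrow> P (star x)"
      "\<And>A L c. embed c = \<eta>A A * \<eta>L L \<Longrightarrow> P c"
  shows "P c"
proof -
  have "cstar_subalgebra hull {c. \<exists>A L. embed c = \<eta>A A * \<eta>L L} \<subseteq> {c. P c}"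
    by (rule hull_minimal) (use assms(2-) in \<open>auto simp: cstar_subalgebra_def\<close>)
  then show ?thesis using assms(1) by (auto simp: crossed_product_host_def)
qed

text \<open>The graph of the intended isomorphism, as the smallest relation that contains the pairs
  of generators and respects the operations and limits. A relation is needed at first because an
  element may be expressed by generators in many ways.\<close>

inductive host_rel for \<eta>A :: "'a \<Rightarrow> 'c::cstar_algebra multiplier" and \<eta>L :: "'l \<Rightarrow> 'c multiplier"
    and \<eta>A' :: "'a \<Rightarrow> 'd::cstar_algebra multiplier" and \<eta>L' :: "'l \<Rightarrow> 'd multiplier" where
  gen: "embed c = \<eta>A A * \<eta>L L \<Longrightarrow> embed d = \<eta>A' A * \<eta>L' L \<Longrightarrow> host_rel \<eta>A \<eta>L \<eta>A' \<eta>L' c d"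
| zero: "host_rel \<eta>A \<eta>L \<eta>A' \<eta>L' 0 0"
| add: "host_rel \<eta>A \<eta>L \<eta>A' \<eta>L' c d \<Longrightarrow> host_rel \<eta>A \<eta>L \<eta>A' \<eta>L' c' d' \<Longrightarrow>
    host_rel \<eta>A \<eta>L \<eta>A' \<eta>L' (c + c') (d + d')"
| mult: "host_rel \<eta>A \<eta>L \<eta>A' \<eta>L' c d \<Longrightarrow> host_rel \<eta>A \<eta>L \<eta>A' \<eta>L' c' d' \<Longrightarrow>
    host_rel \<eta>A \<eta>L \<eta>A' \<eta>L' (c * c') (d * d')"
| scale: "host_rel \<eta>A \<eta>L \<eta>A' \<eta>L' c d \<Longrightarrow> host_rel \<eta>A \<eta>L \<eta>A' \<eta>L' (a *\<^sub>C c) (a *\<^sub>C d)"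
| star: "host_rel \<eta>A \<eta>L \<eta>A' \<eta>L' c d \<Longrightarrow> host_rel \<eta>A \<eta>L \<eta>A' \<eta>L' (star c) (star d)"
| lim: "(\<And>n :: nat. host_rel \<eta>A \<eta>L \<eta>A' \<eta>L' (X n) (Y n)) \<Longrightarrow> X \<longlonglongrightarrow> c \<Longrightarrow> Y \<longlonglongrightarrow> d \<Longrightarrow>
    host_rel \<eta>A \<eta>L \<eta>A' \<eta>L' c d"

lemma host_rel_sym: "host_rel \<eta>A \<eta>L \<eta>A' \<eta>L' c d \<Longrightarrow> host_rel \<eta>A' \<eta>L' \<eta>A \<eta>L d c"
  by (induction rule: host_rel.induct) (blast intro: host_rel.intros)+

lemma host_rel_diff:
  "host_rel \<eta>A \<eta>L \<eta>A' \<eta>L' c d \<Longrightarrow> host_rel \<eta>A \<eta>L \<eta>A' \<eta>L' c' d' \<Longrightarrow>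
    host_rel \<eta>A \<eta>L \<eta>A' \<eta>L' (c - c') (d - d')"
  using host_rel.add[OF _ host_rel.scale[of _ _ _ _ c' d' "-1"], of \<eta>A \<eta>L \<eta>A' \<eta>L' c d] by (simp add: scaleC_minus_one)

definition rep_match where
  "rep_match \<eta>A \<eta>L \<eta>A' \<eta>L' \<rho> \<rho>' \<longleftrightarrow>
    (\<forall>A L c d. embed c = \<eta>A A * \<eta>L L \<longrightarrow> embed d = \<eta>A' A * \<eta>L' L \<longrightarrow> \<rho> c = \<rho>' d)"

text \<open>The vector is generalized because a product needs the induction hypothesis at an image
  vector. Adjoints are handled by moving them across the inner product, limits by continuity of
  matrix coefficients.\<close>

lemma (in hilbert_space) host_rel_rep:
  assumes R: "host_rel \<eta>A \<eta>L \<eta>A' \<eta>L' c d"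
    and r: "representation H \<rho>" "representation H \<rho>'" and m: "rep_match \<eta>A \<eta>L \<eta>A' \<eta>L' \<rho> \<rho>'"
    and x: "x \<in> hcarrier H"
  shows "\<rho> c x = \<rho>' d x"
  using R x
proof (induction arbitrary: x rule: host_rel.induct)
  case (gen c A L d)
  then show ?case using m unfolding rep_match_def by metis
next
  case (star c d)
  note R = representationD[OF r(1)] representationD[OF r(2)]
  show ?case
  proof (rule hext)
    fix z assume z: "z \<in> hcarrier H"
    show "hinner H (\<rho> (star c) x) z = hinner H (\<rho>' (star d) x) z"
      using R(6)[OF star.prems z, of "star c"] R(12)[OF star.prems z, of "star d"] star.IH[OF z] by (simp add: star_star)
  qed (use R star.prems in auto)
next
  case (lim X Y c d)
  show ?case
  proof (rule hext)
    fix z assume z: "z \<in> hcarrier H"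
    have "(\<lambda>n. hinner H (\<rho> (X n) x) z) \<longlonglongrightarrow> hinner H (\<rho> c x) z"
      by (rule bounded_linear.tendsto[OF bounded_linear_matrix_coeff[OF r(1) lim.prems z] lim.hyps(2)])
    moreover have "(\<lambda>n. hinner H (\<rho>' (Y n) x) z) \<longlonglongrightarrow> hinner H (\<rho>' d x) z"
      by (rule bounded_linear.tendsto[OF bounded_linear_matrix_coeff[OF r(2) lim.prems z] lim.hyps(3)])
    ultimately show "hinner H (\<rho> c x) z = hinner H (\<rho>' d x) z"
      using lim.IH[OF lim.prems] by (simp add: LIMSEQ_unique)
  qed (use representationD(2)[OF r(1)] representationD(2)[OF r(2)] lim.prems in auto)
qed (use representation_0[OF r(1)] representation_0[OF r(2)] in
    \<open>simp_all add: representationD[OF r(1)] representationD[OF r(2)]\<close>)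

text \<open>A GNS representation of the first host attains \<open>norm c\<close>, and its match is
  contractive on the second. The match is asked to be a representation, which is what (CP5)
  supplies.\<close>

lemma host_rel_norm_le:
  fixes \<eta>A :: "'a \<Rightarrow> 'c::cstar_algebra multiplier" and \<eta>L :: "'l \<Rightarrow> 'c multiplier"
    and \<eta>A' :: "'a \<Rightarrow> 'd::cstar_algebra multiplier" and \<eta>L' :: "'l \<Rightarrow> 'd multiplier"
  assumes u: "hilbert_universe TYPE('h) TYPE('c)"
    and m: "\<And>(H :: 'h hilbert) \<rho>. hilbert_space H \<Longrightarrow> \<rho> \<in> Rep H \<Longrightarrow>
      \<exists>\<rho>'. representation H \<rho>' \<and> rep_match \<eta>A \<eta>L \<eta>A' \<eta>L' \<rho> \<rho>'"
    and R: "host_rel \<eta>A \<eta>L \<eta>A' \<eta>L' c d"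
  shows "norm c \<le> norm d"
proof (cases "c = 0")
  case False
  obtain f :: "(nat \<Rightarrow> 'c) \<Rightarrow> 'h" where "inj f" using u by (auto simp: hilbert_universe_def)
  then obtain H :: "'h hilbert" and \<rho> :: "'c \<Rightarrow> 'h \<Rightarrow> 'h" and x where
    H: "hilbert_space H" and \<rho>: "\<rho> \<in> Rep H" and x: "x \<in> hcarrier H" "0 < hnorm H x"
      "norm c * hnorm H x \<le> hnorm H (\<rho> c x)"
    by (rule GNS_norming[OF _ False])
  interpret hilbert_space H by (rule H)
  obtain \<rho>' where \<rho>': "representation H \<rho>'" "rep_match \<eta>A \<eta>L \<eta>A' \<eta>L' \<rho> \<rho>'" using m[OF H \<rho>] by blast
  have "\<rho> c x = \<rho>' d x" by (rule host_rel_rep[OF R Rep_representation[OF \<rho>] \<rho>' x(1)])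
  then have "norm c * hnorm H x \<le> norm d * hnorm H x"
    using x(3) representation_contractive[OF \<rho>'(1) x(1), of d] by simp
  then show ?thesis using x(2) by simp
qed simp

section \<open>Construction and uniqueness of the isomorphism\<close>

lemma bounded_linear_star_hom:
  fixes \<phi> :: "'a::cstar_algebra \<Rightarrow> 'b::cstar_algebra"
  assumes "star_hom \<phi>" shows "bounded_linear \<phi>"
  by (rule bounded_linear_intro[where K = 1])
     (simp_all add: star_homD[OF assms] scaleR_scaleC star_hom_contractive[OF assms])

text \<open>Products \<open>\<beta> b * \<alpha> a\<close> are approximated by \<open>\<beta> (u * b) * \<alpha> a\<close>, on which \<open>\<alpha> a0\<close> acts through the
  controlled element \<open>\<alpha> a0 * \<beta> u\<close>.\<close>

lemma star_hom_intertwines_left: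
  fixes \<phi> :: "'c::cstar_algebra \<Rightarrow> 'd::cstar_algebra"
    and \<alpha> :: "'a::cstar_algebra \<Rightarrow> 'c multiplier" and \<beta> :: "'b::cstar_algebra \<Rightarrow> 'c multiplier"
  assumes \<phi>: "star_hom \<phi>" and h: "star_hom \<alpha>" "star_hom \<beta>" "star_hom \<alpha>'" "star_hom \<beta>'"
    and ab: "\<And>a b. \<exists>c. embed c = \<alpha> a * \<beta> b \<and> embed (\<phi> c) = \<alpha>' a * \<beta>' b"
    and c: "embed c = \<alpha> a * \<beta> b \<or> embed c = \<beta> b * \<alpha> a"
  shows "\<phi> (lact (\<alpha> a0) c) = lact (\<alpha>' a0) (\<phi> c)"
proof -
  have AB: "embed (\<phi> c) = \<alpha>' a * \<beta>' b" if "embed c = \<alpha> a * \<beta> b" for c a b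
    using ab[of a b] that embed_inj by metis
  \<comment> \<open>Products in the opposite order are adjoints of products in the given
    order.\<close>
  have BA: "embed (\<phi> c) = \<beta>' b * \<alpha>' a" if e: "embed c = \<beta> b * \<alpha> a" for c a b
  proof -
    have "embed (star c) = \<alpha> (star a) * \<beta> (star b)" by (simp add: embed_star e star_mult star_homD[OF h(1)] star_homD[OF h(2)])
    then have "star (embed (\<phi> (star c))) = star (\<alpha>' (star a) * \<beta>' (star b))" by (simp only: AB)
    then show ?thesis
      by (simp add: star_homD[OF \<phi>] star_homD[OF h(3)] star_homD[OF h(4)] star_mult star_star embed_star)
  qed
  have "\<phi> (lact (\<alpha> a0) c) = lact (\<alpha>' a0) (\<phi> c)" if e: "embed c = \<alpha> a * \<beta> b"
  proof -
    have "embed (lact (\<alpha> a0) c) = \<alpha> (a0 * a) * \<beta> b"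
      by (simp add: e star_homD[OF h(1)] mult.assoc flip: mult_embed)
    from AB[OF this] have "embed (\<phi> (lact (\<alpha> a0) c)) = embed (lact (\<alpha>' a0) (\<phi> c))"
      by (simp add: AB[OF e] star_homD[OF h(3)] mult.assoc flip: mult_embed)
    then show ?thesis by (simp add: embed_inj)
  qed
  moreover have "\<phi> (lact (\<alpha> a0) c) = lact (\<alpha>' a0) (\<phi> c)" if e: "embed c = \<beta> b * \<alpha> a"
  proof -
    define Q where "Q = {c. \<phi> (lact (\<alpha> a0) c) = lact (\<alpha>' a0) (\<phi> c)}"
    have "closed Q"
      unfolding Q_def
      by (intro closed_linear_eq bounded_linear_compose[OF bounded_linear_star_hom[OF \<phi>]]
          bounded_linear_compose[OF bounded_linear_lact] bounded_linear_lact bounded_linear_star_hom \<phi>)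
    moreover have "\<exists>y\<in>Q. dist y c < r" if r: "r > 0" for r
    proof -
      have "0 < r / (norm a + 1)" using r by (simp add: add_nonneg_pos)
      then obtain u where u: "norm (u * b - b) < r / (norm a + 1)" by (rule approx_left_unit)
      define cu where "cu = lact (\<beta> u) c"
      have ecu: "embed cu = \<beta> (u * b) * \<alpha> a"
        by (simp add: cu_def e star_homD[OF h(2)] mult.assoc flip: mult_embed)
      \<comment> \<open>In \<open>\<alpha> a0 * \<beta> (u * b) * \<alpha> a\<close> the first two
        factors regroup as the algebra element \<open>p\<close> times \<open>c\<close>, and
        multiplicativity of \<open>\<phi>\<close> applies.\<close>
      obtain p where p: "embed p = \<alpha> a0 * \<beta> u" "embed (\<phi> p) = \<alpha>' a0 * \<beta>' u" using ab by blast
      have "embed (lact (\<alpha> a0) cu) = embed (p * c)"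
        by (simp add: ecu e p embed_mult star_homD[OF h(2)] mult.assoc flip: mult_embed)
      then have "\<phi> (lact (\<alpha> a0) cu) = \<phi> p * \<phi> c" by (simp add: embed_inj star_homD[OF \<phi>])
      then have "embed (\<phi> (lact (\<alpha> a0) cu)) = embed (lact (\<alpha>' a0) (\<phi> cu))"
        by (simp add: BA[OF ecu] BA[OF e] p embed_mult star_homD[OF h(4)] mult.assoc flip: mult_embed)
      then have "cu \<in> Q" by (simp add: Q_def embed_inj)
      moreover have "dist cu c < r"
      proof -
        have "embed (cu - c) = \<beta> (u * b - b) * \<alpha> a"
          using ecu e star_hom_diff[OF star_hom_embed, of cu c]
          by (simp add: star_hom_diff[OF h(2)] left_diff_distrib)
        then have "norm (cu - c) = norm (\<beta> (u * b - b) * \<alpha> a)" by (metis norm_embed)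
        also have "\<dots> \<le> norm (\<beta> (u * b - b)) * norm (\<alpha> a)" by (rule norm_mult_ineq)
        also have "\<dots> \<le> norm (u * b - b) * norm a"
          by (intro mult_mono star_hom_contractive h) auto
        also have "\<dots> \<le> norm (u * b - b) * (norm a + 1)" by (intro mult_left_mono) auto
        also have "\<dots> < r / (norm a + 1) * (norm a + 1)"
          using u by (intro mult_strict_right_mono) (auto simp: add_nonneg_pos)
        also have "\<dots> = r" using add_nonneg_pos[of "norm a" 1] by simp
        finally show ?thesis by (simp add: dist_norm)
      qed
      ultimately show ?thesis by blast
    qed
    ultimately have "c \<in> Q" by (metis closed_approachable)
    then show ?thesis by (simp add: Q_def)
  qed
  ultimately show ?thesis using c by blast
qed

text \<open>Related pairs can be subtracted, so equality of norms makes \<open>host_rel\<close>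
  single-valued and injective, and makes its domain closed. As the domain contains the generators,
  it is the whole algebra.\<close>

lemma host_iso_exists:
  fixes \<eta>A :: "'a::cstar_algebra \<Rightarrow> 'c::cstar_algebra multiplier" and \<eta>L :: "'l::cstar_algebra \<Rightarrow> 'c multiplier"
    and \<eta>A' :: "'a \<Rightarrow> 'd::cstar_algebra multiplier" and \<eta>L' :: "'l \<Rightarrow> 'd multiplier"
  assumes C: "crossed_product_host \<alpha> \<eta> \<eta>A \<eta>L" and D: "crossed_product_host \<alpha> \<eta> \<eta>A' \<eta>L'"
    and iso: "\<And>c d. host_rel \<eta>A \<eta>L \<eta>A' \<eta>L' c d \<Longrightarrow> norm c = norm d"
  shows "\<exists>\<phi>. host_iso \<eta>A \<eta>L \<eta>A' \<eta>L' \<phi>"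
proof -
  note hC = crossed_product_hostD[OF C] and hD = crossed_product_hostD[OF D]
  \<comment> \<open>Stated over fresh types so that it also applies with the two hosts exchanged,
    which gives surjectivity. The domain is closed because partners of a convergent sequence form a
    Cauchy sequence.\<close>
  have total: "\<exists>d. host_rel \<eta>A \<eta>L \<eta>A' \<eta>L' c d"
    if C: "crossed_product_host \<alpha> \<eta> \<eta>A \<eta>L" and D: "crossed_product_host \<alpha> \<eta> \<eta>A' \<eta>L'"
      and iso: "\<And>c d. host_rel \<eta>A \<eta>L \<eta>A' \<eta>L' c d \<Longrightarrow> norm c = norm d"
    for \<eta>A :: "'a \<Rightarrow> 'e::cstar_algebra multiplier" and \<eta>L :: "'l \<Rightarrow> 'e multiplier"
      and \<eta>A' :: "'a \<Rightarrow> 'f::cstar_algebra multiplier" and \<eta>L' :: "'l \<Rightarrow> 'f multiplier" and c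
  proof (rule crossed_product_host_induct[OF C, where P = "\<lambda>c. \<exists>d. host_rel \<eta>A \<eta>L \<eta>A' \<eta>L' c d"])
    show "closed {c. \<exists>d. host_rel \<eta>A \<eta>L \<eta>A' \<eta>L' c d}"
      unfolding closed_sequential_limits
    proof (intro allI impI, elim conjE)
      fix X c assume "\<forall>n. X n \<in> {c. \<exists>d. host_rel \<eta>A \<eta>L \<eta>A' \<eta>L' c d}" and X: "X \<longlonglongrightarrow> c"
      then have "\<forall>n. \<exists>d. host_rel \<eta>A \<eta>L \<eta>A' \<eta>L' (X n) d" by simp
      then obtain Y where Y: "\<And>n. host_rel \<eta>A \<eta>L \<eta>A' \<eta>L' (X n) (Y n)" by metis
      have "dist (Y m) (Y n) = dist (X m) (X n)" for m n
        using iso[OF host_rel_diff[OF Y Y]] by (simp add: dist_norm)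
      then have "Cauchy Y" using LIMSEQ_imp_Cauchy[OF X] by (simp add: Cauchy_def)
      then have "convergent Y" by (rule Cauchy_convergent)
      then obtain d where d: "Y \<longlonglongrightarrow> d" by (auto simp: convergent_def)
      have "host_rel \<eta>A \<eta>L \<eta>A' \<eta>L' c d" by (rule host_rel.lim[OF Y X d])
      then show "c \<in> {c. \<exists>d. host_rel \<eta>A \<eta>L \<eta>A' \<eta>L' c d}" by blast
    qed
    show "\<exists>d. host_rel \<eta>A \<eta>L \<eta>A' \<eta>L' c d" if "embed c = \<eta>A A * \<eta>L L" for A L c
      using host_rel.gen[of c \<eta>A A \<eta>L L _ \<eta>A' \<eta>L'] that crossed_product_hostD(5)[OF D, of A L] by blast
  qed (blast intro: host_rel.intros)+
  have unique: "d = d'" if "host_rel \<eta>A \<eta>L \<eta>A' \<eta>L' c d" "host_rel \<eta>A \<eta>L \<eta>A' \<eta>L' c d'" for c d d'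
    using iso[OF host_rel_diff[OF that]] by simp
  have "\<forall>c. \<exists>d. host_rel \<eta>A \<eta>L \<eta>A' \<eta>L' c d" using total[OF C D iso] by blast
  then obtain \<phi> where \<phi>: "\<And>c. host_rel \<eta>A \<eta>L \<eta>A' \<eta>L' c (\<phi> c)" by metis
  have eq: "\<phi> c = d" if "host_rel \<eta>A \<eta>L \<eta>A' \<eta>L' c d" for c d by (rule unique[OF \<phi> that])
  have hom: "star_hom \<phi>"
    unfolding star_hom_def
    by (intro conjI allI eq host_rel.add host_rel.mult host_rel.scale host_rel.star \<phi>)
  have "inj \<phi>"
  proof (rule injI)
    fix c c' assume "\<phi> c = \<phi> c'"
    then show "c = c'" using iso[OF host_rel_diff[OF \<phi> \<phi>], of c c'] by simp
  qed
  moreover have surj: "surj \<phi>"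
  proof -
    have "\<exists>c. host_rel \<eta>A' \<eta>L' \<eta>A \<eta>L d c" for d
      by (rule total[OF D C]) (rule iso[OF host_rel_sym, symmetric])
    then show ?thesis unfolding surj_def using eq host_rel_sym by metis
  qed
  ultimately have iso': "star_iso \<phi>" using hom by (simp add: star_iso_def bij_def)
  have gens: "\<exists>c. embed c = \<eta>A A * \<eta>L L \<and> embed (\<phi> c) = \<eta>A' A * \<eta>L' L" for A L
    using hC(5)[of A L] hD(5)[of A L] eq host_rel.gen by metis
  have gens': "\<exists>c. embed c = \<eta>L L * \<eta>A A \<and> embed (\<phi> c) = \<eta>L' L * \<eta>A' A" for A L
  proof -
    obtain c where c: "embed c = \<eta>A (star A) * \<eta>L (star L)" "embed (\<phi> c) = \<eta>A' (star A) * \<eta>L' (star L)"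
      using gens by blast
    then show ?thesis
      by (intro exI[of _ "star c"])
         (simp add: star_homD[OF hom] embed_star star_mult star_star
           star_homD[OF hC(1)] star_homD[OF hC(2)] star_homD[OF hD(1)] star_homD[OF hD(2)])
  qed
  have ext: "\<phi> (lact (m a) c) = lact (m' a) (\<phi> c)"
    if m: "\<And>A L c a. embed c = \<eta>A A * \<eta>L L \<or> embed c = \<eta>L L * \<eta>A A \<Longrightarrow> \<phi> (lact (m a) c) = lact (m' a) (\<phi> c)"
    for m :: "'i \<Rightarrow> 'c multiplier" and m' a c
  proof -
    \<comment> \<open>Left multiplication by \<open>m a\<close> passes through sums and products but
      not through \<open>star\<close>, so the claim for \<open>star c\<close> is carried along; this
      is why \<open>m\<close> must hold for generators in both orders.\<close>
    have "(\<phi> (lact (m a) c) = lact (m' a) (\<phi> c)) \<and> (\<phi> (lact (m a) (star c)) = lact (m' a) (\<phi> (star c)))"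
    proof (rule crossed_product_host_induct[OF C, where P = "\<lambda>c.
        (\<phi> (lact (m a) c) = lact (m' a) (\<phi> c)) \<and> (\<phi> (lact (m a) (star c)) = lact (m' a) (\<phi> (star c)))"])
      show "closed {c. \<phi> (lact (m a) c) = lact (m' a) (\<phi> c) \<and> \<phi> (lact (m a) (star c)) = lact (m' a) (\<phi> (star c))}"
        by (intro closed_Collect_conj closed_linear_eq bounded_linear_compose[OF bounded_linear_star_hom[OF hom]]
            bounded_linear_compose[OF bounded_linear_lact] bounded_linear_lact bounded_linear_star_hom hom bounded_linear_star)
      show "\<phi> (lact (m a) c) = lact (m' a) (\<phi> c) \<and> \<phi> (lact (m a) (star c)) = lact (m' a) (\<phi> (star c))"
        if e: "embed c = \<eta>A A * \<eta>L L" for A L c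
      proof -
        have "embed (star c) = \<eta>L (star L) * \<eta>A (star A)"
          by (simp add: embed_star e star_mult star_homD[OF hC(1)] star_homD[OF hC(2)])
        then show ?thesis using m e by blast
      qed
      have "\<phi> 0 = 0" using star_homD(1)[OF hom, of 0 0] by simp
      then show "\<phi> (lact (m a) 0) = lact (m' a) (\<phi> 0) \<and> \<phi> (lact (m a) (star 0)) = lact (m' a) (\<phi> (star 0))" by simp
    qed (auto simp: lact_add lact_mult lact_scaleC star_homD(1-3)[OF hom] star_add star_mult star_scaleC star_star)
    then show ?thesis by blast
  qed
  have extA: "\<phi> (lact (\<eta>A A) c) = lact (\<eta>A' A) (\<phi> c)" for A c
    by (rule ext) (erule star_hom_intertwines_left[OF hom hC(1,2) hD(1,2) gens])
  \<comment> \<open>The roles of the two structure maps are exchanged, so the products needed are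
    those of \<open>gens'\<close>.\<close>
  have extL: "\<phi> (lact (\<eta>L L) c) = lact (\<eta>L' L) (\<phi> c)" for L c
    by (rule ext) (rule star_hom_intertwines_left[OF hom hC(2,1) hD(2,1) gens'], blast)
  have "mult_ext (embed \<circ> \<phi>) m = m'" if "\<And>c. \<phi> (lact m c) = lact m' (\<phi> c)" for m m'
  proof (rule multiplier_eqI)
    fix d
    obtain c where "d = \<phi> c" using surj by (metis surjD)
    then show "lact (mult_ext (embed \<circ> \<phi>) m) d = lact m' d" by (simp add: mult_ext_iso[OF iso'] that)
  qed
  then have "host_iso \<eta>A \<eta>L \<eta>A' \<eta>L' \<phi>" using extA extL iso' by (auto simp: host_iso_def fun_eq_iff)
  then show ?thesis by blast
qed

text \<open>The extension is multiplicative, so the intertwining conditions force the value on each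
  \<open>\<eta>A A * \<eta>L L\<close>; two such isomorphisms agree on a closed subalgebra stable
  under \<open>star\<close>.\<close>

lemma host_iso_unique:
  fixes \<eta>A :: "'a::cstar_algebra \<Rightarrow> 'c::cstar_algebra multiplier" and \<eta>L :: "'l::cstar_algebra \<Rightarrow> 'c multiplier"
    and \<eta>A' :: "'a \<Rightarrow> 'd::cstar_algebra multiplier" and \<eta>L' :: "'l \<Rightarrow> 'd multiplier"
  assumes C: "crossed_product_host \<alpha> \<eta> \<eta>A \<eta>L"
    and i: "host_iso \<eta>A \<eta>L \<eta>A' \<eta>L' \<phi>" "host_iso \<eta>A \<eta>L \<eta>A' \<eta>L' \<phi>'"
  shows "\<phi> = \<phi>'"
proof
  have hom: "star_hom \<phi>" "star_hom \<phi>'" using i by (auto simp: host_iso_def star_iso_def)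
  have gen: "embed (\<phi> c) = \<eta>A' A * \<eta>L' L"
    if i: "host_iso \<eta>A \<eta>L \<eta>A' \<eta>L' \<phi>" and e: "embed c = \<eta>A A * \<eta>L L" for \<phi> c A L
  proof -
    have h: "star_hom (embed \<circ> \<phi>)" "nondegenerate_hom (embed \<circ> \<phi>)"
      using i by (auto simp: host_iso_def star_iso_def bij_def intro: star_hom_comp star_hom_embed nondegenerate_embed_surj)
    have "embed (\<phi> c) = mult_ext (embed \<circ> \<phi>) (embed c)" using mult_ext_embed[OF h] by simp
    also have "\<dots> = \<eta>A' A * \<eta>L' L"
      unfolding e star_homD(3)[OF star_hom_mult_ext[OF h]] using i by (auto simp: host_iso_def fun_eq_iff)
    finally show ?thesis .
  qed
  show "\<phi> c = \<phi>' c" for c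
  proof (rule crossed_product_host_induct[OF C, where P = "\<lambda>c. \<phi> c = \<phi>' c"])
    show "closed {c. \<phi> c = \<phi>' c}" by (intro closed_linear_eq bounded_linear_star_hom hom)
    show "\<phi> 0 = \<phi>' 0" using star_homD(1)[OF hom(1), of 0 0] star_homD(1)[OF hom(2), of 0 0] by simp
    show "\<phi> c = \<phi>' c" if "embed c = \<eta>A A * \<eta>L L" for A L c
      using gen[OF i(1) that] gen[OF i(2) that] embed_inj[of "\<phi> c" "\<phi>' c"] by simp
  qed (simp_all add: star_homD[OF hom(1)] star_homD[OF hom(2)])
qed

section \<open>Covariance of the induced pairs\<close>

context hilbert_space
begin

lemma projection_op:
  assumes M: "closed_subspace M"
  obtains P where "\<And>x. x \<in> hcarrier H \<Longrightarrow> P x \<in> M" "\<And>x. x \<in> M \<Longrightarrow> P x = x"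
    "\<And>x y. x \<in> hcarrier H \<Longrightarrow> y \<in> hcarrier H \<Longrightarrow> hinner H (P x) y = hinner H x (P y)"
    "\<And>x y. x \<in> hcarrier H \<Longrightarrow> y \<in> M \<Longrightarrow> hinner H (P x) y = hinner H x y"
proof -
  have Mc: "y \<in> hcarrier H" if "y \<in> M" for y using that M by (auto simp: closed_subspace_def hsubspace_def)
  have "\<forall>x\<in>hcarrier H. \<exists>p\<in>M. \<forall>y\<in>M. hinner H (hsub x p) y = 0"
    using projection[OF M] by metis
  then obtain P where P: "\<And>x. x \<in> hcarrier H \<Longrightarrow> P x \<in> M"
    "\<And>x y. x \<in> hcarrier H \<Longrightarrow> y \<in> M \<Longrightarrow> hinner H (hsub x (P x)) y = 0" by metis
  have 4: "hinner H (P x) y = hinner H x y" if "x \<in> hcarrier H" "y \<in> M" for x y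
    using P(2)[OF that] P(1)[OF that(1)] that Mc by simp
  have 3: "hinner H (P x) y = hinner H x (P y)" if x: "x \<in> hcarrier H" and y: "y \<in> hcarrier H" for x y
  proof -
    have "hinner H (P y) (P x) = hinner H y (P x)" by (rule 4[OF y P(1)[OF x]])
    then have "hinner H (P x) (P y) = hinner H (P x) y"
      using ip_commute[OF Mc[OF P(1)[OF x]] Mc[OF P(1)[OF y]]] ip_commute[OF Mc[OF P(1)[OF x]] y] by simp
    then show ?thesis using 4[OF x P(1)[OF y]] by simp
  qed
  have 2: "P x = x" if x: "x \<in> M" for x
  proof (rule hnorm_sub_eq_0D[symmetric])
    have "hsub x (P x) \<in> M" using x P(1)[OF Mc[OF x]] M by (simp add: closed_subspace_def hsubspace_def)
    then have "hinner H (hsub x (P x)) (hsub x (P x)) = 0" by (rule P(2)[OF Mc[OF x]])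
    then show "hnorm H (hsub x (P x)) = 0" by (simp add: hnorm_def)
  qed (use x Mc P(1) in auto)
  show ?thesis by (rule that[OF P(1) 2 3 4])
qed

lemma bounded_ops_comp:
  assumes S: "S \<in> bounded_ops H" and T: "T \<in> bounded_ops H"
  shows "op_mult H S T \<in> bounded_ops H"
proof -
  obtain K where K: "0 \<le> K" "\<And>x. x \<in> hcarrier H \<Longrightarrow> hnorm H (S x) \<le> K * hnorm H x"
    using bounded_ops_bound[OF S] by blast
  obtain K' where K': "0 \<le> K'" "\<And>x. x \<in> hcarrier H \<Longrightarrow> hnorm H (T x) \<le> K' * hnorm H x"
    using bounded_ops_bound[OF T] by blast
  have "hnorm H (S (T x)) \<le> (K * K') * hnorm H x" if "x \<in> hcarrier H" for x
    using K(2)[OF bounded_opsD(1)[OF T that]] mult_left_mono[OF K'(2)[OF that] K(1)] by simp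
  then show ?thesis
    unfolding bounded_ops_def
    by (auto simp: compose_def bounded_opsD[OF S] bounded_opsD[OF T])
qed

text \<open>\<open>W\<close> is a self-adjoint involution, hence its own inverse and adjoint, so
  conjugation by it respects products and adjoints.\<close>

lemma symmetry_conjugate_representation:
  assumes W: "W \<in> bounded_ops H" "\<And>x y. x \<in> hcarrier H \<Longrightarrow> y \<in> hcarrier H \<Longrightarrow> hinner H (W x) y = hinner H x (W y)"
      "\<And>x. x \<in> hcarrier H \<Longrightarrow> W (W x) = x"
    and r: "representation H \<psi>"
  shows "representation H (\<lambda>b. op_mult H (op_mult H W (\<psi> b)) W)"
proof (rule representationI)
  show "op_mult H (op_mult H W (\<psi> b)) W \<in> bounded_ops H" for b
    by (intro bounded_ops_comp W(1) representationD(1)[OF r])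
qed (simp_all add: representationD[OF r] compose_def bounded_opsD[OF W(1)] W(2,3))

lemma hadd_hzero_hzero [simp]: "hadd H (hzero H) (hzero H) = hzero H"
  by (rule add_zero[OF zero_closed])

lemma hscale_hzero [simp]: "hscale H a (hzero H) = hzero H"
  by (rule hext) (simp_all add: zero_closed)

text \<open>Linearity is deduced rather than assumed of \<open>P\<close>: a symmetric map defined on
  the whole space is linear by \<open>hext\<close>. Boundedness comes from \<open>W\<close>
  preserving inner products.\<close>

lemma reflection_op:
  assumes P: "\<And>x. x \<in> hcarrier H \<Longrightarrow> P x \<in> hcarrier H" "\<And>x. x \<in> hcarrier H \<Longrightarrow> P (P x) = P x"
    and sa: "\<And>x y. x \<in> hcarrier H \<Longrightarrow> y \<in> hcarrier H \<Longrightarrow> hinner H (P x) y = hinner H x (P y)"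
  defines "W \<equiv> \<lambda>x\<in>hcarrier H. hadd H x (hscale H (-2) (P x))"
  shows "W \<in> bounded_ops H" "\<And>x y. x \<in> hcarrier H \<Longrightarrow> y \<in> hcarrier H \<Longrightarrow> hinner H (W x) y = hinner H x (W y)"
    "\<And>x. x \<in> hcarrier H \<Longrightarrow> W (W x) = x"
proof -
  have Wc: "W x \<in> hcarrier H" if "x \<in> hcarrier H" for x using that P by (simp add: W_def)
  show Ws: "hinner H (W x) y = hinner H x (W y)" if "x \<in> hcarrier H" "y \<in> hcarrier H" for x y
    using that P sa by (simp add: W_def)
  have PP: "hinner H (P x) (P y) = hinner H x (P y)" if "x \<in> hcarrier H" "y \<in> hcarrier H" for x y
    using sa[OF that(1) P(1)[OF that(2)]] P(2)[OF that(2)] by simp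
  have WW: "hinner H (W x) (W y) = hinner H x y" if "x \<in> hcarrier H" "y \<in> hcarrier H" for x y
    using that P PP sa by (simp add: W_def)
  show "W (W x) = x" if "x \<in> hcarrier H" for x
    by (rule hext) (use that Wc Ws WW in auto)
  have nW: "hnorm H (W x) = hnorm H x" if "x \<in> hcarrier H" for x
    using WW[OF that that] by (simp add: hnorm_def)
  show "W \<in> bounded_ops H"
    unfolding bounded_ops_def
  proof (intro CollectI conjI ballI allI exI)
    show "W \<in> hcarrier H \<rightarrow>\<^sub>E hcarrier H" using Wc by (auto simp: W_def)
    fix x assume x: "x \<in> hcarrier H"
    show "hnorm H (W x) \<le> 1 * hnorm H x" using nW[OF x] by simp
    show "W (hscale H c x) = hscale H c (W x)" for c
      by (rule hext) (use x Wc Ws scale_closed in auto)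
    show "W (hadd H x y) = hadd H (W x) (W y)" if "y \<in> hcarrier H" for y
      by (rule hext) (use x that Wc Ws add_closed in auto)
  qed
qed

lemma closed_subspace_kernel:
  fixes \<pi> :: "'b::star_algebra \<Rightarrow> 'h \<Rightarrow> 'h"
  assumes "representation H \<pi>"
  shows "closed_subspace {x \<in> hcarrier H. \<forall>A. \<pi> A x = hzero H}"
proof -
  note R = representationD[OF assms] and B = bounded_opsD[OF representationD(1)[OF assms]]
  have eq0: "\<pi> A x = hzero H" if "x \<in> hcarrier H" "\<And>z. z \<in> hcarrier H \<Longrightarrow> hinner H (\<pi> A x) z = 0" for A x
    by (rule hext) (use that R zero_closed in auto)
  show ?thesis
    unfolding closed_subspace_def hsubspace_def
  proof (intro conjI ballI allI impI)
    show "hzero H \<in> {x \<in> hcarrier H. \<forall>A. \<pi> A x = hzero H}"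
      by (auto intro!: eq0 simp: R zero_closed)
    fix X x assume X: "hlim X x" "\<forall>n. X n \<in> {x \<in> hcarrier H. \<forall>A. \<pi> A x = hzero H}"
    have x: "x \<in> hcarrier H" using X(1) by (simp add: hlim_def)
    have "hinner H (\<pi> A x) z = 0" if "z \<in> hcarrier H" for A z
      using hlim_inner[OF hlim_op[OF R(1) X(1)] that, of A] X(2) that by (simp add: LIMSEQ_const_iff)
    then show "x \<in> {x \<in> hcarrier H. \<forall>A. \<pi> A x = hzero H}" using x by (auto intro!: eq0)
  qed (auto intro!: eq0 simp: B add_closed scale_closed zero_closed)
qed

text \<open>Conjugation by the reflection in \<open>N\<close> fixes the group representation and hence \<open>\<sigma>\<close>.\<close>

lemma host_pullback_commutant:
  fixes \<eta> :: "'g::topological_group_add \<Rightarrow> 'l::cstar_algebra multiplier" and \<sigma> :: "'l \<Rightarrow> 'h \<Rightarrow> 'h"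
  assumes host: "inj_on (host_pullback \<eta> H) (Rep H)" and s: "\<sigma> \<in> Rep H" and N: "closed_subspace N"
    and inv: "\<And>g x. x \<in> N \<Longrightarrow> rep_ext H \<sigma> (\<eta> g) x \<in> N" "\<And>g x. x \<in> N \<Longrightarrow> rep_ext H \<sigma> (star (\<eta> g)) x \<in> N"
    and x: "x \<in> N"
  shows "\<sigma> L x \<in> N"
proof -
  obtain P where P: "\<And>x. x \<in> hcarrier H \<Longrightarrow> P x \<in> N" "\<And>x. x \<in> N \<Longrightarrow> P x = x"
    "\<And>x y. x \<in> hcarrier H \<Longrightarrow> y \<in> hcarrier H \<Longrightarrow> hinner H (P x) y = hinner H x (P y)"
    "\<And>x y. x \<in> hcarrier H \<Longrightarrow> y \<in> N \<Longrightarrow> hinner H (P x) y = hinner H x y"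
    using projection_op[OF N] by metis
  have Nc: "y \<in> hcarrier H" if "y \<in> N" for y using that N by (auto simp: closed_subspace_def hsubspace_def)
  define W where "W = (\<lambda>x\<in>hcarrier H. hadd H x (hscale H (-2) (P x)))"
  have W: "W \<in> bounded_ops H" "\<And>x y. x \<in> hcarrier H \<Longrightarrow> y \<in> hcarrier H \<Longrightarrow> hinner H (W x) y = hinner H x (W y)"
    "\<And>x. x \<in> hcarrier H \<Longrightarrow> W (W x) = x"
    unfolding W_def by (rule reflection_op; use P Nc in auto)+
  note Wc = bounded_opsD(1)[OF W(1)]
  define \<psi> where "\<psi> = rep_ext H \<sigma>"
  have \<psi>: "representation H \<psi>" "\<And>b. \<psi> (embed b) = \<sigma> b"
    unfolding \<psi>_def by (rule rep_ext_representation[OF s], rule rep_ext_embed[OF s])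
  note R = representationD[OF \<psi>(1)]
  note Rs = representationD[OF Rep_representation[OF s]]
  \<comment> \<open>\<open>\<psi>'\<close> is built beside \<open>\<sigma>'\<close> because the
    group representation of \<open>\<sigma>'\<close> is read off from its extension to multipliers,
    which \<open>ext'\<close> identifies with \<open>\<psi>'\<close>.\<close>
  define \<sigma>' where "\<sigma>' b = op_mult H (op_mult H W (\<sigma> b)) W" for b
  define \<psi>' where "\<psi>' b = op_mult H (op_mult H W (\<psi> b)) W" for b
  have rep': "representation H \<sigma>'" "representation H \<psi>'"
    unfolding \<sigma>'_def \<psi>'_def
    by (rule symmetry_conjugate_representation[OF W]; use Rep_representation[OF s] \<psi> in simp)+
  have s': "\<sigma>' \<in> Rep H"
    unfolding Rep_iff
  proof (intro conjI rep' ballI impI)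
    fix z assume z: "z \<in> hcarrier H" "\<forall>b. \<forall>x\<in>hcarrier H. hinner H z (\<sigma>' b x) = 0"
    have "W z = hzero H"
    proof (rule Rep_eqI[OF s Wc[OF z(1)] zero_closed])
      fix b y assume y: "y \<in> hcarrier H"
      have "hinner H (W z) (\<sigma> b y) = hinner H z (\<sigma>' b (W y))"
        using z y by (simp add: \<sigma>'_def compose_def W(2,3) Wc Rs)
      then show "hinner H (W z) (\<sigma> b y) = hinner H (hzero H) (\<sigma> b y)" using z Wc[OF y] Rs(2)[OF y] by simp
    qed
    then have "z = W (hzero H)" using W(3)[OF z(1)] by simp
    also have "\<dots> = hzero H" by (rule hext) (simp_all add: Wc zero_closed W(2))
    finally show "z = hzero H" .
  qed
  have ext': "rep_ext H \<sigma>' = \<psi>'"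
    by (rule rep_ext_eqI[OF s' rep'(2)]) (simp add: \<psi>'_def \<sigma>'_def \<psi>(2))
  \<comment> \<open>Invariance of \<open>N\<close> under a group operator and under its adjoint
    makes the orthogonal complement invariant as well, so the projection commutes with the
    operator.\<close>
  have PU: "P (\<psi> (\<eta> g) z) = \<psi> (\<eta> g) (P z)" if z: "z \<in> hcarrier H" for g z
  proof (rule hext)
    fix y assume y: "y \<in> hcarrier H"
    have "hinner H (P (\<psi> (\<eta> g) z)) y = hinner H (\<psi> (\<eta> g) z) (P y)" using P(3) z y R by simp
    also have "\<dots> = hinner H z (\<psi> (star (\<eta> g)) (P y))" using R(6) z Nc[OF P(1)[OF y]] by simp
    also have "\<dots> = hinner H (P z) (\<psi> (star (\<eta> g)) (P y))"
      using P(4)[OF z inv(2)[OF P(1)[OF y]]] by (simp add: \<psi>_def)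
    also have "\<dots> = hinner H (\<psi> (\<eta> g) (P z)) (P y)" using R(6) Nc P(1) z y by simp
    also have "\<dots> = hinner H (P (\<psi> (\<eta> g) (P z))) y" using P(3) R Nc P(1) z y by simp
    also have "P (\<psi> (\<eta> g) (P z)) = \<psi> (\<eta> g) (P z)" using P(2)[OF inv(1)[OF P(1)[OF z]]] by (simp add: \<psi>_def)
    finally show "hinner H (P (\<psi> (\<eta> g) z)) y = hinner H (\<psi> (\<eta> g) (P z)) y" .
  qed (use R P(1) Nc z in auto)
  have "host_pullback \<eta> H \<sigma>' = host_pullback \<eta> H \<sigma>"
  proof
    fix g
    have "\<psi>' (\<eta> g) = \<psi> (\<eta> g)"
    proof (rule bounded_ops_ext[OF representationD(1)[OF rep'(2)] R(1)])
      fix z assume z: "z \<in> hcarrier H"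
      have "\<psi> (\<eta> g) (W z) = W (\<psi> (\<eta> g) z)"
        using z R Nc P(1) PU[OF z] by (simp add: W_def bounded_opsD[OF R(1)])
      then show "\<psi>' (\<eta> g) z = \<psi> (\<eta> g) z" using z W(3) R by (simp add: \<psi>'_def compose_def Wc)
    qed
    then show "host_pullback \<eta> H \<sigma>' g = host_pullback \<eta> H \<sigma> g"
      by (simp add: host_pullback_def ext' flip: \<psi>_def)
  qed
  then have eq: "\<sigma>' = \<sigma>" using host s s' by (auto dest: inj_onD)
  define y where "y = \<sigma> L x"
  have yc: "y \<in> hcarrier H" using Rs(2)[OF Nc[OF x]] by (simp add: y_def)
  \<comment> \<open>\<open>N\<close> is the eigenspace of \<open>W\<close> for -1, and
    \<open>W\<close> commutes with \<open>\<sigma> L\<close>; so \<open>\<sigma> L x\<close> is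
    again an eigenvector for -1, and thus lies in \<open>N\<close>.\<close>
  have Wx: "W x = hscale H (-1) x"
    by (rule hext) (use x Nc P(2) scale_closed in \<open>auto simp: W_def algebra_simps\<close>)
  have "W y = W (\<sigma>' L x)" by (simp add: y_def eq)
  also have "\<dots> = \<sigma> L (W x)" using Nc[OF x] by (simp add: \<sigma>'_def compose_def W(3) Wc Rs)
  also have "\<dots> = hscale H (-1) y" unfolding Wx y_def using bounded_opsD(3)[OF Rs(1) Nc[OF x]] .
  finally have Wy: "W y = hscale H (-1) y" .
  have "P y = y"
  proof (rule hext)
    fix z assume z: "z \<in> hcarrier H"
    have "hinner H (W y) z = - hinner H y z" unfolding Wy using yc z by simp
    then show "hinner H (P y) z = hinner H y z" using yc z Nc[OF P(1)[OF yc]] by (simp add: W_def)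
  qed (use yc P(1) Nc in auto)
  then show "\<sigma> L x \<in> N" using P(1)[OF yc] by (simp add: y_def)
qed

text \<open>The group part of the induced pair comes from a representation of \<L>, and the value of
  \<open>\<rho>\<close> at a generator is expressed by that representation and the algebra part.
  Together with (H2) the pair thus determines \<open>\<rho>\<close> on generators.\<close>

lemma cross_pullback_host:
  fixes \<eta> :: "'g::topological_group_add \<Rightarrow> 'l::cstar_algebra multiplier"
    and \<eta>A :: "'a::cstar_algebra \<Rightarrow> 'c::cstar_algebra multiplier" and \<eta>L :: "'l \<Rightarrow> 'c multiplier"
  assumes C: "crossed_product_host \<alpha> \<eta> \<eta>A \<eta>L" and r: "\<rho> \<in> Rep H"
  shows "rep_ext H \<rho> \<circ> \<eta>L \<in> Rep H"
    and "snd (cross_pullback \<eta> \<eta>A \<eta>L H \<rho>) = host_pullback \<eta> H (rep_ext H \<rho> \<circ> \<eta>L)"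
    and "embed c = \<eta>A A * \<eta>L L \<Longrightarrow> \<rho> c = op_mult H (fst (cross_pullback \<eta> \<eta>A \<eta>L H \<rho>) A) ((rep_ext H \<rho> \<circ> \<eta>L) L)"
proof -
  note hC = crossed_product_hostD[OF C]
  show "rep_ext H \<rho> \<circ> \<eta>L \<in> Rep H" by (rule rep_ext_comp_nondegenerate(1)[OF r hC(2,3)])
  show "snd (cross_pullback \<eta> \<eta>A \<eta>L H \<rho>) = host_pullback \<eta> H (rep_ext H \<rho> \<circ> \<eta>L)"
    by (simp add: cross_pullback_def host_pullback_def rep_ext_comp_nondegenerate(2)[OF r hC(2,3)] fun_eq_iff)
  assume "embed c = \<eta>A A * \<eta>L L"
  then have "\<rho> c = rep_ext H \<rho> (\<eta>A A * \<eta>L L)" using rep_ext_embed[OF r, of c] by simp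
  also have "\<dots> = op_mult H (rep_ext H \<rho> (\<eta>A A)) (rep_ext H \<rho> (\<eta>L L))"
    using rep_ext_representation[OF r] by (simp add: representation_def)
  finally show "\<rho> c = op_mult H (fst (cross_pullback \<eta> \<eta>A \<eta>L H \<rho>) A) ((rep_ext H \<rho> \<circ> \<eta>L) L)"
    by (simp add: cross_pullback_def)
qed

text \<open>Non-degeneracy is part of \<open>cov_Rep\<close> but is not assumed of
  \<open>\<eta>A\<close>, so it has to be extracted from that of \<open>\<rho>\<close>.\<close>

lemma cross_pullback_fst_Rep:
  fixes \<eta> :: "'g::topological_group_add \<Rightarrow> 'l::cstar_algebra multiplier"
    and \<eta>A :: "'a::cstar_algebra \<Rightarrow> 'c::cstar_algebra multiplier" and \<eta>L :: "'l \<Rightarrow> 'c multiplier"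
  assumes host: "host_algebra TYPE('h) \<eta>" and act: "cstar_action \<alpha>"
    and C: "crossed_product_host \<alpha> \<eta> \<eta>A \<eta>L" and r: "\<rho> \<in> Rep H"
  shows "rep_ext H \<rho> \<circ> \<eta>A \<in> Rep H"
proof -
  note hC = crossed_product_hostD[OF C]
  define \<psi> where "\<psi> = rep_ext H \<rho>"
  define \<sigma> where "\<sigma> = \<psi> \<circ> \<eta>L"
  define u where "u g = mult_ext \<eta>L (\<eta> g)" for g
  have \<psi>: "representation H \<psi>" "\<And>b. \<psi> (embed b) = \<rho> b"
    unfolding \<psi>_def by (rule rep_ext_representation[OF r], rule rep_ext_embed[OF r])
  note R = representationD[OF \<psi>(1)] and Rr = representationD[OF Rep_representation[OF r]]
  have s: "\<sigma> \<in> Rep H" unfolding \<sigma>_def \<psi>_def by (rule cross_pullback_host(1)[OF C r])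
  have sext: "rep_ext H \<sigma> m = \<psi> (mult_ext \<eta>L m)" for m
    unfolding \<sigma>_def \<psi>_def rep_ext_comp_nondegenerate(2)[OF r hC(2,3)] by simp
  have inj: "inj_on (host_pullback \<eta> H) (Rep H)"
    using host hilbert_space_axioms unfolding host_algebra_def by blast
  have u: "star (u g) * u g = 1" for g
  proof -
    have "star (\<eta> g) * \<eta> g = 1" using host by (simp add: host_algebra_def unitary_mult_def)
    then have "mult_ext \<eta>L (star (\<eta> g) * \<eta> g) = 1" using mult_ext_one[OF hC(2,3)] by simp
    then show ?thesis by (simp add: u_def star_homD[OF star_hom_mult_ext[OF hC(2,3)]])
  qed
  have cov: "u g * \<eta>A A * star (u g) = \<eta>A (\<alpha> g A)" for g A using hC(4) by (simp add: u_def)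
  have pi: "representation H (\<psi> \<circ> \<eta>A)" by (rule representation_comp[OF \<psi>(1) hC(1)])
  define N where "N = {x \<in> hcarrier H. \<forall>A. (\<psi> \<circ> \<eta>A) A x = hzero H}"
  have N: "closed_subspace N" unfolding N_def by (rule closed_subspace_kernel[OF pi])
  have Nc: "x \<in> hcarrier H" if "x \<in> N" for x using that by (simp add: N_def)
  have op0: "\<psi> m (hzero H) = hzero H" for m
    by (rule hext) (simp_all add: R zero_closed)
  have Nu: "\<psi> (u g) x \<in> N" if x: "x \<in> N" for g x
  proof -
    have "\<psi> (\<eta>A A) (\<psi> (u g) x) = hzero H" for A
    proof -
      \<comment> \<open>Covariance moves \<open>u g\<close> to the left only past elements
        \<open>\<eta>A (\<alpha> g B)\<close>; surjectivity brings every \<open>A\<close> into this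
        form.\<close>
      have "surj (\<alpha> g)" using act by (simp add: cstar_action_def star_iso_def bij_def)
      then obtain B where B: "A = \<alpha> g B" by (metis surjD)
      have "\<eta>A A * u g = u g * \<eta>A B * (star (u g) * u g)" by (simp only: B mult.assoc flip: cov)
      then have "\<eta>A A * u g = u g * \<eta>A B" by (simp add: u)
      then have "\<psi> (\<eta>A A) (\<psi> (u g) x) = \<psi> (u g) (\<psi> (\<eta>A B) x)"
        using R(5)[OF Nc[OF x], of "\<eta>A A" "u g"] R(5)[OF Nc[OF x], of "u g" "\<eta>A B"] by simp
      then show ?thesis using x op0 by (simp add: N_def)
    qed
    then show ?thesis using x R by (simp add: N_def)
  qed
  have Nus: "\<psi> (star (u g)) x \<in> N" if x: "x \<in> N" for g x
  proof -
    have "\<psi> (\<eta>A A) (\<psi> (star (u g)) x) = hzero H" for A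
    proof -
      have "star (u g) * \<eta>A (\<alpha> g A) = (star (u g) * u g) * \<eta>A A * star (u g)" by (simp only: mult.assoc flip: cov)
      then have "\<eta>A A * star (u g) = star (u g) * \<eta>A (\<alpha> g A)" by (simp add: u)
      then have "\<psi> (\<eta>A A) (\<psi> (star (u g)) x) = \<psi> (star (u g)) (\<psi> (\<eta>A (\<alpha> g A)) x)"
        using R(5)[OF Nc[OF x], of "\<eta>A A" "star (u g)"] R(5)[OF Nc[OF x], of "star (u g)" "\<eta>A (\<alpha> g A)"] by simp
      then show ?thesis using x op0 by (simp add: N_def)
    qed
    then show ?thesis using x R by (simp add: N_def)
  qed
  have NL: "\<sigma> L x \<in> N" if "x \<in> N" for L x
  proof (rule host_pullback_commutant[OF inj s N _ _ that])
    show "rep_ext H \<sigma> (\<eta> g) x \<in> N" if "x \<in> N" for g x using Nu[OF that] by (simp add: sext u_def)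
    show "rep_ext H \<sigma> (star (\<eta> g)) x \<in> N" if "x \<in> N" for g x
      using Nus[OF that, of g] by (simp add: sext u_def star_homD[OF star_hom_mult_ext[OF hC(2,3)]])
  qed
  \<comment> \<open>The condition is paired with the one for \<open>star c\<close>, since
    annihilating \<open>x\<close> alone is not stable under \<open>star\<close>. For a generator,
    \<open>\<sigma> L\<close> first keeps \<open>x\<close> in \<open>N\<close>; for its adjoint, the
    \<A> part annihilates \<open>x\<close> at once.\<close>
  have Nzero: "\<rho> c x = hzero H \<and> \<rho> (star c) x = hzero H" if x: "x \<in> N" for c x
  proof (rule crossed_product_host_induct[OF C, where P = "\<lambda>c. \<rho> c x = hzero H \<and> \<rho> (star c) x = hzero H"])
    have xc: "x \<in> hcarrier H" using x by (simp add: N_def)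
    have iff: "\<rho> c x = hzero H \<longleftrightarrow> (\<forall>z. z \<in> hcarrier H \<longrightarrow> hinner H (\<rho> c x) z = 0)" for c
      using hext[OF Rr(2)[OF xc, of c] zero_closed] by auto
    show "closed {c. \<rho> c x = hzero H \<and> \<rho> (star c) x = hzero H}"
      unfolding iff
    proof (intro closed_Collect_conj closed_Collect_all)
      fix z
      show "closed {c. z \<in> hcarrier H \<longrightarrow> hinner H (\<rho> c x) z = 0}"
        by (cases "z \<in> hcarrier H")
           (auto intro: closed_linear_eq bounded_linear_matrix_coeff[OF Rep_representation[OF r] xc] bounded_linear_zero)
      show "closed {c. z \<in> hcarrier H \<longrightarrow> hinner H (\<rho> (star c) x) z = 0}"
        by (cases "z \<in> hcarrier H")
           (auto intro: closed_linear_eq bounded_linear_compose[OF bounded_linear_matrix_coeff[OF Rep_representation[OF r] xc] bounded_linear_star] bounded_linear_zero)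
    qed

    show "\<rho> 0 x = hzero H \<and> \<rho> (star 0) x = hzero H" by (simp add: representation_0[OF Rep_representation[OF r] xc])
    show "\<rho> c x = hzero H \<and> \<rho> (star c) x = hzero H" if e: "embed c = \<eta>A A * \<eta>L L" for A L c
    proof
      have "\<rho> c x = \<psi> (\<eta>A A) (\<sigma> L x)" using R(5)[OF xc] by (simp add: \<sigma>_def e flip: \<psi>(2))
      then show "\<rho> c x = hzero H" using NL[OF x, of L] by (simp add: N_def)
      have "embed (star c) = \<eta>L (star L) * \<eta>A (star A)"
        by (simp add: embed_star e star_mult star_homD[OF hC(1)] star_homD[OF hC(2)])
      then have "\<rho> (star c) x = \<psi> (\<eta>L (star L)) (\<psi> (\<eta>A (star A)) x)" using R(5)[OF xc] by (simp flip: \<psi>(2))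
      then show "\<rho> (star c) x = hzero H" using x op0 by (simp add: N_def)
    qed
  qed (use x in \<open>simp_all add: N_def Rr star_add star_mult star_scaleC star_star op0[of "embed _", unfolded \<psi>(2)]\<close>)
  show ?thesis
    unfolding Rep_iff \<psi>_def[symmetric]
  proof (intro conjI pi ballI impI)
    fix z assume z: "z \<in> hcarrier H" "\<forall>b. \<forall>x\<in>hcarrier H. hinner H z ((\<psi> \<circ> \<eta>A) b x) = 0"
    have "(\<psi> \<circ> \<eta>A) A z = hzero H" for A
    proof (rule hext)
      fix x assume "x \<in> hcarrier H"
      then show "hinner H ((\<psi> \<circ> \<eta>A) A z) x = hinner H (hzero H) x"
        using z representationD(6)[OF pi] by simp
    qed (use z representationD(2)[OF pi] zero_closed in auto)
    then have zN: "z \<in> N" using z by (simp add: N_def)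
    show "z = hzero H"
    proof (rule Rep_eqI[OF r z(1) zero_closed])
      fix b x assume x: "x \<in> hcarrier H"
      have "hinner H (\<rho> (star b) z) x = hinner H z (\<rho> b x)"
        using Rr(6)[OF z(1) x, of "star b"] by (simp add: star_star)
      then show "hinner H z (\<rho> b x) = hinner H (hzero H) (\<rho> b x)" using Nzero[OF zN, of b] x Rr(2)[OF x] by simp
    qed
  qed
qed

text \<open>Places the induced pair in the set over which (CP5) of the other host quantifies. The
  operator adjoint is the image of the adjoint multiplier, so covariance is (CP3) carried over by
  \<open>rep_ext\<close>.\<close>

lemma cross_pullback_cov_Rep_host:
  fixes \<eta> :: "'g::topological_group_add \<Rightarrow> 'l::cstar_algebra multiplier"
    and \<eta>A :: "'a::cstar_algebra \<Rightarrow> 'c::cstar_algebra multiplier" and \<eta>L :: "'l \<Rightarrow> 'c multiplier"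
  assumes host: "host_algebra TYPE('h) \<eta>" and act: "cstar_action \<alpha>"
    and C: "crossed_product_host \<alpha> \<eta> \<eta>A \<eta>L" and r: "\<rho> \<in> Rep H"
  shows "cross_pullback \<eta> \<eta>A \<eta>L H \<rho> \<in> cov_Rep_host \<alpha> \<eta> H"
proof -
  note hC = crossed_product_hostD[OF C]
  define U where "U = snd (cross_pullback \<eta> \<eta>A \<eta>L H \<rho>)"
  have U: "U = host_pullback \<eta> H (rep_ext H \<rho> \<circ> \<eta>L)" unfolding U_def by (rule cross_pullback_host(2)[OF C r])
  have Ug: "U g = rep_ext H \<rho> (mult_ext \<eta>L (\<eta> g))" for g by (simp add: U_def cross_pullback_def)
  have Ur: "U \<in> host_pullback \<eta> H ` Rep H" unfolding U by (rule imageI[OF cross_pullback_host(1)[OF C r]])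
  then have "U \<in> group_Rep H" using host hilbert_space_axioms unfolding host_algebra_def by blast
  moreover have "op_mult H (op_mult H (U g) ((rep_ext H \<rho> \<circ> \<eta>A) A)) (op_adj H (U g)) = (rep_ext H \<rho> \<circ> \<eta>A) (\<alpha> g A)" for g A
  proof -
    note rep = rep_ext_representation[OF r]
    have "is_adjoint H (U g) (rep_ext H \<rho> (star (mult_ext \<eta>L (\<eta> g))))"
      using rep by (simp add: representation_def Ug)
    then have adj: "op_adj H (U g) = rep_ext H \<rho> (star (mult_ext \<eta>L (\<eta> g)))"
      using representationD(1)[OF rep] by (intro op_adj_eq) (simp_all add: Ug)
    have "rep_ext H \<rho> (mult_ext \<eta>L (\<eta> g) * \<eta>A A * star (mult_ext \<eta>L (\<eta> g))) = rep_ext H \<rho> (\<eta>A (\<alpha> g A))"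
      by (simp only: hC(4))
    then show ?thesis unfolding adj using rep by (simp add: representation_def Ug)
  qed
  ultimately have "(rep_ext H \<rho> \<circ> \<eta>A, U) \<in> cov_Rep \<alpha> H"
    using cross_pullback_fst_Rep[OF assms] unfolding cov_Rep_def by blast
  moreover have "cross_pullback \<eta> \<eta>A \<eta>L H \<rho> = (rep_ext H \<rho> \<circ> \<eta>A, U)" by (simp add: U_def cross_pullback_def)
  ultimately show ?thesis using Ur by (simp add: cov_Rep_host_def)
qed

end

section \<open>Matching the representations of two hosts\<close>

lemma rep_match_cross_range:
  fixes \<eta> :: "'g::topological_group_add \<Rightarrow> 'l::cstar_algebra multiplier"
    and \<eta>A :: "'a::cstar_algebra \<Rightarrow> 'c::cstar_algebra multiplier" and \<eta>A' :: "'a \<Rightarrow> 'd::cstar_algebra multiplier"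
    and H :: "'h hilbert"
  assumes host: "host_algebra TYPE('h) \<eta>" and C: "crossed_product_host \<alpha> \<eta> \<eta>A \<eta>L"
    and D: "crossed_product_host \<alpha> \<eta> \<eta>A' \<eta>L'" and H: "hilbert_space H"
    and le: "cross_range \<eta> \<eta>A \<eta>L H \<subseteq> cross_range \<eta> \<eta>A' \<eta>L' H" and r: "\<rho> \<in> Rep H"
  shows "\<exists>\<rho>'. representation H \<rho>' \<and> rep_match \<eta>A \<eta>L \<eta>A' \<eta>L' \<rho> \<rho>'"
proof -
  interpret hilbert_space H by (rule H)
  have "cross_pullback \<eta> \<eta>A \<eta>L H \<rho> \<in> cross_range \<eta> \<eta>A' \<eta>L' H" using le r by (auto simp: cross_range_def)
  then obtain \<rho>' where r': "\<rho>' \<in> Rep H" and eq: "cross_pullback \<eta> \<eta>A \<eta>L H \<rho> = cross_pullback \<eta> \<eta>A' \<eta>L' H \<rho>'"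
    by (auto simp: cross_range_def)
  have "inj_on (host_pullback \<eta> H) (Rep H)" using host H unfolding host_algebra_def by blast
  moreover have "host_pullback \<eta> H (rep_ext H \<rho> \<circ> \<eta>L) = host_pullback \<eta> H (rep_ext H \<rho>' \<circ> \<eta>L')"
    using cross_pullback_host(2)[OF C r] cross_pullback_host(2)[OF D r'] eq by simp
  ultimately have s: "rep_ext H \<rho> \<circ> \<eta>L = rep_ext H \<rho>' \<circ> \<eta>L'"
    using cross_pullback_host(1)[OF C r] cross_pullback_host(1)[OF D r'] by (auto dest: inj_onD)
  have "rep_match \<eta>A \<eta>L \<eta>A' \<eta>L' \<rho> \<rho>'"
    unfolding rep_match_def
  proof (intro allI impI)
    fix A L c d assume c: "embed c = \<eta>A A * \<eta>L L" and d: "embed d = \<eta>A' A * \<eta>L' L"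
    show "\<rho> c = \<rho>' d"
      unfolding cross_pullback_host(3)[OF C r c] cross_pullback_host(3)[OF D r' d] eq s ..
  qed
  then show ?thesis using Rep_representation[OF r'] by blast
qed

text \<open>Injectivity evaluates \<open>host_inverse\<close> at \<open>U\<close> as the
  representation of \<L> contained in \<open>\<rho>\<close>; the values prescribed by (CP5) are
  therefore those of \<open>\<rho>\<close> on corresponding generators.\<close>

lemma rep_match_full:
  fixes \<eta> :: "'g::topological_group_add \<Rightarrow> 'l::cstar_algebra multiplier"
    and \<eta>A :: "'a::cstar_algebra \<Rightarrow> 'c::cstar_algebra multiplier" and \<eta>A' :: "'a \<Rightarrow> 'd::cstar_algebra multiplier"
    and H :: "'h hilbert"
  assumes host: "host_algebra TYPE('h) \<eta>" and act: "cstar_action \<alpha>" and C: "crossed_product_host \<alpha> \<eta> \<eta>A \<eta>L"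
    and D: "full_crossed_product_host TYPE('h) \<alpha> \<eta> \<eta>A' \<eta>L'" and H: "hilbert_space H" and r: "\<rho> \<in> Rep H"
  shows "\<exists>\<rho>'. representation H \<rho>' \<and> rep_match \<eta>A \<eta>L \<eta>A' \<eta>L' \<rho> \<rho>'"
proof -
  interpret hilbert_space H by (rule H)
  obtain \<pi> U where pU: "cross_pullback \<eta> \<eta>A \<eta>L H \<rho> = (\<pi>, U)" by fastforce
  have "(\<pi>, U) \<in> cov_Rep_host \<alpha> \<eta> H" using cross_pullback_cov_Rep_host[OF host act C r] by (simp add: pU)
  then obtain \<rho>' where \<rho>': "representation H \<rho>'"
    "\<And>A L d. embed d = \<eta>A' A * \<eta>L' L \<Longrightarrow> \<rho>' d = op_mult H (\<pi> A) (host_inverse \<eta> H U L)"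
    using D H unfolding full_crossed_product_host_def by blast
  have "inj_on (host_pullback \<eta> H) (Rep H)" using host H unfolding host_algebra_def by blast
  then have "host_inverse \<eta> H U = rep_ext H \<rho> \<circ> \<eta>L"
    using cross_pullback_host(1,2)[OF C r] pU by (simp add: host_inverse_def)
  then have "rep_match \<eta>A \<eta>L \<eta>A' \<eta>L' \<rho> \<rho>'"
    unfolding rep_match_def using cross_pullback_host(3)[OF C r] \<rho>'(2) pU by simp
  then show ?thesis using \<rho>'(1) by blast
qed

theorem theorem4p8:
  fixes \<alpha> :: "'g::topological_group_add \<Rightarrow> 'a::cstar_algebra \<Rightarrow> 'a"
    and \<eta> :: "'g \<Rightarrow> 'l::cstar_algebra multiplier"
    and \<eta>A :: "'a \<Rightarrow> 'c::cstar_algebra multiplier"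
    and \<eta>L :: "'l \<Rightarrow> 'c multiplier"
    and \<eta>A' :: "'a \<Rightarrow> 'd::cstar_algebra multiplier"
    and \<eta>L' :: "'l \<Rightarrow> 'd multiplier"
  assumes "hilbert_universe TYPE('h) TYPE('c)" and "hilbert_universe TYPE('h) TYPE('d)"
    and "host_algebra TYPE('h) \<eta>"
    and "cstar_action \<alpha>"
    and "crossed_product_host \<alpha> \<eta> \<eta>A \<eta>L"
    and "crossed_product_host \<alpha> \<eta> \<eta>A' \<eta>L'"
  shows "((\<forall>H :: 'h hilbert. hilbert_space H \<longrightarrow>
              cross_range \<eta> \<eta>A \<eta>L H = cross_range \<eta> \<eta>A' \<eta>L' H) \<longrightarrow>
            (\<exists>!\<phi>. host_iso \<eta>A \<eta>L \<eta>A' \<eta>L' \<phi>)) \<and>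
         (full_crossed_product_host TYPE('h) \<alpha> \<eta> \<eta>A \<eta>L \<and>
          full_crossed_product_host TYPE('h) \<alpha> \<eta> \<eta>A' \<eta>L' \<longrightarrow>
            (\<exists>\<phi>. host_iso \<eta>A \<eta>L \<eta>A' \<eta>L' \<phi>))"
proof -
  \<comment> \<open>Each direction of the matching yields one inequality between the norms of
    related elements, using GNS representations of one host and then of the other. The two claims
    differ only in how the matches are obtained.\<close>
  have ex: "\<exists>\<phi>. host_iso \<eta>A \<eta>L \<eta>A' \<eta>L' \<phi>"
    if m: "\<And>(H :: 'h hilbert) \<rho>. hilbert_space H \<Longrightarrow> \<rho> \<in> Rep H \<Longrightarrow>
        \<exists>\<rho>'. representation H \<rho>' \<and> rep_match \<eta>A \<eta>L \<eta>A' \<eta>L' \<rho> \<rho>'"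
      and m': "\<And>(H :: 'h hilbert) \<rho>. hilbert_space H \<Longrightarrow> \<rho> \<in> Rep H \<Longrightarrow>
        \<exists>\<rho>'. representation H \<rho>' \<and> rep_match \<eta>A' \<eta>L' \<eta>A \<eta>L \<rho> \<rho>'"
  proof (rule host_iso_exists[OF assms(5,6)])
    fix c d assume R: "host_rel \<eta>A \<eta>L \<eta>A' \<eta>L' c d"
    show "norm c = norm d"
      using host_rel_norm_le[OF assms(1) m R] host_rel_norm_le[OF assms(2) m' host_rel_sym[OF R]] by simp
  qed
  show ?thesis
  proof (intro conjI impI)
    assume eq: "\<forall>H :: 'h hilbert. hilbert_space H \<longrightarrow> cross_range \<eta> \<eta>A \<eta>L H = cross_range \<eta> \<eta>A' \<eta>L' H"
    have "\<exists>\<phi>. host_iso \<eta>A \<eta>L \<eta>A' \<eta>L' \<phi>"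
      by (rule ex; rule rep_match_cross_range[OF assms(3)]) (use assms eq in auto)
    then show "\<exists>!\<phi>. host_iso \<eta>A \<eta>L \<eta>A' \<eta>L' \<phi>" using host_iso_unique[OF assms(5)] by blast
  next
    assume "full_crossed_product_host TYPE('h) \<alpha> \<eta> \<eta>A \<eta>L \<and> full_crossed_product_host TYPE('h) \<alpha> \<eta> \<eta>A' \<eta>L'"
    then show "\<exists>\<phi>. host_iso \<eta>A \<eta>L \<eta>A' \<eta>L' \<phi>"
      by (intro ex; intro rep_match_full[OF assms(3,4)]) (use assms in auto)
  qed
qed

end
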